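(* Let $\mathcal G_\infty=(V_\infty,E_\infty)$ be an infinite, locally finite, connected, undirected graph without self-loops, with positive symmetric edge weights $W$, approximated by finite subgraphs with vertex sets $V_n\uparrow V_\infty$, and let $(\boldsymbol\beta_i)_{i\in V_\infty}$, $\mathcal F_n$, $u^{(n)}$, $\hat G^{(n)}$ be as defined in the context. For all $\theta\in(-\infty,0]^{V_\infty}$ having only finitely many non-zero entries, the process $$M^{(n)}(\theta)=e^{\langle\theta^{(n)},e^{u^{(n)}}\rangle-\frac12\langle\theta^{(n)},\hat G^{(n)}\theta^{(n)}\rangle},\qquad n\in\mathbb{N},$$ is a martingale with respect to the filtration $(\mathcal F_n)_{n\in\mathbb{N}}$ on $(\Omega_\infty,\mathcal F_\infty,\mu^W_\infty)$. Here $\theta^{(n)}\in(-\infty,0]^{\tilde V_n}$ is given by $\theta^{(n)}_i=\theta_i$ for $i\in V_n$ and $\theta^{(n)}_{\delta_n}=\sum_{j\in V_\infty\setminus V_n}\theta_j$, $e^{u^{(n)}}=(e^{u^{(n)}_i})_{i\in\tilde V_n}$, and $\langle\cdot,\cdot\rangle$ is the euclidean scalar product on $\mathbb{R}^{\tilde V_n}$.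
   Context: **Finite graphs.** Let $(\tilde V,\tilde E)$ be a finite, undirected, connected graph without self-loops, $\delta\in\tilde V$, $V=\tilde V\setminus\{\delta\}$, with weights $W_{ij}=W_{ji}>0$ for $(i\sim j)\in\tilde E$, $W_{ij}=0$ if $i\not\sim j$. Let $U_V=\{u\in\mathbb{R}^{\tilde V}:u_\delta=0\}$, $\Omega_V=U_V\times U_V\ni(u,s)$. The matrix $A^W(u)\in\mathbb{R}^{\tilde V\times\tilde V}$ has entries $-W_{ij}e^{u_i+u_j}$ for $i\neq j$ and $\sum_{k\in\tilde V}W_{ik}e^{u_i+u_k}$ for $i=j$; $A^W_{VV}(u)$ is the submatrix with row and column $\delta$ deleted (positive definite). The $H^{2|2}$ measure is the probability measure on $\Omega_V$ $$\mu^W(du\,ds)=e^{-\frac12 s^tA^W(u)s}\det A^W_{VV}(u)\prod_{(i\sim j)\in\tilde E}e^{-W_{ij}[\cosh(u_i-u_j)-1]}\prod_{i\in V}e^{-u_i}\frac{du_ids_i}{2\pi}$$ (known to have total mass 1). Put $\hat G^V_{ij}(u)=e^{u_i}(A^W_{VV}(u)^{-1})_{ij}e^{u_j}$ for $i,j\in V$, and $\hat G^V_{ij}(u)=0$ if $i=\delta$ or $j=\delta$. Put $\beta^V(u)=(\beta_i(u))_{i\in V}$, $\beta_i(u)=\frac12\sum_{j\in\tilde V:j\sim i}W_{ij}e^{u_j-u_i}$. It is known that $u\in U_V$ is a measurable function of $\beta^V(u)$: there is a measurable $f_V^W:\mathbb{R}^V\to\mathbb{R}^{\tilde V}$ with $u=f_V^W(\beta^V(u))$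 for all $u\in U_V$ (namely, on the range of $\beta^V$, $u_\delta=0$ and $(e^{u_i})_{i\in V}=H_\beta^{-1}(W_{i\delta})_{i\in V}$ with $(H_\beta)_{ij}=2\beta_i\delta_{ij}-W_{ij}$, $i,j\in V$; extended arbitrarily measurably elsewhere). **Infinite graph.** $W_{ij}=W_{ji}>0$ for $(i\sim j)\in E_\infty$, $W_{ij}=0$ otherwise. $V_n\uparrow V_\infty$ are finite vertex sets (increasing with union $V_\infty$), $E_n=\{(i\sim j)\in E_\infty:i,j\in V_n\}$. The wired graph $\tilde{\mathcal G}_n=(\tilde V_n,\tilde E_n)$ is obtained by collapsing $V_\infty\setminus V_n$ to one vertex $\delta_n$: $\tilde V_n=V_n\cup\{\delta_n\}$, $\tilde E_n=E_n\cup\{(i\sim\delta_n):i\in V_n,\ \exists j\in V_\infty\setminus V_n,\ (i\sim j)\in E_\infty\}$, with weights $W^{(n)}_{ij}=W_{ij}$ for $i,j\in V_n$, $W^{(n)}_{i\delta_n}=W^{(n)}_{\delta_ni}=\sum_{j\in V_\infty\setminus V_n}W_{ij}$ for $i\in V_n$, $W^{(n)}_{\delta_n\delta_n}=0$. Let $\mu_n^W$ be the $H^{2|2}$ measure on $\tilde{\mathcal G}_n$ with weights $W^{(n)}$ and reference vertex $\delta_n$. It is known that the laws of $\beta^{V_n}$ under $\mu_n^W$ are consistent (the law of $\beta^{V_{n+1}}|_{V_n}$ under $\mu^W_{n+1}$ equals the law of $\beta^{V_n}$ under $\mu^W_n$), so by Kolmogorov's extension theorem there are random variables $(\boldsymbol\beta_i)_{i\in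 V_\infty}$ on a probability space $(\Omega_\infty,\mathcal F_\infty,\mu_\infty^W)$ such that for every $n$ the law of $\boldsymbol\beta^{(n)}=(\boldsymbol\beta_i)_{i\in V_n}$ under $\mu_\infty^W$ equals the law of $\beta^{V_n}$ under $\mu_n^W$. Define $\mathcal F_n=\sigma(\boldsymbol\beta^{(n)})$, $u^{(n)}=(u^{(n)}_i)_{i\in\tilde V_n}=f_{V_n}(\boldsymbol\beta^{(n)})$ (the function $f$ above for the graph $\tilde{\mathcal G}_n$ with weights $W^{(n)}$), and $\hat G^{(n)}=\hat G^{V_n}(u^{(n)})$, the Green's function of $\tilde{\mathcal G}_n$ with weights $W^{(n)}$ evaluated at $u^{(n)}$. *)

theory Defs
  imports "HOL-Probability.Probability"
begin

section \<open>Linear algebra over a finite index set\<close>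

text \<open>
  Matrices indexed by a finite set V are functions of two arguments that are only read on V.
  The determinant is the same Leibniz sum as in the library, where the index set has to be a type.
\<close>

definition det_on :: "'a set \<Rightarrow> ('a \<Rightarrow> 'a \<Rightarrow> real) \<Rightarrow> real" where
  "det_on V A = (\<Sum>p | p permutes V. of_int (sign p) * (\<Prod>i\<in>V. A i (p i)))"

definition inv_on :: "'a set \<Rightarrow> ('a \<Rightarrow> 'a \<Rightarrow> real) \<Rightarrow> 'a \<Rightarrow> 'a \<Rightarrow> real" where
  "inv_on V A = (THE B.
     (\<forall>i\<in>V. \<forall>j\<in>V. (\<Sum>k\<in>V. A i k * B k j) = (if i = j then 1 else 0)) \<and>
     (\<forall>i\<in>V. \<forall>j\<in>V. (\<Sum>k\<in>V. B i k * A k j) = (if i = j then 1 else 0)) \<and>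
     (\<forall>i j. i \<notin> V \<or> j \<notin> V \<longrightarrow> B i j = 0))"

section \<open>The measure on a finite weighted graph\<close>

text \<open>
  Below, Vt is the full vertex set, \<delta> the reference vertex, E the edge set and W the weights.
  An undirected graph is given by a symmetric relation E, so each edge occurs in E as two ordered
  pairs.
\<close>

definition pinned_configs :: "'a set \<Rightarrow> 'a \<Rightarrow> ('a \<Rightarrow> real) set" where
  "pinned_configs Vt \<delta> = {u \<in> Vt \<rightarrow>\<^sub>E UNIV. u \<delta> = 0}"

text \<open>
  Lebesgue measure on the space of pinned configurations, regarded as a measure on all functions on
  Vt: the coordinate at \<delta> carries the unit point mass at 0.
\<close>

definition pinned_lebesgue :: "'a set \<Rightarrow> 'a \<Rightarrow> ('a \<Rightarrow> real) measure" where
  "pinned_lebesgue Vt \<delta> = (\<Pi>\<^sub>M i\<in>Vt. if i = \<delta> then return borel 0 else lborel)"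

definition A_mat :: "'a set \<Rightarrow> ('a \<Rightarrow> 'a \<Rightarrow> real) \<Rightarrow> ('a \<Rightarrow> real) \<Rightarrow> 'a \<Rightarrow> 'a \<Rightarrow> real" where
  "A_mat Vt W u i j =
     (if i = j then \<Sum>k\<in>Vt. W i k * exp (u i + u k) else - W i j * exp (u i + u j))"

text \<open>
  The factor 1/2 in the product over E compensates for each edge being counted in both
  orientations.
\<close>

definition H22_density ::
  "'a set \<Rightarrow> ('a \<times> 'a) set \<Rightarrow> 'a \<Rightarrow> ('a \<Rightarrow> 'a \<Rightarrow> real) \<Rightarrow> ('a \<Rightarrow> real) \<Rightarrow> ('a \<Rightarrow> real) \<Rightarrow> real" where
  "H22_density Vt E \<delta> W u s =
     exp (- (1 / 2) * (\<Sum>i\<in>Vt. \<Sum>j\<in>Vt. s i * A_mat Vt W u i j * s j))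
     * det_on (Vt - {\<delta>}) (A_mat Vt W u)
     * (\<Prod>(i, j)\<in>E. exp (- (1 / 2) * (W i j * (cosh (u i - u j) - 1))))
     * (\<Prod>i\<in>Vt - {\<delta>}. exp (- u i) / (2 * pi))"

definition H22_measure ::
  "'a set \<Rightarrow> ('a \<times> 'a) set \<Rightarrow> 'a \<Rightarrow> ('a \<Rightarrow> 'a \<Rightarrow> real) \<Rightarrow> (('a \<Rightarrow> real) \<times> ('a \<Rightarrow> real)) measure" where
  "H22_measure Vt E \<delta> W =
     density (pinned_lebesgue Vt \<delta> \<Otimes>\<^sub>M pinned_lebesgue Vt \<delta>)
       (\<lambda>(u, s). ennreal (H22_density Vt E \<delta> W u s))"

definition G_hat ::
  "'a set \<Rightarrow> 'a \<Rightarrow> ('a \<Rightarrow> 'a \<Rightarrow> real) \<Rightarrow> ('a \<Rightarrow> real) \<Rightarrow> 'a \<Rightarrow> 'a \<Rightarrow> real" where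
  "G_hat Vt \<delta> W u i j =
     (if i = \<delta> \<or> j = \<delta> then 0
      else exp (u i) * inv_on (Vt - {\<delta>}) (A_mat Vt W u) i j * exp (u j))"

definition beta_of ::
  "'a set \<Rightarrow> ('a \<times> 'a) set \<Rightarrow> 'a \<Rightarrow> ('a \<Rightarrow> 'a \<Rightarrow> real) \<Rightarrow> ('a \<Rightarrow> real) \<Rightarrow> 'a \<Rightarrow> real" where
  "beta_of Vt E \<delta> W u =
     (\<lambda>i\<in>Vt - {\<delta>}. 1 / 2 * (\<Sum>j | j \<in> Vt \<and> (i, j) \<in> E. W i j * exp (u j - u i)))"

text \<open>
  A measurable function recovering u from \<beta>; its values outside the range of \<beta> are
  unconstrained.
\<close>

definition recovers_u ::
  "'a set \<Rightarrow> ('a \<times> 'a) set \<Rightarrow> 'a \<Rightarrow> ('a \<Rightarrow> 'a \<Rightarrow> real) \<Rightarrow> (('a \<Rightarrow> real) \<Rightarrow> 'a \<Rightarrow> real) \<Rightarrow> bool" where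
  "recovers_u Vt E \<delta> W f \<longleftrightarrow>
     f \<in> (\<Pi>\<^sub>M i\<in>Vt - {\<delta>}. borel) \<rightarrow>\<^sub>M (\<Pi>\<^sub>M i\<in>Vt. borel) \<and>
     (\<forall>u \<in> pinned_configs Vt \<delta>. f (beta_of Vt E \<delta> W u) = u)"

section \<open>Infinite weighted graphs and wired boundary conditions\<close>

locale infinite_weighted_graph =
  fixes V :: "'a set" and E :: "('a \<times> 'a) set" and W :: "'a \<Rightarrow> 'a \<Rightarrow> real"
  assumes infinite_vertices: "infinite V"
    and edges_subset: "E \<subseteq> V \<times> V"
    and undirected: "sym E"
    and no_loops: "irrefl E"
    and locally_finite: "\<And>i. i \<in> V \<Longrightarrow> finite (E `` {i})"
    and connected_graph: "\<And>i j. i \<in> V \<Longrightarrow> j \<in> V \<Longrightarrow> (i, j) \<in> E\<^sup>*"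
    and weight_sym: "\<And>i j. W i j = W j i"
    and weight_pos: "\<And>i j. (i, j) \<in> E \<Longrightarrow> W i j > 0"
    and weight_zero: "\<And>i j. (i, j) \<notin> E \<Longrightarrow> W i j = 0"

text \<open>
  V is the infinite vertex set, U a finite subset, and \<delta> the vertex, not in U, to which V - U is
  collapsed. Any label outside U may be used for it. The sums over V - U have only finitely many
  non-zero terms.
\<close>

definition wired_edges :: "'a set \<Rightarrow> ('a \<times> 'a) set \<Rightarrow> 'a set \<Rightarrow> 'a \<Rightarrow> ('a \<times> 'a) set" where
  "wired_edges V E U \<delta> =
     {(i, j). (i, j) \<in> E \<and> i \<in> U \<and> j \<in> U}
     \<union> {(i, \<delta>) | i. i \<in> U \<and> (\<exists>j\<in>V - U. (i, j) \<in> E)}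
     \<union> {(\<delta>, i) | i. i \<in> U \<and> (\<exists>j\<in>V - U. (i, j) \<in> E)}"

definition wired_weight ::
  "'a set \<Rightarrow> ('a \<Rightarrow> 'a \<Rightarrow> real) \<Rightarrow> 'a set \<Rightarrow> 'a \<Rightarrow> 'a \<Rightarrow> 'a \<Rightarrow> real" where
  "wired_weight V W U \<delta> i j =
     (if i \<in> U \<and> j \<in> U then W i j
      else if i \<in> U \<and> j = \<delta> then \<Sum>\<^sub>\<infinity>k\<in>V - U. W i k
      else if i = \<delta> \<and> j \<in> U then \<Sum>\<^sub>\<infinity>k\<in>V - U. W j k
      else 0)"

definition wired_theta :: "'a set \<Rightarrow> ('a \<Rightarrow> real) \<Rightarrow> 'a set \<Rightarrow> 'a \<Rightarrow> 'a \<Rightarrow> real" where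
  "wired_theta V \<theta> U \<delta> i =
     (if i \<in> U then \<theta> i else if i = \<delta> then \<Sum>\<^sub>\<infinity>j\<in>V - U. \<theta> j else 0)"

definition wired_H22 ::
  "'a set \<Rightarrow> ('a \<times> 'a) set \<Rightarrow> ('a \<Rightarrow> 'a \<Rightarrow> real) \<Rightarrow> 'a set \<Rightarrow> 'a \<Rightarrow> (('a \<Rightarrow> real) \<times> ('a \<Rightarrow> real)) measure"
  where
  "wired_H22 V E W U \<delta> =
     H22_measure (insert \<delta> U) (wired_edges V E U \<delta>) \<delta> (wired_weight V W U \<delta>)"

definition wired_beta ::
  "'a set \<Rightarrow> ('a \<times> 'a) set \<Rightarrow> ('a \<Rightarrow> 'a \<Rightarrow> real) \<Rightarrow> 'a set \<Rightarrow> 'a \<Rightarrow> ('a \<Rightarrow> real) \<Rightarrow> 'a \<Rightarrow> real" where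
  "wired_beta V E W U \<delta> =
     beta_of (insert \<delta> U) (wired_edges V E U \<delta>) \<delta> (wired_weight V W U \<delta>)"

definition wired_recovers_u ::
  "'a set \<Rightarrow> ('a \<times> 'a) set \<Rightarrow> ('a \<Rightarrow> 'a \<Rightarrow> real) \<Rightarrow> 'a set \<Rightarrow> 'a \<Rightarrow> (('a \<Rightarrow> real) \<Rightarrow> 'a \<Rightarrow> real) \<Rightarrow> bool"
  where
  "wired_recovers_u V E W U \<delta> f \<longleftrightarrow>
     recovers_u (insert \<delta> U) (wired_edges V E U \<delta>) \<delta> (wired_weight V W U \<delta>) f"

text \<open>The exponential functional of a configuration u on the wired graph.\<close>

definition exp_functional ::
  "'a set \<Rightarrow> ('a \<Rightarrow> 'a \<Rightarrow> real) \<Rightarrow> ('a \<Rightarrow> real) \<Rightarrow> 'a set \<Rightarrow> 'a \<Rightarrow> ('a \<Rightarrow> real) \<Rightarrow> real" where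
  "exp_functional V W \<theta> U \<delta> u =
     (let \<theta>' = wired_theta V \<theta> U \<delta>;
          G = G_hat (insert \<delta> U) \<delta> (wired_weight V W U \<delta>) u
      in exp ((\<Sum>i\<in>insert \<delta> U. \<theta>' i * exp (u i))
              - 1 / 2 * (\<Sum>i\<in>insert \<delta> U. \<theta>' i * (\<Sum>j\<in>insert \<delta> U. G i j * \<theta>' j))))"

section \<open>Martingales in discrete time\<close>

definition is_martingale ::
  "'w measure \<Rightarrow> (nat \<Rightarrow> 'w measure) \<Rightarrow> (nat \<Rightarrow> 'w \<Rightarrow> real) \<Rightarrow> bool" where
  "is_martingale P F X \<longleftrightarrow>
     filtration (space P) F \<and>
     (\<forall>n. subalgebra P (F n)) \<and>
     (\<forall>n. X n \<in> borel_measurable (F n)) \<and>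
     (\<forall>n. integrable P (X n)) \<and>
     (\<forall>m n. m \<le> n \<longrightarrow> (AE \<omega> in P. real_cond_exp P (F m) (X n) \<omega> = X m \<omega>))"

end

theory Submission
  imports Defs
begin

text \<open>
  The idea is to describe everything in the variable \<beta>. For a finite vertex set U, weights W and a
  boundary term \<eta> (the total weight \<eta> i from i to the wiring point), let H be the matrix with diagonal
  entries 2 \<beta> i and off-diagonal entries -W i j, and let G be its inverse. Along \<beta> = \<beta>(u) one has
  exp u = G \<eta>, and G is the Green's function in the exponential functional.

  First, under the H22 measure \<beta> has an explicit density with respect to Lebesgue measure. It lives on
  the \<beta> for which H is positive definite and is there
  (2/\<pi>)^(n/2) exp(-<1,H1>/2 - <\<eta>,G\<eta>>/2 + <\<eta>,1>) / sqrt(det H), called \<open>beta_density\<close> below. The s-variables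
  contribute a Gaussian integral (\<open>nn_integral_multivariate_Gaussian\<close>), and the map from u to \<beta> has
  Jacobian determinant 2^(-n) det H in absolute value (\<open>beta_map_change_of_variables\<close>).

  Second, this family of densities, with \<eta> as parameter, is stable under taking marginals: integrating
  out \<beta> v replaces \<eta> by \<eta> + W(.,v) (\<open>beta_density_marginal\<close>). By a Schur complement at v this is the
  one-dimensional inverse Gaussian integral (\<open>nn_integral_inverse_Gaussian\<close>). In particular every member
  of the family has mass 1.

  Third, M is an exponential change of \<eta>. Since <\<theta>,e^u> - <\<theta>,G\<theta>>/2 = <\<theta>,G\<eta>> - <\<theta>,G\<theta>>/2 + const, completing
  the square gives: M times the density with parameter \<eta> equals a constant times the density with
  parameter \<eta> - \<theta> (\<open>exp_functional_tilt\<close>). The constant is the exponential of the sum of all \<theta> j and so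
  is the same for all n, and \<eta> - \<theta> is again nonnegative because \<theta> \<le> 0.

  Enlarging V(m) to V(n) lowers \<eta> by the weights to V(n) - V(m), which is exactly what the
  marginals restore. Hence the measure with density M(n), restricted to events about \<beta> on V(m), does not
  depend on n \<ge> m, and this is the martingale property.

  All facts in n dimensions are proved by induction on the vertex set, adding one vertex at a
  time through a Schur complement, so that only one-dimensional integrals have to be evaluated.
\<close>

section \<open>Matrices over a finite index set\<close>

definition bilinear_form :: "'a set \<Rightarrow> ('a \<Rightarrow> 'a \<Rightarrow> real) \<Rightarrow> ('a \<Rightarrow> real) \<Rightarrow> ('a \<Rightarrow> real) \<Rightarrow> real" where
  "bilinear_form V A x y = (\<Sum>i\<in>V. \<Sum>j\<in>V. x i * A i j * y j)"

definition pos_def_on :: "'a set \<Rightarrow> ('a \<Rightarrow> 'a \<Rightarrow> real) \<Rightarrow> bool" where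
  "pos_def_on V A \<longleftrightarrow> (\<forall>i\<in>V. \<forall>j\<in>V. A i j = A j i) \<and>
     (\<forall>x. (\<exists>i\<in>V. x i \<noteq> 0) \<longrightarrow> 0 < bilinear_form V A x x)"

definition inverse_on :: "'a set \<Rightarrow> ('a \<Rightarrow> 'a \<Rightarrow> real) \<Rightarrow> ('a \<Rightarrow> 'a \<Rightarrow> real) \<Rightarrow> bool" where
  "inverse_on V A B \<longleftrightarrow>
     (\<forall>i\<in>V. \<forall>j\<in>V. (\<Sum>k\<in>V. A i k * B k j) = (if i = j then 1 else 0)) \<and>
     (\<forall>i\<in>V. \<forall>j\<in>V. (\<Sum>k\<in>V. B i k * A k j) = (if i = j then 1 else 0)) \<and>
     (\<forall>i j. i \<notin> V \<or> j \<notin> V \<longrightarrow> B i j = 0)"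

lemma bilinear_form_cong:
  assumes "\<And>i j. i \<in> V \<Longrightarrow> j \<in> V \<Longrightarrow> A i j = A' i j" "\<And>i. i \<in> V \<Longrightarrow> x i = x' i" "\<And>i. i \<in> V \<Longrightarrow> y i = y' i"
  shows "bilinear_form V A x y = bilinear_form V A' x' y'"
  unfolding bilinear_form_def using assms by (auto intro!: sum.cong)

lemma pos_def_on_cong:
  assumes "\<And>i j. i \<in> V \<Longrightarrow> j \<in> V \<Longrightarrow> A i j = A' i j"
  shows "pos_def_on V A \<longleftrightarrow> pos_def_on V A'"
  using bilinear_form_cong[of V A A', OF assms] assms unfolding pos_def_on_def by auto

lemma pos_def_on_form_pos:
  "pos_def_on V A \<Longrightarrow> i \<in> V \<Longrightarrow> x i \<noteq> 0 \<Longrightarrow> 0 < bilinear_form V A x x"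
  unfolding pos_def_on_def by blast

lemma pos_def_on_form_nonneg: "pos_def_on V A \<Longrightarrow> 0 \<le> bilinear_form V A x x"
  using pos_def_on_form_pos[of V A _ x] unfolding bilinear_form_def
  by (cases "\<exists>i\<in>V. x i \<noteq> 0") (auto simp: less_imp_le)

lemma inv_on_cong:
  assumes "\<And>i j. i \<in> V \<Longrightarrow> j \<in> V \<Longrightarrow> A i j = A' i j"
  shows "inv_on V A = inv_on V A'"
proof -
  have "(\<Sum>k\<in>V. A i k * B k j) = (\<Sum>k\<in>V. A' i k * B k j)"
    "(\<Sum>k\<in>V. B i k * A k j) = (\<Sum>k\<in>V. B i k * A' k j)" if "i \<in> V" "j \<in> V" for B :: "'a \<Rightarrow> 'a \<Rightarrow> real" and i j
    using that assms by (auto intro!: sum.cong)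
  then show ?thesis unfolding inv_on_def by (intro arg_cong[where f = The] ext) auto
qed

lemma det_on_cong:
  assumes "\<And>i j. i \<in> V \<Longrightarrow> j \<in> V \<Longrightarrow> A i j = A' i j"
  shows "det_on V A = det_on V A'"
  unfolding det_on_def
  by (intro sum.cong refl arg_cong2[where f = "(*)"] prod.cong assms) (auto simp: permutes_in_image)

lemma sum_delta_mult:
  fixes f :: "'a \<Rightarrow> real"
  assumes "finite V" "i \<in> V"
  shows "(\<Sum>k\<in>V. (if i = k then 1 else 0) * f k) = f i" "(\<Sum>k\<in>V. f k * (if k = i then 1 else 0)) = f i"
    "(\<Sum>k\<in>V. (if k = i then 1 else 0) * f k) = f i" "(\<Sum>k\<in>V. f k * (if i = k then 1 else 0)) = f i"
  using assms by (auto simp: if_distrib[of "\<lambda>x. x * _"] if_distrib[of "\<lambda>x. _ * x"] cong: if_cong)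

lemma inverse_on_unique:
  assumes "finite V" "inverse_on V A B" "inverse_on V A C"
  shows "B = C"
proof (intro ext)
  fix i j
  show "B i j = C i j"
  proof (cases "i \<in> V \<and> j \<in> V")
    case True
    have "B i j = (\<Sum>k\<in>V. B i k * (\<Sum>l\<in>V. A k l * C l j))"
      using assms True by (auto simp: inverse_on_def sum_delta_mult cong: sum.cong)
    also have "\<dots> = (\<Sum>l\<in>V. (\<Sum>k\<in>V. B i k * A k l) * C l j)"
      unfolding sum_distrib_left sum_distrib_right by (subst sum.swap) (simp add: mult.assoc)
    also have "\<dots> = C i j"
      using assms True by (auto simp: inverse_on_def sum_delta_mult cong: sum.cong)
    finally show ?thesis .
  next
    case False
    then show ?thesis using assms by (auto simp: inverse_on_def)
  qed
qed

lemma inv_on_eqI: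
  assumes "finite V" "inverse_on V A B"
  shows "inv_on V A = B"
  unfolding inv_on_def inverse_on_def[symmetric]
  by (rule the_equality, rule assms(2)) (erule inverse_on_unique[OF assms(1) _ assms(2)])

lemma inverse_on_symmetric:
  assumes "finite V" "inverse_on V A B" "\<And>i j. i \<in> V \<Longrightarrow> j \<in> V \<Longrightarrow> A i j = A j i"
  shows "B i j = B j i"
proof -
  have "(\<Sum>k\<in>V. A i k * B j k) = (\<Sum>k\<in>V. B j k * A k i)" 
    "(\<Sum>k\<in>V. B k i * A k j) = (\<Sum>k\<in>V. A j k * B k i)" if "i \<in> V" "j \<in> V" for i j
    using assms(3) that by (auto intro!: sum.cong)
  then have "inverse_on V A (\<lambda>i j. B j i)"
    using assms(2) unfolding inverse_on_def by auto
  from inverse_on_unique[OF assms(1,2) this] show ?thesis by (rule fun_cong[OF fun_cong])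
qed

lemma inverse_on_solve:
  assumes "finite V" "inverse_on V A B" "i \<in> V" "\<And>j. j \<in> V \<Longrightarrow> (\<Sum>k\<in>V. A j k * x k) = y j"
  shows "(\<Sum>j\<in>V. B i j * y j) = x i"
proof -
  have "(\<Sum>j\<in>V. B i j * y j) = (\<Sum>j\<in>V. B i j * (\<Sum>k\<in>V. A j k * x k))"
    using assms(4) by simp
  also have "\<dots> = (\<Sum>k\<in>V. (\<Sum>j\<in>V. B i j * A j k) * x k)"
    unfolding sum_distrib_left sum_distrib_right by (subst sum.swap) (simp add: mult.assoc)
  also have "\<dots> = x i"
    using assms(1-3) by (auto simp: inverse_on_def sum_delta_mult cong: sum.cong)
  finally show ?thesis .
qed

lemma inverse_on_apply:
  assumes "finite V" "inverse_on V A B" "i \<in> V"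
  shows "(\<Sum>k\<in>V. A i k * (\<Sum>j\<in>V. B k j * y j)) = y i"
proof -
  have "(\<Sum>k\<in>V. A i k * (\<Sum>j\<in>V. B k j * y j)) = (\<Sum>j\<in>V. (\<Sum>k\<in>V. A i k * B k j) * y j)"
    unfolding sum_distrib_left sum_distrib_right by (subst sum.swap) (simp add: mult.assoc)
  also have "\<dots> = y i"
    using assms by (auto simp: inverse_on_def sum_delta_mult cong: sum.cong)
  finally show ?thesis .
qed

section \<open>Determinants and Schur complements\<close>

lemma prod_replace_row:
  assumes "finite V" "r \<in> V"
  shows "(\<Prod>i\<in>V. (if i = r then h i else g i :: real)) = h r * (\<Prod>i\<in>V - {r}. g i)"
  using assms by (subst prod.remove[of _ r]) (auto intro!: prod.cong)

lemma det_on_row_linear: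
  assumes "finite V" "r \<in> V"
  shows "det_on V (\<lambda>i j. if i = r then f j + (\<Sum>k\<in>K. c k * g k j) else A i j) =
    det_on V (\<lambda>i j. if i = r then f j else A i j) +
    (\<Sum>k\<in>K. c k * det_on V (\<lambda>i j. if i = r then g k j else A i j))"
  unfolding det_on_def prod_replace_row[OF assms] sum_distrib_left
  by (subst sum.swap) (simp add: sum.distrib[symmetric] algebra_simps sum_distrib_left sum_distrib_right)

text \<open>Composing permutations with the transposition of r and s is a sign-reversing involution of the
  Leibniz sum that keeps the products.\<close>
lemma det_on_equal_rows:
  assumes "finite V" "r \<in> V" "s \<in> V" "r \<noteq> s" "\<And>j. j \<in> V \<Longrightarrow> A r j = A s j"
  shows "det_on V A = 0"
proof -
  let ?t = "Transposition.transpose r s"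
  let ?g = "\<lambda>p. of_int (sign p) * (\<Prod>i\<in>V. A i (p i))"
  have t: "?t permutes V" using assms by (simp add: permutes_swap_id)
  have "?g (p \<circ> ?t) = - ?g p" if p: "p permutes V" for p
  proof -
    have "sign (p \<circ> ?t) = - sign p"
      using p t assms by (subst sign_compose) (auto simp: sign_swap_id intro: permutation_permutes[THEN iffD2])
    moreover have "(\<Prod>i\<in>V. A i ((p \<circ> ?t) i)) = (\<Prod>i\<in>V. A (?t i) (p (?t i)))"
    proof (intro prod.cong refl)
      fix i assume i: "i \<in> V"
      have "p (?t i) \<in> V"
        using permutes_in_image[OF t, of i] permutes_in_image[OF p] i by auto
      then show "A i ((p \<circ> ?t) i) = A (?t i) (p (?t i))"
        using assms(5) by (auto simp: Transposition.transpose_def)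
    qed
    moreover have "\<dots> = (\<Prod>i\<in>V. A i (p i))"
      using prod.permute[OF t, of "\<lambda>i. A i (p i)"] by (simp add: comp_def)
    ultimately show ?thesis by simp
  qed
  then have "(\<Sum>p | p permutes V. ?g (p \<circ> ?t)) = - det_on V A"
    unfolding det_on_def by (simp add: sum_negf)
  moreover have "(\<Sum>p | p permutes V. ?g (p \<circ> ?t)) = det_on V A"
    unfolding det_on_def
    by (rule sum.reindex_bij_witness[of _ "\<lambda>p. p \<circ> ?t" "\<lambda>p. p \<circ> ?t"])
       (auto simp: comp_assoc intro: permutes_compose[OF t])
  ultimately show ?thesis by simp
qed

lemma det_on_insert_zero_row:
  assumes V: "finite V" "v \<notin> V" and zero: "\<And>k. k \<in> V \<Longrightarrow> A v k = 0"
  shows "det_on (insert v V) A = A v v * det_on V A"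
proof -
  let ?g = "\<lambda>p. of_int (sign p) * (\<Prod>i\<in>insert v V. A i (p i))"
  have "?g (Transposition.transpose v b \<circ> q) = 0" if "b \<in> V" "q permutes V" for b q
    using that V zero by (auto simp: permutes_not_in)
  then have "det_on (insert v V) A = (\<Sum>q | q permutes V. ?g q)"
    unfolding det_on_def sum_over_permutations_insert[OF V] using V
    by (subst sum.insert) (auto intro!: sum.neutral simp del: prod.insert)
  also have "\<dots> = (\<Sum>q | q permutes V. A v v * (of_int (sign q) * (\<Prod>i\<in>V. A i (q i))))"
    using V by (intro sum.cong refl) (auto simp: permutes_not_in)
  finally show ?thesis by (simp add: det_on_def sum_distrib_left)
qed

text \<open>Subtracting from row v the combination of the other rows with coefficients a clears it except for
  the Schur complement in position v.\<close>
lemma det_on_Schur: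
  assumes V: "finite V" "v \<notin> V" and a: "\<And>k. k \<in> V \<Longrightarrow> (\<Sum>j\<in>V. a j * A j k) = A v k"
  shows "det_on (insert v V) A = det_on V A * (A v v - (\<Sum>j\<in>V. a j * A j v))"
proof -
  let ?I = "insert v V"
  define f where "f j = A v j - (\<Sum>k\<in>V. a k * A k j)" for j
  have I: "finite ?I" "v \<in> ?I" using V by auto
  have "det_on ?I A = det_on ?I (\<lambda>i j. if i = v then f j + (\<Sum>k\<in>V. a k * A k j) else A i j)"
    by (intro det_on_cong) (auto simp: f_def)
  also have "\<dots> = det_on ?I (\<lambda>i j. if i = v then f j else A i j) +
      (\<Sum>k\<in>V. a k * det_on ?I (\<lambda>i j. if i = v then A k j else A i j))"
    by (rule det_on_row_linear[OF I])
  also have "(\<Sum>k\<in>V. a k * det_on ?I (\<lambda>i j. if i = v then A k j else A i j)) = 0"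
  proof (intro sum.neutral ballI)
    fix k assume "k \<in> V"
    then show "a k * det_on ?I (\<lambda>i j. if i = v then A k j else A i j) = 0"
      using V by (subst det_on_equal_rows[of ?I v k]) auto
  qed
  also have "det_on ?I (\<lambda>i j. if i = v then f j else A i j) =
      f v * det_on V (\<lambda>i j. if i = v then f j else A i j)"
    by (subst det_on_insert_zero_row[OF V]) (auto simp: f_def a)
  also have "det_on V (\<lambda>i j. if i = v then f j else A i j) = det_on V A"
    using V by (intro det_on_cong) auto
  finally show ?thesis by (simp add: f_def)
qed

lemma det_on_diag_scale:
  assumes "finite V"
  shows "det_on V (\<lambda>i j. d i * A i j * d j) = (\<Prod>i\<in>V. d i)\<^sup>2 * det_on V A"
proof -
  have "(\<Prod>i\<in>V. d i * A i (p i) * d (p i)) = (\<Prod>i\<in>V. d i)\<^sup>2 * (\<Prod>i\<in>V. A i (p i))" if "p permutes V" for p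
    using prod.permute[OF that, of d] by (simp add: prod.distrib power2_eq_square comp_def)
  then show ?thesis unfolding det_on_def sum_distrib_left
    by (intro sum.cong) (auto simp: algebra_simps)
qed

text \<open>Completing the square in the coordinate v.\<close>
lemma bilinear_form_Schur:
  assumes V: "finite V" "v \<notin> V" and sym: "\<And>i j. i \<in> insert v V \<Longrightarrow> j \<in> insert v V \<Longrightarrow> A i j = A j i"
    and a: "\<And>i. i \<in> V \<Longrightarrow> (\<Sum>j\<in>V. A i j * a j) = A i v"
  shows "bilinear_form (insert v V) A x x =
    bilinear_form V A (\<lambda>i. x i + x v * a i) (\<lambda>i. x i + x v * a i) + (A v v - (\<Sum>i\<in>V. A v i * a i)) * (x v)\<^sup>2"
proof -
  have s: "A v i = A i v" if "i \<in> V" for i using that sym by auto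
  have 1: "bilinear_form V A x a = (\<Sum>i\<in>V. x i * A i v)" for x
    unfolding bilinear_form_def using a by (simp add: mult.assoc sum_distrib_left[symmetric])
  have 2: "bilinear_form V A a x = (\<Sum>i\<in>V. x i * A i v)" for x
    unfolding 1[symmetric] unfolding bilinear_form_def
    by (subst sum.swap) (use sym in \<open>auto intro!: sum.cong simp: mult_ac\<close>)
  have "bilinear_form V A (\<lambda>i. x i + x v * a i) (\<lambda>i. x i + x v * a i) =
    bilinear_form V A x x + x v * bilinear_form V A x a + x v * bilinear_form V A a x + x v * x v * bilinear_form V A a a"
    unfolding bilinear_form_def by (simp add: algebra_simps sum.distrib sum_distrib_left)
  also have "\<dots> = bilinear_form V A x x + 2 * x v * (\<Sum>i\<in>V. x i * A i v) + (x v)\<^sup>2 * (\<Sum>i\<in>V. a i * A i v)"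
    unfolding 1 2 by (simp add: power2_eq_square)
  finally have *: "bilinear_form V A (\<lambda>i. x i + x v * a i) (\<lambda>i. x i + x v * a i) = \<dots>" .
  have "bilinear_form (insert v V) A x x = bilinear_form V A x x + 2 * x v * (\<Sum>i\<in>V. x i * A i v) + A v v * (x v)\<^sup>2"
  proof -
    have row: "(\<Sum>j\<in>V. x v * A v j * x j) = x v * (\<Sum>i\<in>V. x i * A i v)"
      unfolding sum_distrib_left by (intro sum.cong refl) (simp add: s)
    have col: "(\<Sum>i\<in>V. x i * A i v * x v) = x v * (\<Sum>i\<in>V. x i * A i v)"
      unfolding sum_distrib_left by (intro sum.cong refl) simp
    have "bilinear_form (insert v V) A x x =
        (x v * A v v * x v + (\<Sum>j\<in>V. x v * A v j * x j)) + ((\<Sum>i\<in>V. x i * A i v * x v) + bilinear_form V A x x)"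
      unfolding bilinear_form_def using V by (simp add: sum.distrib)
    then show ?thesis unfolding row col by (simp add: power2_eq_square)
  qed
  moreover have "(\<Sum>i\<in>V. A v i * a i) = (\<Sum>i\<in>V. a i * A i v)"
    by (intro sum.cong refl) (simp add: s)
  ultimately show ?thesis unfolding * by (simp add: left_diff_distrib)
qed

lemma pos_def_on_insert_iff:
  assumes V: "finite V" "v \<notin> V" and sym: "\<And>i j. i \<in> insert v V \<Longrightarrow> j \<in> insert v V \<Longrightarrow> A i j = A j i"
    and a: "\<And>i. i \<in> V \<Longrightarrow> (\<Sum>j\<in>V. A i j * a j) = A i v"
  shows "pos_def_on (insert v V) A \<longleftrightarrow> pos_def_on V A \<and> 0 < A v v - (\<Sum>i\<in>V. A v i * a i)"
proof -
  let ?c = "A v v - (\<Sum>i\<in>V. A v i * a i)"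
  have S: "bilinear_form (insert v V) A x x =
      bilinear_form V A (\<lambda>i. x i + x v * a i) (\<lambda>i. x i + x v * a i) + ?c * (x v)\<^sup>2" for x
    by (rule bilinear_form_Schur[OF V sym a])
  show ?thesis
  proof safe
    assume pd: "pos_def_on (insert v V) A"
    show "pos_def_on V A"
      unfolding pos_def_on_def
    proof (intro conjI allI impI)
      fix x :: "'a \<Rightarrow> real" assume "\<exists>i\<in>V. x i \<noteq> 0"
      then obtain i where "i \<in> V" "x i \<noteq> 0" by blast
      then have "0 < bilinear_form (insert v V) A (x(v := 0)) (x(v := 0))"
        using V by (intro pos_def_on_form_pos[OF pd, of i]) auto
      also have "\<dots> = bilinear_form V A x x"
        using V by (subst S) (auto intro!: bilinear_form_cong)
      finally show "0 < bilinear_form V A x x" .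
    qed (use sym in auto)
    \<comment> \<open>This vector is orthogonal to V with respect to A, and the form takes the value of the pivot on it.\<close>
    let ?x = "\<lambda>i. if i = v then 1 else - a i"
    have "0 < bilinear_form (insert v V) A ?x ?x"
      by (rule pos_def_on_form_pos[OF pd, of v]) auto
    also have "\<dots> = bilinear_form V A (\<lambda>_. 0) (\<lambda>_. 0) + ?c"
      using V by (subst S) (auto intro!: bilinear_form_cong)
    finally show "0 < ?c" by (simp add: bilinear_form_def)
  next
    assume pd: "pos_def_on V A" and c: "0 < ?c"
    show "pos_def_on (insert v V) A"
      unfolding pos_def_on_def
    proof (intro conjI allI impI)
      fix x :: "'a \<Rightarrow> real" assume x: "\<exists>i\<in>insert v V. x i \<noteq> 0"
      show "0 < bilinear_form (insert v V) A x x"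
      proof (cases "x v = 0")
        case True
        then obtain i where "i \<in> V" "x i \<noteq> 0" using x by auto
        then have "0 < bilinear_form V A x x" by (rule pos_def_on_form_pos[OF pd])
        then show ?thesis using True unfolding S by simp
      next
        case False
        then have "0 < ?c * (x v)\<^sup>2" using c by auto
        then show ?thesis unfolding S using pos_def_on_form_nonneg[OF pd] by (simp add: add_nonneg_pos)
      qed
    qed (use sym in auto)
  qed
qed

text \<open>
  The block inverse formula: B, extended by zero, plus the rank one matrix formed from (a, -1) and
  divided by the Schur complement c.
\<close>
definition Schur_inverse :: "'a set \<Rightarrow> 'a \<Rightarrow> ('a \<Rightarrow> real) \<Rightarrow> real \<Rightarrow> ('a \<Rightarrow> 'a \<Rightarrow> real) \<Rightarrow> 'a \<Rightarrow> 'a \<Rightarrow> real" where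
  "Schur_inverse V v a c B i j =
     (if i \<in> insert v V \<and> j \<in> insert v V then
       (if i = v \<or> j = v then 0 else B i j) + (if i = v then -1 else a i) * (if j = v then -1 else a j) / c
      else 0)"

lemma inverse_on_insert:
  assumes V: "finite V" "v \<notin> V" and sym: "\<And>i j. i \<in> insert v V \<Longrightarrow> j \<in> insert v V \<Longrightarrow> A i j = A j i"
    and B: "inverse_on V A B"
    and a: "\<And>i. i \<in> V \<Longrightarrow> (\<Sum>j\<in>V. A i j * a j) = A i v"
    and c: "c = A v v - (\<Sum>i\<in>V. A v i * a i)" "c \<noteq> 0"
  shows "inverse_on (insert v V) A (Schur_inverse V v a c B)"
proof -
  let ?B = "Schur_inverse V v a c B"
  have symB: "?B i j = ?B j i" for i j
    using inverse_on_symmetric[OF V(1) B, of i j] sym by (auto simp: Schur_inverse_def)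
  have aB: "(\<Sum>j\<in>V. A v j * B j k) = a k" if "k \<in> V" for k
  proof -
    have "(\<Sum>j\<in>V. A v j * B j k) = (\<Sum>j\<in>V. B k j * A j v)"
      using sym inverse_on_symmetric[OF V(1) B] by (auto intro!: sum.cong)
    then show ?thesis using inverse_on_solve[OF V(1) B that a] by simp
  qed
  have R: "(\<Sum>k\<in>insert v V. A i k * ?B k j) = (if i = j then 1 else 0)"
    if ij: "i \<in> insert v V" "j \<in> insert v V" for i j
  proof -
    define aj where "aj = (if j = v then -1 else a j) / c"
    have "(\<Sum>k\<in>insert v V. A i k * ?B k j) =
        - A i v * aj + (\<Sum>k\<in>V. A i k * ((if j = v then 0 else B k j) + a k * aj))"
      using V ij by (auto simp: Schur_inverse_def aj_def intro!: sum.cong)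
    also have "\<dots> = (if j = v then 0 else (\<Sum>k\<in>V. A i k * B k j)) + ((\<Sum>k\<in>V. A i k * a k) - A i v) * aj"
      by (simp add: algebra_simps sum.distrib sum_distrib_left)
    also have "\<dots> = (if i = j then 1 else 0)"
    proof (cases "i = v")
      case True
      have "(\<Sum>k\<in>V. A i k * a k) - A i v = - c" using c True by simp
      then show ?thesis using True ij c(2) aB by (auto simp: aj_def)
    next
      case False
      then show ?thesis using ij a B V by (auto simp: inverse_on_def)
    qed
    finally show ?thesis .
  qed
  moreover have "(\<Sum>k\<in>insert v V. ?B i k * A k j) = (if i = j then 1 else 0)"
    if ij: "i \<in> insert v V" "j \<in> insert v V" for i j
  proof -
    have "(\<Sum>k\<in>insert v V. ?B i k * A k j) = (\<Sum>k\<in>insert v V. A j k * ?B k i)"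
      using sym ij by (intro sum.cong refl) (simp add: symB[of i] mult.commute)
    then show ?thesis using R[of j i] ij by auto
  qed
  ultimately show ?thesis unfolding inverse_on_def by (auto simp: Schur_inverse_def)
qed

lemma pos_def_on_subset:
  assumes "finite V" "U \<subseteq> V" "pos_def_on V A"
  shows "pos_def_on U A"
  unfolding pos_def_on_def
proof (intro conjI allI impI)
  fix x :: "'a \<Rightarrow> real" assume "\<exists>i\<in>U. x i \<noteq> 0"
  then obtain k where k: "k \<in> U" "x k \<noteq> 0" by blast
  let ?x = "\<lambda>i. if i \<in> U then x i else 0"
  have "0 < bilinear_form V A ?x ?x"
    by (rule pos_def_on_form_pos[OF assms(3), of k]) (use k assms(2) in auto)
  also have "\<dots> = (\<Sum>i\<in>U. \<Sum>j\<in>V. ?x i * A i j * ?x j)"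
    unfolding bilinear_form_def using assms by (intro sum.mono_neutral_right) auto
  also have "\<dots> = (\<Sum>i\<in>U. \<Sum>j\<in>U. ?x i * A i j * ?x j)"
    using assms by (intro sum.cong refl sum.mono_neutral_right) auto
  also have "\<dots> = bilinear_form U A x x" unfolding bilinear_form_def by simp
  finally show "0 < bilinear_form U A x x" .
next
  show "\<forall>i\<in>U. \<forall>j\<in>U. A i j = A j i"
    using assms(2,3) unfolding pos_def_on_def by blast
qed

text \<open>The inverse is built up one index at a time; the pivots do not vanish because they are positive.\<close>
lemma pos_def_on_inverse:
  assumes "finite V" "pos_def_on V A"
  shows "inverse_on V A (inv_on V A)"
proof -
  have "\<exists>B. inverse_on V A B"
    using assms
  proof (induction V)
    case empty
    then show ?case by (auto simp: inverse_on_def intro!: exI[of _ "\<lambda>_ _. 0"])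
  next
    case (insert v V)
    have sym: "A i j = A j i" if "i \<in> insert v V" "j \<in> insert v V" for i j
      using insert.prems that by (auto simp: pos_def_on_def)
    obtain B where B: "inverse_on V A B"
      using insert pos_def_on_subset[of "insert v V" V A] by auto
    define a where "a i = (\<Sum>j\<in>V. B i j * A j v)" for i
    have a: "(\<Sum>j\<in>V. A i j * a j) = A i v" if "i \<in> V" for i
      unfolding a_def by (rule inverse_on_apply[OF insert(1) B that])
    have "A v v - (\<Sum>i\<in>V. A v i * a i) \<noteq> 0"
      using insert pos_def_on_insert_iff[OF insert(1,2) sym a] by auto
    from inverse_on_insert[OF insert(1,2) sym B a refl this] show ?case by blast
  qed
  then obtain B where B: "inverse_on V A B" ..
  show ?thesis unfolding inv_on_eqI[OF assms(1) B] by (rule B)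
qed

text \<open>The data of the Schur complement when v is added to V: the solution a of A a = A(.,v) on V, and the
  remaining pivot.\<close>
definition Schur_vec :: "'a set \<Rightarrow> 'a \<Rightarrow> ('a \<Rightarrow> 'a \<Rightarrow> real) \<Rightarrow> 'a \<Rightarrow> real" where
  "Schur_vec V v A i = (\<Sum>j\<in>V. inv_on V A i j * A j v)"

definition Schur_pivot :: "'a set \<Rightarrow> 'a \<Rightarrow> ('a \<Rightarrow> 'a \<Rightarrow> real) \<Rightarrow> real" where
  "Schur_pivot V v A = A v v - (\<Sum>i\<in>V. A v i * Schur_vec V v A i)"

lemma Schur_vec_solves:
  assumes "finite V" "pos_def_on V A" "i \<in> V"
  shows "(\<Sum>j\<in>V. A i j * Schur_vec V v A j) = A i v"
  unfolding Schur_vec_def by (rule inverse_on_apply[OF assms(1) pos_def_on_inverse[OF assms(1,2)] assms(3)])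

context
  fixes V :: "'a set" and v :: 'a and A :: "'a \<Rightarrow> 'a \<Rightarrow> real"
  assumes V: "finite V" "v \<notin> V" and sym: "\<And>i j. i \<in> insert v V \<Longrightarrow> j \<in> insert v V \<Longrightarrow> A i j = A j i"
begin

lemma pos_def_on_insert:
  "pos_def_on (insert v V) A \<longleftrightarrow> pos_def_on V A \<and> 0 < Schur_pivot V v A"
proof (cases "pos_def_on V A")
  case True
  show ?thesis unfolding Schur_pivot_def
    by (rule pos_def_on_insert_iff[OF V]) (erule (1) sym, erule Schur_vec_solves[OF V(1) True])
next
  case False
  moreover have "\<not> pos_def_on (insert v V) A"
    using pos_def_on_subset[of "insert v V" V A] V False by blast
  ultimately show ?thesis by blast
qed

lemma det_on_insert:
  assumes "pos_def_on V A"
  shows "det_on (insert v V) A = det_on V A * Schur_pivot V v A"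
proof -
  let ?a = "Schur_vec V v A"
  have "(\<Sum>j\<in>V. ?a j * A j k) = A v k" if "k \<in> V" for k
  proof -
    have "(\<Sum>j\<in>V. ?a j * A j k) = (\<Sum>j\<in>V. A k j * ?a j)"
      using that by (intro sum.cong refl) (simp add: sym[of k])
    then show ?thesis using Schur_vec_solves[OF V(1) assms that, of v] sym[of k v] that by simp
  qed
  from det_on_Schur[OF V this]
  have "det_on (insert v V) A = det_on V A * (A v v - (\<Sum>j\<in>V. ?a j * A j v))" .
  moreover have "(\<Sum>j\<in>V. ?a j * A j v) = (\<Sum>j\<in>V. A v j * ?a j)"
    by (intro sum.cong refl) (simp add: sym[of v])
  ultimately show ?thesis by (simp add: Schur_pivot_def)
qed

lemma inv_on_insert:
  assumes "pos_def_on (insert v V) A"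
  shows "inv_on (insert v V) A = Schur_inverse V v (Schur_vec V v A) (Schur_pivot V v A) (inv_on V A)"
proof -
  have pd: "pos_def_on V A" "0 < Schur_pivot V v A" using assms pos_def_on_insert by blast+
  show ?thesis
  proof (rule inv_on_eqI[OF _ inverse_on_insert[OF V]])
    show "inverse_on V A (inv_on V A)" by (rule pos_def_on_inverse[OF V(1) pd(1)])
  qed (use V(1) pd(2) in \<open>auto simp: Schur_pivot_def intro: sym Schur_vec_solves[OF V(1) pd(1)]\<close>)
qed

lemma bilinear_form_insert:
  assumes "pos_def_on V A"
  shows "bilinear_form (insert v V) A x x =
    bilinear_form V A (\<lambda>i. x i + x v * Schur_vec V v A i) (\<lambda>i. x i + x v * Schur_vec V v A i)
      + Schur_pivot V v A * (x v)\<^sup>2"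
  unfolding Schur_pivot_def
  by (rule bilinear_form_Schur[OF V]) (erule (1) sym, erule Schur_vec_solves[OF V(1) assms])

lemma bilinear_form_inv_on_insert:
  assumes "pos_def_on (insert v V) A"
  shows "bilinear_form (insert v V) (inv_on (insert v V) A) x x =
    bilinear_form V (inv_on V A) x x + (x v - (\<Sum>i\<in>V. Schur_vec V v A i * x i))\<^sup>2 / Schur_pivot V v A"
proof -
  let ?c = "Schur_pivot V v A" and ?B = "inv_on V A"
  define a where "a = Schur_vec V v A"
  define s where "s = (\<Sum>i\<in>V. a i * x i)"
  have "bilinear_form (insert v V) (inv_on (insert v V) A) x x =
      (x v)\<^sup>2 / ?c - x v * s / ?c - x v * s / ?c + (\<Sum>i\<in>V. \<Sum>j\<in>V. x i * (?B i j + a i * a j / ?c) * x j)"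
  proof -
    have 1: "(\<Sum>j\<in>insert v V. x v * Schur_inverse V v a ?c ?B v j * x j) = (x v)\<^sup>2 / ?c - x v * s / ?c"
    proof -
      have "(\<Sum>j\<in>V. x v * Schur_inverse V v a ?c ?B v j * x j) = (\<Sum>j\<in>V. - (x v / ?c) * (a j * x j))"
        using V by (intro sum.cong) (auto simp: Schur_inverse_def)
      also have "\<dots> = - (x v * s / ?c)"
        unfolding s_def sum_distrib_left[symmetric] by simp
      finally show ?thesis
        unfolding sum.insert[OF V] by (simp add: Schur_inverse_def power2_eq_square)
    qed
    have 2: "(\<Sum>j\<in>insert v V. x i * Schur_inverse V v a ?c ?B i j * x j) =
        - (x v / ?c) * (a i * x i) + (\<Sum>j\<in>V. x i * (?B i j + a i * a j / ?c) * x j)" if "i \<in> V" for i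
    proof -
      have "(\<Sum>j\<in>V. x i * Schur_inverse V v a ?c ?B i j * x j) = (\<Sum>j\<in>V. x i * (?B i j + a i * a j / ?c) * x j)"
        using V that by (intro sum.cong) (auto simp: Schur_inverse_def)
      moreover have "i \<noteq> v" using V that by auto
      ultimately show ?thesis unfolding sum.insert[OF V] using that by (simp add: Schur_inverse_def)
    qed
    have "bilinear_form (insert v V) (Schur_inverse V v a ?c ?B) x x =
        (x v)\<^sup>2 / ?c - x v * s / ?c + (\<Sum>i\<in>V. \<Sum>j\<in>insert v V. x i * Schur_inverse V v a ?c ?B i j * x j)"
      unfolding bilinear_form_def using V 1 by simp
    also have "(\<Sum>i\<in>V. \<Sum>j\<in>insert v V. x i * Schur_inverse V v a ?c ?B i j * x j) =
        - (x v / ?c) * s + (\<Sum>i\<in>V. \<Sum>j\<in>V. x i * (?B i j + a i * a j / ?c) * x j)"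
      unfolding s_def sum_distrib_left sum.distrib[symmetric] by (intro sum.cong refl 2)
    finally show ?thesis unfolding inv_on_insert[OF assms] a_def by simp
  qed
  also have "(\<Sum>i\<in>V. \<Sum>j\<in>V. x i * (?B i j + a i * a j / ?c) * x j) = bilinear_form V ?B x x + s\<^sup>2 / ?c"
    unfolding bilinear_form_def s_def power2_eq_square sum_product
    by (simp add: algebra_simps sum.distrib sum_divide_distrib)
  finally show ?thesis unfolding s_def a_def
    by (simp add: power2_eq_square algebra_simps add_divide_distrib diff_divide_distrib)
qed

end

lemma det_on_empty: "det_on {} A = 1"
  unfolding det_on_def by simp

lemma det_on_pos:
  assumes "finite V" "pos_def_on V A"
  shows "0 < det_on V A"
  using assms
proof (induction V)
  case (insert v V)
  have sym: "A i j = A j i" if "i \<in> insert v V" "j \<in> insert v V" for i j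
    using insert.prems that by (auto simp: pos_def_on_def)
  have "pos_def_on V A \<and> 0 < Schur_pivot V v A"
    using insert(4) pos_def_on_insert[OF insert(1,2) sym] by simp
  then show ?case using insert(3) det_on_insert[OF insert(1,2) sym] by auto
qed (simp add: det_on_empty)

text \<open>The block inverse formula only adds nonnegative terms, as the Schur vector is nonpositive.\<close>
lemma inv_on_nonneg:
  assumes "finite V" "pos_def_on V A" "\<And>i j. i \<in> V \<Longrightarrow> j \<in> V \<Longrightarrow> i \<noteq> j \<Longrightarrow> A i j \<le> 0"
  shows "0 \<le> inv_on V A i j"
  using assms
proof (induction V arbitrary: i j)
  case empty
  have "inverse_on {} A (\<lambda>_ _. 0)" by (auto simp: inverse_on_def)
  then show ?case by (subst inv_on_eqI) auto
next
  case (insert v V)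
  have sym: "A i j = A j i" if "i \<in> insert v V" "j \<in> insert v V" for i j
    using insert.prems that by (auto simp: pos_def_on_def)
  have pd: "pos_def_on V A" "0 < Schur_pivot V v A"
    using insert(4) pos_def_on_insert[OF insert(1,2) sym] by auto
  have IH: "0 \<le> inv_on V A i j" for i j
    using pd insert by blast
  then have "Schur_vec V v A i \<le> 0" for i
    unfolding Schur_vec_def using insert by (auto intro!: sum_nonpos mult_nonneg_nonpos)
  moreover have "inv_on (insert v V) A =
      Schur_inverse V v (Schur_vec V v A) (Schur_pivot V v A) (inv_on V A)"
    by (rule inv_on_insert[OF insert(1,2) sym insert(4)])
  ultimately show ?case using pd IH
    by (auto simp: Schur_inverse_def mult_nonpos_nonpos intro!: add_nonneg_nonneg divide_nonneg_pos)
qed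

lemma pos_def_on_diag_scale:
  assumes "pos_def_on V A" "\<And>i. i \<in> V \<Longrightarrow> d i \<noteq> 0"
  shows "pos_def_on V (\<lambda>i j. d i * A i j * d j)"
  unfolding pos_def_on_def
proof (intro conjI allI impI)
  fix x :: "'a \<Rightarrow> real" assume "\<exists>i\<in>V. x i \<noteq> 0"
  then obtain k where "k \<in> V" "x k \<noteq> 0" by blast
  then have "0 < bilinear_form V A (\<lambda>i. x i * d i) (\<lambda>i. x i * d i)"
    using assms(2) by (intro pos_def_on_form_pos[OF assms(1), of k]) auto
  then show "0 < bilinear_form V (\<lambda>i j. d i * A i j * d j) x x"
    by (simp add: bilinear_form_def mult_ac)
qed (use assms in \<open>auto simp: pos_def_on_def\<close>)

lemma inv_on_diag_scale:
  assumes "finite V" "pos_def_on V A" "\<And>i. i \<in> V \<Longrightarrow> d i \<noteq> 0" "i \<in> V" "j \<in> V"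
  shows "d i * inv_on V (\<lambda>i j. d i * A i j * d j) i j * d j = inv_on V A i j"
proof -
  have B: "inverse_on V A (inv_on V A)" by (rule pos_def_on_inverse[OF assms(1,2)])
  have 1: "(\<Sum>k\<in>V. d i * A i k * d k * (inv_on V A k j / (d k * d j))) = (d i / d j) * (\<Sum>k\<in>V. A i k * inv_on V A k j)"
    "(\<Sum>k\<in>V. inv_on V A i k / (d i * d k) * (d k * A k j * d j)) = (d j / d i) * (\<Sum>k\<in>V. inv_on V A i k * A k j)"
    for i j unfolding sum_distrib_left using assms(3) by (auto intro!: sum.cong)
  have "inverse_on V (\<lambda>i j. d i * A i j * d j) (\<lambda>i j. inv_on V A i j / (d i * d j))"
    using B assms(3) unfolding inverse_on_def 1 by auto
  from inv_on_eqI[OF assms(1) this] show ?thesis using assms by simp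
qed

section \<open>Measurability and integrals\<close>

lemma inv_on_empty: "inv_on {} A = (\<lambda>_ _. 0)"
  by (rule inv_on_eqI) (auto simp: inverse_on_def)

text \<open>
  Where A is not positive definite the inverse may fail to exist, so it is replaced by zero there. Both
  statements are needed together: the pivot that decides about positivity on a larger set is made
  from the inverse on the smaller one.
\<close>
lemma measurable_pos_def_on_inv_on:
  fixes A :: "'b \<Rightarrow> 'a \<Rightarrow> 'a \<Rightarrow> real"
  assumes "finite V" "\<And>i j. i \<in> V \<Longrightarrow> j \<in> V \<Longrightarrow> (\<lambda>x. A x i j) \<in> borel_measurable M"
    and "\<And>x i j. A x i j = A x j i"
  shows measurable_pos_def_on: "Measurable.pred M (\<lambda>x. pos_def_on V (A x))"
    and measurable_inv_on_guarded: "(\<lambda>x. if pos_def_on V (A x) then inv_on V (A x) i j else 0) \<in> borel_measurable M"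
proof -
  have "Measurable.pred M (\<lambda>x. pos_def_on V (A x)) \<and>
    (\<forall>i j. (\<lambda>x. if pos_def_on V (A x) then inv_on V (A x) i j else 0) \<in> borel_measurable M)"
    using assms(1,2)
  proof (induction V)
    case empty
    have "pos_def_on {} (A x)" for x by (simp add: pos_def_on_def)
    then show ?case by (simp add: inv_on_empty)
  next
    case (insert v V)
    define g where "g x i j = (if pos_def_on V (A x) then inv_on V (A x) i j else 0)" for x i j
    define a where "a x i = (\<Sum>j\<in>V. g x i j * A x j v)" for x i
    define c where "c x = A x v v - (\<Sum>i\<in>V. A x v i * a x i)" for x
    have [measurable]: "Measurable.pred M (\<lambda>x. pos_def_on V (A x))" "\<And>i j. (\<lambda>x. g x i j) \<in> borel_measurable M"
      using insert unfolding g_def by auto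
    have A[measurable]: "(\<lambda>x. A x i j) \<in> borel_measurable M" if "i \<in> insert v V" "j \<in> insert v V" for i j
      using insert that by auto
    have am: "(\<lambda>x. a x i) \<in> borel_measurable M" for i
      unfolding a_def by (intro borel_measurable_sum borel_measurable_times A) auto
    have cm: "c \<in> borel_measurable M"
      unfolding c_def by (intro borel_measurable_diff borel_measurable_sum borel_measurable_times A am) auto
    note [measurable] = am cm
    have ac: "Schur_vec V v (A x) = a x" "Schur_pivot V v (A x) = c x" "inv_on V (A x) = g x" if "pos_def_on V (A x)" for x
      using that by (auto simp: Schur_vec_def Schur_pivot_def a_def c_def g_def intro!: ext)
    have pd: "pos_def_on (insert v V) (A x) \<longleftrightarrow> pos_def_on V (A x) \<and> 0 < c x" for x
      using pos_def_on_insert[OF insert(1,2), of "A x"] assms(3) ac by metis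
    have inv: "(if pos_def_on (insert v V) (A x) then inv_on (insert v V) (A x) i j else 0) =
       (if pos_def_on V (A x) \<and> 0 < c x then Schur_inverse V v (a x) (c x) (g x) i j else 0)" for x i j
    proof (cases "pos_def_on (insert v V) (A x)")
      case True
      then have "inv_on (insert v V) (A x) = Schur_inverse V v (a x) (c x) (g x)"
        using pd[of x] ac[of x] inv_on_insert[OF insert(1,2) assms(3), of x] by simp
      then show ?thesis using True pd[of x] by simp
    qed (use pd[of x] in auto)
    have "(\<lambda>x. Schur_inverse V v (a x) (c x) (g x) i j) \<in> borel_measurable M" for i j
      unfolding Schur_inverse_def by measurable
    then show ?case unfolding inv unfolding pd by auto
  qed
  then show "Measurable.pred M (\<lambda>x. pos_def_on V (A x))"
    "(\<lambda>x. if pos_def_on V (A x) then inv_on V (A x) i j else 0) \<in> borel_measurable M"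
    by auto
qed

lemma borel_measurable_det_on:
  fixes A :: "'b \<Rightarrow> 'a \<Rightarrow> 'a \<Rightarrow> real"
  assumes "\<And>i j. i \<in> V \<Longrightarrow> j \<in> V \<Longrightarrow> (\<lambda>x. A x i j) \<in> borel_measurable M"
  shows "(\<lambda>x. det_on V (A x)) \<in> borel_measurable M"
  unfolding det_on_def
  by (intro borel_measurable_sum borel_measurable_times borel_measurable_prod assms borel_measurable_const)
     (auto simp: permutes_in_image)

text \<open>Monotone substitution on the whole line, from substitution on the intervals [-(1+n), 1+n] by
  continuity from below.\<close>
lemma nn_integral_substitution_range:
  fixes f :: "real \<Rightarrow> ennreal"
  assumes f[measurable]: "f \<in> borel_measurable borel"
    and g: "\<And>x. (g has_real_derivative g' x) (at x)"
    and g'_cont: "continuous_on UNIV g'" and g'_nonneg: "\<And>x. 0 \<le> g' x"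
  shows "(\<integral>\<^sup>+z. f z * indicator (range g) z \<partial>lborel) = (\<integral>\<^sup>+x. f (g x) * ennreal (g' x) \<partial>lborel)"
proof -
  have g_cont: "continuous_on UNIV g"
    using g by (auto intro!: DERIV_continuous_on)
  have [measurable]: "g \<in> borel_measurable borel" "g' \<in> borel_measurable borel"
    using g_cont g'_cont by (auto intro: borel_measurable_continuous_onI)
  have mono: "g x \<le> g y" if "x \<le> y" for x y
    using that g g'_nonneg by (intro DERIV_nonneg_imp_nondecreasing[OF that]) auto
  \<comment> \<open>Starting at radius 1, as substitution is applied on nondegenerate intervals.\<close>
  define I where "I n = {- (1 + real n)..1 + real n}" for n
  define J where "J n = {g (- (1 + real n))..g (1 + real n)}" for n
  have I: "(\<Union>n. I n) = UNIV"
  proof (intro equalityI subsetI)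
    fix x :: real
    obtain n where "\<bar>x\<bar> \<le> real n" using real_arch_simple by blast
    then have "x \<in> I n" by (auto simp: I_def)
    then show "x \<in> (\<Union>n. I n)" by blast
  qed simp
  have gI: "g ` I n = J n" for n
  proof
    show "g ` I n \<subseteq> J n" by (auto simp: I_def J_def intro: mono)
    show "J n \<subseteq> g ` I n"
    proof
      fix z assume "z \<in> J n"
      then obtain x where "- (1 + real n) \<le> x" "x \<le> 1 + real n" "g x = z"
        using IVT'[of g "- (1 + real n)" z "1 + real n"] continuous_on_subset[OF g_cont]
        by (auto simp: J_def)
      then show "z \<in> g ` I n" by (auto simp: I_def)
    qed
  qed
  have J: "(\<Union>n. J n) = range g" unfolding gI[symmetric] I[symmetric] by blast
  have inc: "incseq I" by (auto simp: I_def incseq_def)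
  then have incJ: "incseq J" unfolding gI[symmetric] incseq_def by (simp add: image_mono)
  have [measurable]: "I n \<in> sets borel" "J n \<in> sets borel" for n
    by (auto simp: I_def J_def)
  then have [measurable]: "range g \<in> sets borel" unfolding J[symmetric] by blast
  have "(\<integral>\<^sup>+z. f z * indicator (range g) z \<partial>lborel) = emeasure (density lborel f) (\<Union>n. J n)"
    unfolding J by (simp add: emeasure_density)
  also have "\<dots> = (SUP n. emeasure (density lborel f) (J n))"
    using incJ by (intro SUP_emeasure_incseq[symmetric]) auto
  also have "\<dots> = (SUP n. emeasure (density lborel (\<lambda>x. f (g x) * ennreal (g' x))) (I n))"
  proof (intro SUP_cong refl)
    fix n
    have "emeasure (density lborel f) (J n) = (\<integral>\<^sup>+x. f x * indicator (J n) x \<partial>lborel)"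
      by (simp add: emeasure_density)
    also have "\<dots> = (\<integral>\<^sup>+x. f (g x) * ennreal (g' x) * indicator (I n) x \<partial>lborel)"
      unfolding I_def J_def
      by (intro nn_integral_substitution_aux g continuous_on_subset[OF g'_cont] g'_nonneg f) auto
    also have "\<dots> = emeasure (density lborel (\<lambda>x. f (g x) * ennreal (g' x))) (I n)"
      by (simp add: emeasure_density)
    finally show "emeasure (density lborel f) (J n) = \<dots>" .
  qed
  also have "\<dots> = emeasure (density lborel (\<lambda>x. f (g x) * ennreal (g' x))) (\<Union>n. I n)"
    using inc by (intro SUP_emeasure_incseq) auto
  also have "\<dots> = (\<integral>\<^sup>+x. f (g x) * ennreal (g' x) \<partial>lborel)"
    unfolding I by (simp add: emeasure_density)
  finally show ?thesis .
qed

lemma nn_integral_lborel_minus: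
  fixes f :: "real \<Rightarrow> ennreal"
  assumes "f \<in> borel_measurable borel"
  shows "(\<integral>\<^sup>+x. f (- x) \<partial>lborel) = (\<integral>\<^sup>+x. f x \<partial>lborel)"
  using nn_integral_real_affine[OF assms, of "-1" 0] by simp

text \<open>The one-variable step of the passage from u to \<beta>: as t runs over the line, (exp(-t) b + q)/2 runs
  over the half-line above q/2.\<close>
lemma nn_integral_exp_substitution:
  fixes F :: "real \<Rightarrow> ennreal"
  assumes b: "0 < b" and F[measurable]: "F \<in> borel_measurable borel"
  shows "(\<integral>\<^sup>+t. F (1 / 2 * (exp (- t) * b + q)) * ennreal (exp (- t) * b) \<partial>lborel) =
    2 * (\<integral>\<^sup>+y. F y * indicator {y. q < 2 * y} y \<partial>lborel)"
proof -
  let ?g = "\<lambda>t. - (1 / 2 * (exp (- t) * b + q))"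
  have range: "z \<in> range ?g \<longleftrightarrow> q < 2 * (- z)" for z
  proof
    assume "q < 2 * (- z)"
    then have "z = ?g (- ln ((2 * (- z) - q) / b))" using b by simp
    then show "z \<in> range ?g" by blast
  qed (use b in auto)
  have "(\<integral>\<^sup>+t. F (1 / 2 * (exp (- t) * b + q)) * ennreal (exp (- t) * b) \<partial>lborel) =
      (\<integral>\<^sup>+t. 2 * (F (- ?g t) * ennreal (1 / 2 * (exp (- t) * b))) \<partial>lborel)"
  proof (intro nn_integral_cong)
    fix t
    have "ennreal (exp (- t) * b) = 2 * ennreal (1 / 2 * (exp (- t) * b))"
      using b by (subst ennreal_numeral[symmetric], subst ennreal_mult'[symmetric]) auto
    then show "F (1 / 2 * (exp (- t) * b + q)) * ennreal (exp (- t) * b) =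
        2 * (F (- ?g t) * ennreal (1 / 2 * (exp (- t) * b)))"
      by (simp add: mult_ac)
  qed
  also have "\<dots> = 2 * (\<integral>\<^sup>+t. F (- ?g t) * ennreal (1 / 2 * (exp (- t) * b)) \<partial>lborel)"
    by (intro nn_integral_cmult) measurable
  also have "(\<integral>\<^sup>+t. F (- ?g t) * ennreal (1 / 2 * (exp (- t) * b)) \<partial>lborel) =
      (\<integral>\<^sup>+z. F (- z) * indicator (range ?g) z \<partial>lborel)"
    by (rule nn_integral_substitution_range[symmetric])
       (use b in \<open>auto intro!: derivative_eq_intros continuous_intros\<close>)
  also have "\<dots> = (\<integral>\<^sup>+z. F (- z) * indicator {y. q < 2 * y} (- z) \<partial>lborel)"
    by (intro nn_integral_cong arg_cong2[where f = "(*)"] refl)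
       (simp only: indicator_def range mem_Collect_eq)
  also have "\<dots> = (\<integral>\<^sup>+y. F y * indicator {y. q < 2 * y} y \<partial>lborel)"
    by (rule nn_integral_lborel_minus) measurable
  finally show ?thesis .
qed

lemma nn_integral_Gaussian:
  assumes "0 < c"
  shows "(\<integral>\<^sup>+t. ennreal (exp (- (1 / 2) * (c * (t + m)\<^sup>2))) \<partial>lborel) = ennreal (sqrt (2 * pi) / sqrt c)"
proof -
  have "exp (- (1 / 2) * (c * (t + m)\<^sup>2)) = sqrt (2 * pi) / sqrt c * normal_density (- m) (1 / sqrt c) t" for t
    using assms by (simp add: normal_density_def field_simps power2_eq_square real_sqrt_divide real_sqrt_mult)
  then have "(\<integral>\<^sup>+t. ennreal (exp (- (1 / 2) * (c * (t + m)\<^sup>2))) \<partial>lborel) =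
      (\<integral>\<^sup>+t. ennreal (sqrt (2 * pi) / sqrt c) * ennreal (normal_density (- m) (1 / sqrt c) t) \<partial>lborel)"
    using assms by (simp add: ennreal_mult'[symmetric])
  also have "\<dots> = ennreal (sqrt (2 * pi) / sqrt c) * (\<integral>\<^sup>+t. ennreal (normal_density (- m) (1 / sqrt c) t) \<partial>lborel)"
    by (intro nn_integral_cmult) simp
  also have "(\<integral>\<^sup>+t. ennreal (normal_density (- m) (1 / sqrt c) t) \<partial>lborel) = 1"
    using assms by (subst nn_integral_eq_integral) auto
  finally show ?thesis by simp
qed

text \<open>
  With x = b exp(2t) the exponent becomes -b cosh(2t) = -b - 2b (sinh t)^2 and the measure becomes a
  multiple of exp t dt. Averaging over t and -t turns exp t into cosh t, and z = sinh t then gives a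
  Gaussian integral.
\<close>
lemma nn_integral_inverse_Gaussian:
  assumes b: "0 < b"
  shows "(\<integral>\<^sup>+x. ennreal (exp (- (1 / 2) * (x + b\<^sup>2 / x)) / sqrt x) * indicator {0<..} x \<partial>lborel) =
    ennreal (sqrt (2 * pi) * exp (- b))"
    (is "?I = _")
proof -
  define h where "h t = exp (- (1 / 2) * (4 * b * (sinh t + 0)\<^sup>2))" for t
  define K where "K = (\<integral>\<^sup>+t. ennreal (2 * sqrt b * exp (- b) * exp t * h t) \<partial>lborel)"
  have [measurable]: "h \<in> borel_measurable borel"
    unfolding h_def by (intro borel_measurable_continuous_onI continuous_intros)
  have [measurable]: "(cosh :: real \<Rightarrow> real) \<in> borel_measurable borel"
    by (intro borel_measurable_continuous_onI continuous_intros)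
  have range: "range (\<lambda>t. b * exp (2 * t)) = {0<..}"
  proof (intro equalityI subsetI)
    fix x :: real assume "x \<in> {0<..}"
    then have "x = b * exp (2 * (ln (x / b) / 2))" using b by simp
    then show "x \<in> range (\<lambda>t. b * exp (2 * t))" by blast
  qed (use b in auto)
  have "?I = (\<integral>\<^sup>+t. ennreal (exp (- (1 / 2) * (b * exp (2 * t) + b\<^sup>2 / (b * exp (2 * t)))) / sqrt (b * exp (2 * t)))
      * ennreal (2 * b * exp (2 * t)) \<partial>lborel)"
    unfolding range[symmetric]
    by (rule nn_integral_substitution_range) (use b in \<open>auto intro!: derivative_eq_intros continuous_intros\<close>)
  also have "\<dots> = K"
    unfolding K_def
  proof (intro nn_integral_cong)
    fix t
    have s: "sqrt (b * exp (2 * t)) = sqrt b * exp t"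
      using b by (simp add: real_sqrt_mult exp_double real_sqrt_unique)
    have "exp t * exp (- t) = (1::real)" "exp (2 * t) = exp t * exp t" "exp (- (2 * t)) = exp (- t) * exp (- t)"
      by (simp_all add: exp_add[symmetric])
    then have e: "exp (2 * t) + exp (- (2 * t)) = 2 + 4 * (sinh t)\<^sup>2"
      unfolding sinh_field_def power2_eq_square
      by (simp add: algebra_simps add_divide_distrib diff_divide_distrib)
    have "b * exp (2 * t) + b\<^sup>2 / (b * exp (2 * t)) = b * (exp (2 * t) + exp (- (2 * t)))"
      using b by (simp add: exp_minus field_simps power2_eq_square)
    then have 1: "exp (- (1 / 2) * (b * exp (2 * t) + b\<^sup>2 / (b * exp (2 * t)))) = exp (- b) * h t"
      unfolding e h_def exp_add[symmetric] by (simp add: algebra_simps)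
    have 2: "2 * b * exp (2 * t) / sqrt (b * exp (2 * t)) = 2 * sqrt b * exp t"
    proof -
      have "(2 * sqrt b * exp t) * (sqrt b * exp t) = 2 * (sqrt b * sqrt b) * (exp t * exp t)"
        by (simp only: mult_ac)
      also have "\<dots> = 2 * b * exp (2 * t)"
        using b by (simp add: exp_double power2_eq_square)
      finally show ?thesis using b unfolding s by (simp add: field_simps)
    qed
    have "ennreal (exp (- (1 / 2) * (b * exp (2 * t) + b\<^sup>2 / (b * exp (2 * t)))) / sqrt (b * exp (2 * t)))
      * ennreal (2 * b * exp (2 * t)) = ennreal (exp (- b) * h t * (2 * b * exp (2 * t) / sqrt (b * exp (2 * t))))"
      unfolding 1 using b by (subst ennreal_mult'[symmetric]) (auto simp: h_def)
    also have "\<dots> = ennreal (2 * sqrt b * exp (- b) * exp t * h t)"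
      unfolding 2 by (simp add: mult_ac)
    finally show "ennreal (exp (- (1 / 2) * (b * exp (2 * t) + b\<^sup>2 / (b * exp (2 * t)))) / sqrt (b * exp (2 * t)))
      * ennreal (2 * b * exp (2 * t)) = \<dots>" .
  qed
  finally have I: "?I = K" .
  have "K = (\<integral>\<^sup>+t. ennreal (2 * sqrt b * exp (- b) * exp (- t) * h (- t)) \<partial>lborel)"
    unfolding K_def by (subst nn_integral_lborel_minus[symmetric]) auto
  also have "\<dots> = (\<integral>\<^sup>+t. ennreal (2 * sqrt b * exp (- b) * exp (- t) * h t) \<partial>lborel)"
    by (simp add: h_def)
  finally have "K + K = (\<integral>\<^sup>+t. ennreal (2 * sqrt b * exp (- b) * exp t * h t) +
      ennreal (2 * sqrt b * exp (- b) * exp (- t) * h t) \<partial>lborel)"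
    unfolding K_def by (subst nn_integral_add) auto
  also have "\<dots> = (\<integral>\<^sup>+t. ennreal (4 * sqrt b * exp (- b)) * (ennreal (h t) * ennreal (cosh t)) \<partial>lborel)"
    using b by (intro nn_integral_cong)
      (auto simp: ennreal_plus[symmetric] ennreal_mult'[symmetric] h_def cosh_field_def algebra_simps simp del: ennreal_plus)
  also have "\<dots> = ennreal (4 * sqrt b * exp (- b)) * (\<integral>\<^sup>+t. ennreal (h t) * ennreal (cosh t) \<partial>lborel)"
    by (intro nn_integral_cmult) measurable
  also have "(\<integral>\<^sup>+t. ennreal (h t) * ennreal (cosh t) \<partial>lborel) =
      (\<integral>\<^sup>+z. ennreal (exp (- (1 / 2) * (4 * b * (z + 0)\<^sup>2))) * indicator (range sinh) z \<partial>lborel)"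
    unfolding h_def
    by (rule nn_integral_substitution_range[symmetric])
       (auto intro!: derivative_eq_intros continuous_intros simp: less_imp_le[OF cosh_real_pos])
  also have "range (sinh :: real \<Rightarrow> real) = UNIV"
    by (intro surjI[of _ arsinh] sinh_arsinh_real)
  also have "(\<integral>\<^sup>+z. ennreal (exp (- (1 / 2) * (4 * b * (z + 0)\<^sup>2))) * indicator UNIV z \<partial>lborel) =
      ennreal (sqrt (2 * pi) / sqrt (4 * b))"
    using nn_integral_Gaussian[of "4 * b" 0] b by simp
  also have "ennreal (4 * sqrt b * exp (- b)) * \<dots> = 2 * ennreal (sqrt (2 * pi) * exp (- b))"
    using b by (simp add: ennreal_mult'[symmetric] real_sqrt_mult ennreal_numeral[symmetric] del: ennreal_numeral)
  finally have "2 * K = 2 * ennreal (sqrt (2 * pi) * exp (- b))" by (simp only: mult_2)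
  then have "K = ennreal (sqrt (2 * pi) * exp (- b))"
    by (subst (asm) ennreal_mult_cancel_left) auto
  then show ?thesis by (simp only: I)
qed

text \<open>The shift m is what makes the induction work: completing the square in a new coordinate shifts the
  remaining ones by a multiple of it.\<close>
lemma nn_integral_multivariate_Gaussian:
  assumes "finite V" "pos_def_on V A"
  shows "(\<integral>\<^sup>+s. ennreal (exp (- (1 / 2) * bilinear_form V A (\<lambda>i. s i + m i) (\<lambda>i. s i + m i))) \<partial>(\<Pi>\<^sub>M i\<in>V. lborel)) =
    ennreal (sqrt (2 * pi) ^ card V / sqrt (det_on V A))"
  using assms
proof (induction V arbitrary: m)
  case empty
  interpret product_sigma_finite "\<lambda>_::'a. lborel :: real measure" ..
  show ?case by (simp add: bilinear_form_def det_on_empty PiM_empty nn_integral_count_space_finite)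
next
  case (insert v V)
  interpret product_sigma_finite "\<lambda>_::'a. lborel :: real measure" ..
  have sym: "A i j = A j i" if "i \<in> insert v V" "j \<in> insert v V" for i j
    using insert.prems that by (auto simp: pos_def_on_def)
  have pd: "pos_def_on V A" "0 < Schur_pivot V v A"
    using pos_def_on_insert[OF insert(1,2) sym] insert(4) by auto
  let ?c = "Schur_pivot V v A" and ?a = "Schur_vec V v A"
  have split: "bilinear_form (insert v V) A (\<lambda>i. (s(v := t)) i + m i) (\<lambda>i. (s(v := t)) i + m i) =
    bilinear_form V A (\<lambda>i. s i + (m i + (t + m v) * ?a i)) (\<lambda>i. s i + (m i + (t + m v) * ?a i)) + ?c * (t + m v)\<^sup>2" for s t
  proof -
    have "bilinear_form (insert v V) A (\<lambda>i. (s(v := t)) i + m i) (\<lambda>i. (s(v := t)) i + m i) =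
      bilinear_form V A (\<lambda>i. (s(v := t)) i + m i + (t + m v) * ?a i) (\<lambda>i. (s(v := t)) i + m i + (t + m v) * ?a i) + ?c * (t + m v)\<^sup>2"
      by (subst bilinear_form_insert[OF insert(1,2) sym pd(1)]) auto
    then show ?thesis using insert(2)
      by (simp add: add.assoc cong: bilinear_form_cong) (auto intro!: bilinear_form_cong)
  qed
  have meas: "(\<lambda>s. ennreal (exp (- (1 / 2) * bilinear_form U A (\<lambda>i. s i + m i) (\<lambda>i. s i + m i))))
     \<in> borel_measurable (\<Pi>\<^sub>M i\<in>U. lborel)" for m U
    unfolding bilinear_form_def by measurable
  have "(\<integral>\<^sup>+s. ennreal (exp (- (1 / 2) * bilinear_form (insert v V) A (\<lambda>i. s i + m i) (\<lambda>i. s i + m i))) \<partial>(\<Pi>\<^sub>M i\<in>insert v V. lborel)) =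
    (\<integral>\<^sup>+t. (\<integral>\<^sup>+s. ennreal (exp (- (1 / 2) * (?c * (t + m v)\<^sup>2))) *
        ennreal (exp (- (1 / 2) * bilinear_form V A (\<lambda>i. s i + (m i + (t + m v) * ?a i)) (\<lambda>i. s i + (m i + (t + m v) * ?a i))))
       \<partial>(\<Pi>\<^sub>M i\<in>V. lborel)) \<partial>lborel)"
    unfolding product_nn_integral_insert_rev[OF insert(1,2) meas] split
    by (intro nn_integral_cong) (simp add: ennreal_mult'[symmetric] exp_add[symmetric] algebra_simps)
  also have "\<dots> = (\<integral>\<^sup>+t. ennreal (exp (- (1 / 2) * (?c * (t + m v)\<^sup>2))) * ennreal (sqrt (2 * pi) ^ card V / sqrt (det_on V A)) \<partial>lborel)"
    by (subst nn_integral_cmult[OF meas]) (simp only: insert.IH[OF pd(1)])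
  also have "\<dots> = ennreal (sqrt (2 * pi) / sqrt ?c) * ennreal (sqrt (2 * pi) ^ card V / sqrt (det_on V A))"
    by (subst nn_integral_multc) (auto simp only: nn_integral_Gaussian[OF pd(2)], measurable)
  also have "\<dots> = ennreal (sqrt (2 * pi) ^ card (insert v V) / sqrt (det_on (insert v V) A))"
    using insert(1,2) pd det_on_pos[OF insert(1) pd(1)] det_on_insert[OF insert(1,2) sym pd(1)]
    by (simp add: ennreal_mult'[symmetric] real_sqrt_mult mult_ac)
  finally show ?case .
qed

section \<open>The matrix H and its Green's function\<close>

locale symmetric_weights =
  fixes W :: "'a \<Rightarrow> 'a \<Rightarrow> real"
  assumes W_sym: "W i j = W j i" and W_nonneg: "0 \<le> W i j" and W_diag: "W i i = 0"
begin

definition H_mat :: "('a \<Rightarrow> real) \<Rightarrow> 'a \<Rightarrow> 'a \<Rightarrow> real" where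
  "H_mat \<beta> i j = (if i = j then 2 * \<beta> i else - W i j)"

text \<open>
  Connectedness of U to the boundary: every nonempty part Z of U has an edge leaving it, either to
  the rest of U or to the boundary. In this form it passes to smaller vertex sets with enlarged \<eta>.
\<close>
definition reaches_boundary :: "'a set \<Rightarrow> ('a \<Rightarrow> real) \<Rightarrow> bool" where
  "reaches_boundary U \<eta> \<longleftrightarrow>
     (\<forall>Z\<subseteq>U. Z \<noteq> {} \<longrightarrow> (\<exists>i\<in>Z. 0 < \<eta> i \<or> (\<exists>j\<in>U - Z. 0 < W i j)))"

text \<open>The map from u to \<beta> when the reference vertex sits at height 0 and has weight \<eta> i to i.\<close>
definition beta_map :: "'a set \<Rightarrow> ('a \<Rightarrow> real) \<Rightarrow> ('a \<Rightarrow> real) \<Rightarrow> 'a \<Rightarrow> real" where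
  "beta_map U \<eta> u = (\<lambda>i\<in>U. 1 / 2 * (exp (- u i) * ((\<Sum>j\<in>U. W i j * exp (u j)) + \<eta> i)))"

definition green :: "'a set \<Rightarrow> ('a \<Rightarrow> real) \<Rightarrow> ('a \<Rightarrow> real) \<Rightarrow> 'a \<Rightarrow> real" where
  "green U \<beta> x i = (\<Sum>j\<in>U. inv_on U (H_mat \<beta>) i j * x j)"

text \<open>The multivariate (generalised) inverse Gaussian density: the law of the potential of the random Schroedinger operator
  associated with the H22 model.\<close>
definition beta_density :: "'a set \<Rightarrow> ('a \<Rightarrow> real) \<Rightarrow> ('a \<Rightarrow> real) \<Rightarrow> real" where
  "beta_density U \<eta> \<beta> =
     (if pos_def_on U (H_mat \<beta>) then
        sqrt (2 / pi) ^ card U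
          * exp (- (1 / 2) * bilinear_form U (H_mat \<beta>) (\<lambda>_. 1) (\<lambda>_. 1)
                 - 1 / 2 * bilinear_form U (inv_on U (H_mat \<beta>)) \<eta> \<eta> + sum \<eta> U)
          / sqrt (det_on U (H_mat \<beta>))
      else 0)"

lemma H_mat_sym: "H_mat \<beta> i j = H_mat \<beta> j i"
  by (simp add: H_mat_def W_sym)

lemma H_mat_cong: "\<beta> i = \<beta>' i \<Longrightarrow> H_mat \<beta> i j = H_mat \<beta>' i j"
  by (auto simp: H_mat_def)

lemma H_mat_update:
  assumes "v \<notin> U"
  shows "pos_def_on U (H_mat (\<beta>(v := y))) = pos_def_on U (H_mat \<beta>)"
    "inv_on U (H_mat (\<beta>(v := y))) = inv_on U (H_mat \<beta>)"
    "det_on U (H_mat (\<beta>(v := y))) = det_on U (H_mat \<beta>)"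
    "bilinear_form U (H_mat (\<beta>(v := y))) x z = bilinear_form U (H_mat \<beta>) x z"
proof -
  have "H_mat (\<beta>(v := y)) i j = H_mat \<beta> i j" if "i \<in> U" for i j
    using that assms by (intro H_mat_cong) auto
  then show "pos_def_on U (H_mat (\<beta>(v := y))) = pos_def_on U (H_mat \<beta>)"
    "inv_on U (H_mat (\<beta>(v := y))) = inv_on U (H_mat \<beta>)"
    "det_on U (H_mat (\<beta>(v := y))) = det_on U (H_mat \<beta>)"
    "bilinear_form U (H_mat (\<beta>(v := y))) x z = bilinear_form U (H_mat \<beta>) x z"
    by (intro pos_def_on_cong inv_on_cong det_on_cong bilinear_form_cong; simp)+
qed

lemma H_mat_apply:
  assumes "finite U" "i \<in> U"
  shows "(\<Sum>j\<in>U. H_mat \<beta> i j * y j) = 2 * \<beta> i * y i - (\<Sum>j\<in>U. W i j * y j)"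
proof -
  have "(\<Sum>j\<in>U. H_mat \<beta> i j * y j) = (\<Sum>j\<in>U. (if j = i then 2 * \<beta> i * y i else 0) - W i j * y j)"
    by (intro sum.cong) (auto simp: H_mat_def W_diag)
  then show ?thesis using assms by (simp add: sum_subtractf)
qed

text \<open>The defining relation of \<beta>: exp u solves H x = \<eta>.\<close>
lemma H_mat_beta_map:
  assumes "finite U" "i \<in> U"
  shows "(\<Sum>j\<in>U. H_mat (beta_map U \<eta> u) i j * exp (u j)) = \<eta> i"
  using assms unfolding H_mat_apply[OF assms] by (simp add: beta_map_def exp_minus field_simps)

lemma green_beta_map:
  assumes "finite U" "pos_def_on U (H_mat (beta_map U \<eta> u))" "i \<in> U"
  shows "green U (beta_map U \<eta> u) \<eta> i = exp (u i)"
  unfolding green_def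
  by (rule inverse_on_solve[OF assms(1) pos_def_on_inverse[OF assms(1,2)] assms(3)])
     (rule H_mat_beta_map[OF assms(1)])

lemma green_add: "green U \<beta> (\<lambda>i. x i + y i) i = green U \<beta> x i + green U \<beta> y i"
  by (simp add: green_def algebra_simps sum.distrib)

lemma green_scale: "green U \<beta> (\<lambda>i. x i * t) i = green U \<beta> x i * t"
  by (simp add: green_def sum_distrib_right mult.assoc)

lemma bilinear_form_green: "bilinear_form U (inv_on U (H_mat \<beta>)) x y = (\<Sum>i\<in>U. x i * green U \<beta> y i)"
  by (simp add: bilinear_form_def green_def sum_distrib_left mult.assoc)

lemma inv_on_H_mat_sym:
  assumes "finite U" "pos_def_on U (H_mat \<beta>)"
  shows "inv_on U (H_mat \<beta>) i j = inv_on U (H_mat \<beta>) j i"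
  by (rule inverse_on_symmetric[OF assms(1) pos_def_on_inverse[OF assms] H_mat_sym])

lemma green_self_adjoint:
  assumes "finite U" "pos_def_on U (H_mat \<beta>)"
  shows "(\<Sum>i\<in>U. x i * green U \<beta> y i) = (\<Sum>i\<in>U. y i * green U \<beta> x i)"
  unfolding green_def sum_distrib_left
  by (subst sum.swap) (auto intro!: sum.cong simp: inv_on_H_mat_sym[OF assms] mult_ac)

lemma H_mat_green:
  assumes "finite U" "pos_def_on U (H_mat \<beta>)" "i \<in> U"
  shows "(\<Sum>j\<in>U. H_mat \<beta> i j * green U \<beta> x j) = x i"
  unfolding green_def by (rule inverse_on_apply[OF assms(1) pos_def_on_inverse[OF assms(1,2)] assms(3)])

lemma green_nonneg:
  assumes "finite U" "pos_def_on U (H_mat \<beta>)" "\<And>i. i \<in> U \<Longrightarrow> 0 \<le> x i"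
  shows "0 \<le> green U \<beta> x i"
  unfolding green_def using assms
  by (intro sum_nonneg mult_nonneg_nonneg inv_on_nonneg) (auto simp: H_mat_def W_nonneg)

text \<open>If the nonnegative solution y of H y = x vanishes at i, then row i of this equation is a sum of
  nonnegative terms that equals zero.\<close>
lemma green_zero:
  assumes U: "finite U" "pos_def_on U (H_mat \<beta>)" and x: "\<And>i. i \<in> U \<Longrightarrow> 0 \<le> x i"
    and i: "i \<in> U" "green U \<beta> x i = 0"
  shows "x i = 0" "\<And>j. j \<in> U \<Longrightarrow> 0 < W i j \<Longrightarrow> green U \<beta> x j = 0"
proof -
  have g: "0 \<le> green U \<beta> x k" for k by (rule green_nonneg[OF U x])
  have "x i = - (\<Sum>j\<in>U. W i j * green U \<beta> x j)"
    using H_mat_green[OF U i(1), of x] H_mat_apply[OF U(1) i(1), of \<beta> "green U \<beta> x"] i(2) by simp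
  moreover have "0 \<le> (\<Sum>j\<in>U. W i j * green U \<beta> x j)"
    by (intro sum_nonneg mult_nonneg_nonneg W_nonneg g)
  ultimately have 0: "x i = 0" "(\<Sum>j\<in>U. W i j * green U \<beta> x j) = 0" using x[OF i(1)] by auto
  show "x i = 0" by (fact 0)
  show "green U \<beta> x j = 0" if "j \<in> U" "0 < W i j" for j
    using 0(2) that U(1) g W_nonneg by (subst (asm) sum_nonneg_eq_0_iff) auto
qed

text \<open>By the previous lemma, the zero set of the solution has no edges out of it and no contact with the
  boundary, so it is empty.\<close>
lemma green_pos:
  assumes U: "finite U" "pos_def_on U (H_mat \<beta>)" and x: "\<And>i. i \<in> U \<Longrightarrow> 0 \<le> x i"
    and bd: "reaches_boundary U x" and i: "i \<in> U"
  shows "0 < green U \<beta> x i"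
proof (rule ccontr)
  assume neg: "\<not> 0 < green U \<beta> x i"
  define Z where "Z = {i\<in>U. green U \<beta> x i = 0}"
  have g: "0 \<le> green U \<beta> x k" for k by (rule green_nonneg[OF U x])
  have "Z \<subseteq> U" "Z \<noteq> {}" using neg g[of i] i by (auto simp: Z_def)
  then obtain k where k: "k \<in> Z" "0 < x k \<or> (\<exists>j\<in>U - Z. 0 < W k j)"
    using bd unfolding reaches_boundary_def by blast
  then have "k \<in> U" "green U \<beta> x k = 0" by (auto simp: Z_def)
  note z = green_zero[where x = x, OF U x this]
  from k(2) show False
  proof
    assume "\<exists>j\<in>U - Z. 0 < W k j"
    then obtain j where "j \<in> U" "j \<notin> Z" "0 < W k j" by blast
    then show False using z(2)[of j] by (auto simp: Z_def)
  qed (use z(1) in simp)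
qed

lemma reaches_boundary_insert:
  assumes "reaches_boundary (insert v U) \<eta>" "\<And>i. i \<in> U \<Longrightarrow> 0 \<le> \<eta> i" "0 < t"
  shows "reaches_boundary U (\<lambda>i. \<eta> i + W i v * t)"
  unfolding reaches_boundary_def
proof (intro allI impI)
  fix Z assume Z: "Z \<subseteq> U" "Z \<noteq> {}"
  then have "Z \<subseteq> insert v U" by blast
  with Z(2) assms(1) obtain i where i: "i \<in> Z" "0 < \<eta> i \<or> (\<exists>j\<in>insert v U - Z. 0 < W i j)"
    unfolding reaches_boundary_def by blast
  have nn: "0 \<le> \<eta> i" "0 \<le> W i v * t"
    using assms(2)[of i] i Z assms(3) W_nonneg[of i v] by auto
  show "\<exists>i\<in>Z. 0 < \<eta> i + W i v * t \<or> (\<exists>j\<in>U - Z. 0 < W i j)"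
  proof (rule bexI[OF _ i(1)])
    from i(2) show "0 < \<eta> i + W i v * t \<or> (\<exists>j\<in>U - Z. 0 < W i j)"
    proof
      assume "0 < \<eta> i"
      then show ?thesis using nn by auto
    next
      assume "\<exists>j\<in>insert v U - Z. 0 < W i j"
      then obtain j where j: "j \<in> insert v U - Z" "0 < W i j" by blast
      show ?thesis
      proof (cases "j = v")
        case True
        then have "0 < W i v * t" using j assms(3) by simp
        then show ?thesis using nn by auto
      qed (use j in auto)
    qed
  qed
qed

text \<open>
  When the vertex v is added to U, the new pivot of H is 2 \<beta> v - q with q the shift below, and the source b
  is what remains of \<eta> v in the equation H y = \<eta> after the variables in U have been eliminated.
\<close>
definition pivot_shift :: "'a set \<Rightarrow> 'a \<Rightarrow> ('a \<Rightarrow> real) \<Rightarrow> real" where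
  "pivot_shift U v \<beta> = (\<Sum>i\<in>U. W v i * green U \<beta> (\<lambda>j. W j v) i)"

definition pivot_source :: "'a set \<Rightarrow> 'a \<Rightarrow> ('a \<Rightarrow> real) \<Rightarrow> ('a \<Rightarrow> real) \<Rightarrow> real" where
  "pivot_source U v \<eta> \<beta> = \<eta> v + (\<Sum>i\<in>U. W v i * green U \<beta> \<eta> i)"

lemma pivot_update:
  assumes "v \<notin> U"
  shows "pivot_shift U v (\<beta>(v := y)) = pivot_shift U v \<beta>"
    "pivot_source U v \<eta> (\<beta>(v := y)) = pivot_source U v \<eta> \<beta>"
  by (simp_all add: pivot_shift_def pivot_source_def green_def H_mat_update[OF assms])

text \<open>If b were zero, v together with the zeros of the solution on U would form a set without any edge
  leaving it.\<close>
lemma pivot_source_pos: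
  assumes U: "finite U" "v \<notin> U" "pos_def_on U (H_mat \<beta>)"
    and x: "\<And>i. i \<in> insert v U \<Longrightarrow> 0 \<le> \<eta> i" and bd: "reaches_boundary (insert v U) \<eta>"
  shows "0 < pivot_source U v \<eta> \<beta>"
proof (rule ccontr)
  assume neg: "\<not> 0 < pivot_source U v \<eta> \<beta>"
  have xU: "0 \<le> \<eta> i" if "i \<in> U" for i using x that by auto
  have g: "0 \<le> green U \<beta> \<eta> k" for k by (rule green_nonneg[OF U(1,3) xU])
  have s: "0 \<le> (\<Sum>i\<in>U. W v i * green U \<beta> \<eta> i)"
    by (intro sum_nonneg mult_nonneg_nonneg W_nonneg g)
  then have v0: "\<eta> v = 0" "(\<Sum>i\<in>U. W v i * green U \<beta> \<eta> i) = 0"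
    using neg x[of v] by (auto simp: pivot_source_def)
  have vW: "green U \<beta> \<eta> j = 0" if "j \<in> U" "0 < W v j" for j
    using v0(2) that U(1) g W_nonneg by (subst (asm) sum_nonneg_eq_0_iff) auto
  define Z where "Z = insert v {i\<in>U. green U \<beta> \<eta> i = 0}"
  have "Z \<subseteq> insert v U" "Z \<noteq> {}" by (auto simp: Z_def)
  then obtain k where k: "k \<in> Z" "0 < \<eta> k \<or> (\<exists>j\<in>insert v U - Z. 0 < W k j)"
    using bd unfolding reaches_boundary_def by blast
  show False
  proof (cases "k = v")
    case True
    then obtain j where "j \<in> insert v U - Z" "0 < W v j" using k(2) v0(1) by auto
    then show False using vW[of j] by (auto simp: Z_def)
  next
    case False
    then have "k \<in> U" "green U \<beta> \<eta> k = 0" using k(1) by (auto simp: Z_def)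
    note z = green_zero[where x = \<eta>, OF U(1,3) xU this]
    from z(1) k(2) obtain j where "j \<in> insert v U - Z" "0 < W k j" by auto
    then show False using z(2)[of j] by (auto simp: Z_def)
  qed
qed

lemma Schur_vec_H_mat:
  assumes "v \<notin> U"
  shows "Schur_vec U v (H_mat \<beta>) i = - green U \<beta> (\<lambda>j. W j v) i"
proof -
  have "inv_on U (H_mat \<beta>) i j * H_mat \<beta> j v = - (inv_on U (H_mat \<beta>) i j * W j v)" if "j \<in> U" for j
    using that assms by (auto simp: H_mat_def)
  then show ?thesis unfolding Schur_vec_def green_def by (simp add: sum_negf)
qed

lemma Schur_pivot_H_mat:
  assumes "v \<notin> U"
  shows "Schur_pivot U v (H_mat \<beta>) = 2 * \<beta> v - pivot_shift U v \<beta>"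
proof -
  have "H_mat \<beta> v i * Schur_vec U v (H_mat \<beta>) i = W v i * green U \<beta> (\<lambda>j. W j v) i" if "i \<in> U" for i
    using that assms by (auto simp: H_mat_def Schur_vec_H_mat)
  moreover have "H_mat \<beta> v v = 2 * \<beta> v" by (simp add: H_mat_def)
  ultimately show ?thesis unfolding Schur_pivot_def pivot_shift_def by simp
qed

lemma pos_def_on_H_mat_insert:
  assumes "finite U" "v \<notin> U"
  shows "pos_def_on (insert v U) (H_mat \<beta>) \<longleftrightarrow>
    pos_def_on U (H_mat \<beta>) \<and> pivot_shift U v \<beta> < 2 * \<beta> v"
  using pos_def_on_insert[OF assms, of "H_mat \<beta>", OF H_mat_sym] unfolding Schur_pivot_H_mat[OF assms(2)] by simp

lemma pivot_source_Schur:
  assumes "finite U" "v \<notin> U" "pos_def_on U (H_mat \<beta>)"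
  shows "\<eta> v - (\<Sum>i\<in>U. Schur_vec U v (H_mat \<beta>) i * \<eta> i) = pivot_source U v \<eta> \<beta>"
proof -
  have "(\<Sum>i\<in>U. Schur_vec U v (H_mat \<beta>) i * \<eta> i) = - (\<Sum>i\<in>U. \<eta> i * green U \<beta> (\<lambda>j. W j v) i)"
    by (simp add: Schur_vec_H_mat[OF assms(2)] sum_negf mult.commute)
  also have "(\<Sum>i\<in>U. \<eta> i * green U \<beta> (\<lambda>j. W j v) i) = (\<Sum>i\<in>U. W i v * green U \<beta> \<eta> i)"
    by (rule green_self_adjoint[OF assms(1,3)])
  also have "\<dots> = (\<Sum>i\<in>U. W v i * green U \<beta> \<eta> i)" by (simp add: W_sym)
  finally show ?thesis by (simp add: pivot_source_def)
qed

text \<open>For the vertices in U, a new vertex v at height u v acts as additional boundary.\<close>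
lemma beta_map_insert:
  assumes "finite U" "v \<notin> U" "i \<in> U"
  shows "beta_map (insert v U) \<eta> u i = beta_map U (\<lambda>i. \<eta> i + W i v * exp (u v)) u i"
  using assms by (simp add: beta_map_def algebra_simps)

text \<open>So the pivot at v equals exp(-u v) b. Since b depends only on \<beta> on U, the map from u v to \<beta> v is
  elementary once \<beta> on U is fixed.\<close>
lemma beta_map_new_vertex:
  assumes U: "finite U" "v \<notin> U" and pd: "pos_def_on U (H_mat \<beta>)"
    and \<beta>: "\<beta> = beta_map U (\<lambda>i. \<eta> i + W i v * exp (u v)) u"
  shows "2 * beta_map (insert v U) \<eta> u v = exp (- u v) * pivot_source U v \<eta> \<beta> + pivot_shift U v \<beta>"
proof -
  have "exp (u j) = green U \<beta> \<eta> j + green U \<beta> (\<lambda>i. W i v) j * exp (u v)" if "j \<in> U" for j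
    using green_beta_map[OF U(1) pd[unfolded \<beta>] that] unfolding \<beta>[symmetric] green_add green_scale by simp
  then have "(\<Sum>j\<in>U. W v j * exp (u j)) =
      (\<Sum>j\<in>U. W v j * green U \<beta> \<eta> j) + pivot_shift U v \<beta> * exp (u v)"
    unfolding pivot_shift_def sum_distrib_right sum.distrib[symmetric]
    by (intro sum.cong) (auto simp: algebra_simps)
  then show ?thesis using U
    by (simp add: beta_map_def W_diag pivot_source_def algebra_simps exp_minus)
qed

text \<open>The pivot at a new vertex v is exp(-u v) times the positive source b.\<close>
lemma pos_def_on_beta_map:
  assumes "finite U" "\<And>i. i \<in> U \<Longrightarrow> 0 \<le> \<eta> i" "reaches_boundary U \<eta>"
  shows "pos_def_on U (H_mat (beta_map U \<eta> u))"
  using assms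
proof (induction U arbitrary: \<eta>)
  case empty
  show ?case by (simp add: pos_def_on_def)
next
  case (insert v U)
  define \<eta>' where "\<eta>' i = \<eta> i + W i v * exp (u v)" for i
  let ?\<beta> = "beta_map (insert v U) \<eta> u" and ?\<beta>' = "beta_map U \<eta>' u"
  have eq: "H_mat ?\<beta> i j = H_mat ?\<beta>' i j" if "i \<in> U" for i j
    unfolding \<eta>'_def using beta_map_insert[OF insert(1,2) that] by (rule H_mat_cong)
  have pd': "pos_def_on U (H_mat ?\<beta>')"
  proof (rule insert.IH)
    show "0 \<le> \<eta>' i" if "i \<in> U" for i
      using insert(4)[of i] that W_nonneg[of i v] by (simp add: \<eta>'_def)
    show "reaches_boundary U \<eta>'"
      unfolding \<eta>'_def by (rule reaches_boundary_insert[OF insert(5)]) (use insert(4) in auto)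
  qed
  have pd: "pos_def_on U (H_mat ?\<beta>)"
    using pd' pos_def_on_cong[of U "H_mat ?\<beta>" "H_mat ?\<beta>'"] eq by blast
  have inv: "inv_on U (H_mat ?\<beta>) = inv_on U (H_mat ?\<beta>')"
    using eq by (intro inv_on_cong)
  have "2 * ?\<beta> v = exp (- u v) * pivot_source U v \<eta> ?\<beta>' + pivot_shift U v ?\<beta>'"
    by (rule beta_map_new_vertex[OF insert(1,2) pd']) (simp add: \<eta>'_def[abs_def])
  moreover have "0 < pivot_source U v \<eta> ?\<beta>'"
    by (rule pivot_source_pos[OF insert(1,2) pd' insert(4,5)])
  moreover have "pivot_shift U v ?\<beta>' = pivot_shift U v ?\<beta>"
    by (simp add: pivot_shift_def green_def inv)
  ultimately show ?case
    unfolding pos_def_on_H_mat_insert[OF insert(1,2)] using pd by simp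
qed

section \<open>The change of variables from u to \<beta>\<close>

lemma beta_map_cong:
  assumes "\<And>i. i \<in> U \<Longrightarrow> u i = u' i"
  shows "beta_map U \<eta> u = beta_map U \<eta> u'"
  using assms unfolding beta_map_def by (intro restrict_ext) auto

lemma measurable_beta_map[measurable]:
  "beta_map U \<eta> \<in> (\<Pi>\<^sub>M i\<in>U. lborel) \<rightarrow>\<^sub>M (\<Pi>\<^sub>M i\<in>U. lborel)"
  unfolding beta_map_def by measurable

lemma borel_measurable_H_mat:
  "i \<in> U \<Longrightarrow> (\<lambda>\<beta>. H_mat \<beta> i j) \<in> borel_measurable (\<Pi>\<^sub>M i\<in>U. lborel)"
  unfolding H_mat_def by measurable

lemma pred_pos_def_on_H_mat[measurable]:
  "finite U \<Longrightarrow> Measurable.pred (\<Pi>\<^sub>M i\<in>U. lborel) (\<lambda>\<beta>. pos_def_on U (H_mat \<beta>))"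
  by (rule measurable_pos_def_on) (auto simp: borel_measurable_H_mat H_mat_sym)

lemma borel_measurable_inv_on_H_mat:
  "finite U \<Longrightarrow> (\<lambda>\<beta>. if pos_def_on U (H_mat \<beta>) then inv_on U (H_mat \<beta>) i j else 0)
     \<in> borel_measurable (\<Pi>\<^sub>M i\<in>U. lborel)"
  by (rule measurable_inv_on_guarded) (auto simp: borel_measurable_H_mat H_mat_sym)

lemma borel_measurable_det_on_H_mat[measurable]:
  "(\<lambda>\<beta>. det_on U (H_mat \<beta>)) \<in> borel_measurable (\<Pi>\<^sub>M i\<in>U. lborel)"
  by (rule borel_measurable_det_on) (rule borel_measurable_H_mat)

lemma borel_measurable_green:
  assumes "finite U"
  shows "(\<lambda>\<beta>. if pos_def_on U (H_mat \<beta>) then green U \<beta> x i else 0) \<in> borel_measurable (\<Pi>\<^sub>M i\<in>U. lborel)"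
proof -
  have "(\<lambda>\<beta>. if pos_def_on U (H_mat \<beta>) then green U \<beta> x i else 0) =
    (\<lambda>\<beta>. \<Sum>j\<in>U. (if pos_def_on U (H_mat \<beta>) then inv_on U (H_mat \<beta>) i j else 0) * x j)"
    by (auto simp: green_def)
  also have "\<dots> \<in> borel_measurable (\<Pi>\<^sub>M i\<in>U. lborel)"
    by (intro borel_measurable_sum borel_measurable_times borel_measurable_inv_on_H_mat assms) simp
  finally show ?thesis .
qed

lemma borel_measurable_pivot:
  assumes "finite U"
  shows borel_measurable_pivot_shift:
      "(\<lambda>\<beta>. if pos_def_on U (H_mat \<beta>) then pivot_shift U v \<beta> else 0) \<in> borel_measurable (\<Pi>\<^sub>M i\<in>U. lborel)"
    and borel_measurable_pivot_source:
      "(\<lambda>\<beta>. if pos_def_on U (H_mat \<beta>) then pivot_source U v \<eta> \<beta> else 0) \<in> borel_measurable (\<Pi>\<^sub>M i\<in>U. lborel)"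
proof -
  note [measurable] = pred_pos_def_on_H_mat[OF assms] borel_measurable_green[OF assms]
  have "(\<lambda>\<beta>. if pos_def_on U (H_mat \<beta>) then pivot_shift U v \<beta> else 0) =
    (\<lambda>\<beta>. \<Sum>i\<in>U. W v i * (if pos_def_on U (H_mat \<beta>) then green U \<beta> (\<lambda>j. W j v) i else 0))"
    by (auto simp: pivot_shift_def)
  also have "\<dots> \<in> borel_measurable (\<Pi>\<^sub>M i\<in>U. lborel)" by measurable
  finally show "(\<lambda>\<beta>. if pos_def_on U (H_mat \<beta>) then pivot_shift U v \<beta> else 0) \<in> borel_measurable (\<Pi>\<^sub>M i\<in>U. lborel)" .
  have "(\<lambda>\<beta>. if pos_def_on U (H_mat \<beta>) then pivot_source U v \<eta> \<beta> else 0) =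
    (\<lambda>\<beta>. if pos_def_on U (H_mat \<beta>) then
      \<eta> v + (\<Sum>i\<in>U. W v i * (if pos_def_on U (H_mat \<beta>) then green U \<beta> \<eta> i else 0)) else 0)"
    by (auto simp: pivot_source_def)
  also have "\<dots> \<in> borel_measurable (\<Pi>\<^sub>M i\<in>U. lborel)" by measurable
  finally show "(\<lambda>\<beta>. if pos_def_on U (H_mat \<beta>) then pivot_source U v \<eta> \<beta> else 0) \<in> borel_measurable (\<Pi>\<^sub>M i\<in>U. lborel)" .
qed

lemma borel_measurable_beta_density[measurable]:
  assumes "finite U"
  shows "beta_density U \<eta> \<in> borel_measurable (\<Pi>\<^sub>M i\<in>U. lborel)"
proof -
  note [measurable] = pred_pos_def_on_H_mat[OF assms] borel_measurable_green[OF assms]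
  have [measurable]: "(\<lambda>\<beta>. bilinear_form U (H_mat \<beta>) x y) \<in> borel_measurable (\<Pi>\<^sub>M i\<in>U. lborel)" for x y
    unfolding bilinear_form_def
    by (intro borel_measurable_sum borel_measurable_times borel_measurable_H_mat) auto
  have "beta_density U \<eta> = (\<lambda>\<beta>. if pos_def_on U (H_mat \<beta>) then
        sqrt (2 / pi) ^ card U
          * exp (- (1 / 2) * bilinear_form U (H_mat \<beta>) (\<lambda>_. 1) (\<lambda>_. 1)
                 - 1 / 2 * (\<Sum>i\<in>U. \<eta> i * (if pos_def_on U (H_mat \<beta>) then green U \<beta> \<eta> i else 0)) + sum \<eta> U)
          / sqrt (det_on U (H_mat \<beta>))
      else 0)"
    by (auto simp: beta_density_def bilinear_form_green)
  also have "\<dots> \<in> borel_measurable (\<Pi>\<^sub>M i\<in>U. lborel)" by measurable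
  finally show ?thesis .
qed

lemma beta_density_nonneg: "finite U \<Longrightarrow> 0 \<le> beta_density U \<eta> \<beta>"
  unfolding beta_density_def by (auto simp: less_imp_le[OF det_on_pos])

text \<open>
  The Jacobian formula, by induction on U. Hold the height t of the new vertex fixed and transform
  the other variables by the induction hypothesis, with the boundary term enlarged by W(.,v) exp t. Then
  hold \<beta> on U fixed and transform t. The factor exp(-t) b by which the determinant grows is twice the
  derivative of this last map up to sign.
\<close>
lemma beta_map_change_of_variables:
  assumes "finite U" "\<And>i. i \<in> U \<Longrightarrow> 0 \<le> \<eta> i" "reaches_boundary U \<eta>"
    and "F \<in> borel_measurable (\<Pi>\<^sub>M i\<in>U. lborel)"
  shows "(\<integral>\<^sup>+u. F (beta_map U \<eta> u) * ennreal (det_on U (H_mat (beta_map U \<eta> u))) \<partial>(\<Pi>\<^sub>M i\<in>U. lborel)) =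
    2 ^ card U * (\<integral>\<^sup>+\<beta>. F \<beta> * indicator {\<beta>. pos_def_on U (H_mat \<beta>)} \<beta> \<partial>(\<Pi>\<^sub>M i\<in>U. lborel))"
  using assms
proof (induction U arbitrary: \<eta> F)
  case empty
  interpret product_sigma_finite "\<lambda>_::'a. lborel :: real measure" ..
  show ?case
    by (simp add: PiM_empty nn_integral_count_space_finite det_on_empty pos_def_on_def beta_map_def restrict_def)
next
  case (insert v U)
  interpret product_sigma_finite "\<lambda>_::'a. lborel :: real measure" ..
  let ?M = "\<Pi>\<^sub>M i\<in>U. (lborel :: real measure)" and ?N = "\<Pi>\<^sub>M i\<in>insert v U. (lborel :: real measure)"
  interpret U: sigma_finite_measure ?M by (rule sigma_finite) (rule insert(1))
  interpret pair_sigma_finite ?M "lborel :: real measure" ..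
  note F[measurable] = insert(6)
  note [measurable] = pred_pos_def_on_H_mat[OF insert(1)]
  define b where "b \<beta> = (if pos_def_on U (H_mat \<beta>) then pivot_source U v \<eta> \<beta> else 0)" for \<beta>
  define q where "q \<beta> = (if pos_def_on U (H_mat \<beta>) then pivot_shift U v \<beta> else 0)" for \<beta>
  have [measurable]: "b \<in> borel_measurable ?M" "q \<in> borel_measurable ?M"
    unfolding b_def q_def using borel_measurable_pivot[OF insert(1)] by auto
  define \<eta>' where "\<eta>' t i = \<eta> i + W i v * exp t" for t i
  define \<Phi> where "\<Phi> t \<beta> = F (\<beta>(v := 1 / 2 * (exp (- t) * b \<beta> + q \<beta>))) * ennreal (exp (- t) * b \<beta>)" for t \<beta>
  have \<Phi>_joint[measurable]: "(\<lambda>(\<beta>, t). \<Phi> t \<beta>) \<in> borel_measurable (?M \<Otimes>\<^sub>M lborel)"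
    unfolding \<Phi>_def by measurable
  have \<Phi>[measurable]: "\<Phi> t \<in> borel_measurable ?M" for t
    unfolding \<Phi>_def by measurable
  have b_pos: "0 < b \<beta>" if "pos_def_on U (H_mat \<beta>)" for \<beta>
    using pivot_source_pos[OF insert(1,2) that insert(4,5)] that by (simp add: b_def)
  \<comment> \<open>Passing to \<beta> on U for fixed t: the integrand becomes \<Phi> t at that \<beta>, times the smaller determinant.\<close>
  have key: "F (beta_map (insert v U) \<eta> (u(v := t))) *
        ennreal (det_on (insert v U) (H_mat (beta_map (insert v U) \<eta> (u(v := t))))) =
      \<Phi> t (beta_map U (\<eta>' t) u) * ennreal (det_on U (H_mat (beta_map U (\<eta>' t) u)))" for u t
  proof -
    let ?\<beta> = "beta_map U (\<eta>' t) u"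
    have \<beta>: "?\<beta> = beta_map U (\<lambda>i. \<eta> i + W i v * exp ((u(v := t)) v)) (u(v := t))"
      using insert(2) unfolding \<eta>'_def by (simp, intro beta_map_cong) auto
    have pd: "pos_def_on U (H_mat ?\<beta>)"
    proof (rule pos_def_on_beta_map[OF insert(1)])
      show "0 \<le> \<eta>' t i" if "i \<in> U" for i
        using insert(4)[of i] that W_nonneg[of i v] by (simp add: \<eta>'_def)
      show "reaches_boundary U (\<eta>' t)"
        unfolding \<eta>'_def by (rule reaches_boundary_insert[OF insert(5)]) (use insert(4) in auto)
    qed
    have new: "2 * beta_map (insert v U) \<eta> (u(v := t)) v = exp (- t) * b ?\<beta> + q ?\<beta>"
      using beta_map_new_vertex[where u = "u(v := t)" and \<eta> = \<eta>, OF insert(1,2) pd \<beta>] pd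
      by (simp add: b_def q_def)
    have eq: "beta_map (insert v U) \<eta> (u(v := t)) = ?\<beta>(v := 1 / 2 * (exp (- t) * b ?\<beta> + q ?\<beta>))"
    proof
      fix i
      consider "i = v" | "i \<in> U" "i \<noteq> v" | "i \<notin> insert v U" using insert(2) by auto
      then show "beta_map (insert v U) \<eta> (u(v := t)) i = (?\<beta>(v := 1 / 2 * (exp (- t) * b ?\<beta> + q ?\<beta>))) i"
      proof cases
        case 2
        then show ?thesis unfolding beta_map_insert[OF insert(1,2) 2(1)] \<beta>[symmetric] by simp
      qed (use new in \<open>auto simp: beta_map_def\<close>)
    qed
    have "det_on (insert v U) (H_mat (beta_map (insert v U) \<eta> (u(v := t)))) =
        det_on U (H_mat ?\<beta>) * (exp (- t) * b ?\<beta>)"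
      using pd new unfolding eq
      by (subst det_on_insert[OF insert(1,2) H_mat_sym])
         (simp_all add: H_mat_update[OF insert(2)] Schur_pivot_H_mat[OF insert(2)] pivot_update[OF insert(2)] q_def add_divide_distrib)
    then have "ennreal (det_on (insert v U) (H_mat (beta_map (insert v U) \<eta> (u(v := t))))) =
        ennreal (exp (- t) * b ?\<beta>) * ennreal (det_on U (H_mat ?\<beta>))"
      using b_pos[OF pd] by (simp only: mult.commute[of "det_on U _"]) (simp add: ennreal_mult')
    then show ?thesis
      unfolding eq \<Phi>_def by (simp only: mult.assoc)
  qed
  have "(\<integral>\<^sup>+u. F (beta_map (insert v U) \<eta> u) * ennreal (det_on (insert v U) (H_mat (beta_map (insert v U) \<eta> u))) \<partial>?N) =
    (\<integral>\<^sup>+t. (\<integral>\<^sup>+u. \<Phi> t (beta_map U (\<eta>' t) u) * ennreal (det_on U (H_mat (beta_map U (\<eta>' t) u))) \<partial>?M) \<partial>lborel)"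
    unfolding key[symmetric] by (rule product_nn_integral_insert_rev[OF insert(1,2)]) measurable
  also have "\<dots> = (\<integral>\<^sup>+t. 2 ^ card U * (\<integral>\<^sup>+\<beta>. \<Phi> t \<beta> * indicator {\<beta>. pos_def_on U (H_mat \<beta>)} \<beta> \<partial>?M) \<partial>lborel)"
  proof (intro nn_integral_cong insert.IH \<Phi>)
    fix t
    show "0 \<le> \<eta>' t i" if "i \<in> U" for i
      using insert(4)[of i] that W_nonneg[of i v] by (simp add: \<eta>'_def)
    show "reaches_boundary U (\<eta>' t)"
      unfolding \<eta>'_def by (rule reaches_boundary_insert[OF insert(5)]) (use insert(4) in auto)
  qed
  also have "\<dots> = 2 ^ card U * (\<integral>\<^sup>+t. (\<integral>\<^sup>+\<beta>. \<Phi> t \<beta> * indicator {\<beta>. pos_def_on U (H_mat \<beta>)} \<beta> \<partial>?M) \<partial>lborel)"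
    by (intro nn_integral_cmult) measurable
  also have "(\<integral>\<^sup>+t. (\<integral>\<^sup>+\<beta>. \<Phi> t \<beta> * indicator {\<beta>. pos_def_on U (H_mat \<beta>)} \<beta> \<partial>?M) \<partial>lborel) =
      (\<integral>\<^sup>+\<beta>. (\<integral>\<^sup>+t. \<Phi> t \<beta> * indicator {\<beta>. pos_def_on U (H_mat \<beta>)} \<beta> \<partial>lborel) \<partial>?M)"
    by (rule Fubini') measurable
  also have "\<dots> = (\<integral>\<^sup>+\<beta>. 2 * (\<integral>\<^sup>+y. F (\<beta>(v := y)) *
      indicator {\<beta>. pos_def_on (insert v U) (H_mat \<beta>)} (\<beta>(v := y)) \<partial>lborel) \<partial>?M)"
  proof (intro nn_integral_cong)
    fix \<beta> assume \<beta>[measurable]: "\<beta> \<in> space ?M"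
    show "(\<integral>\<^sup>+t. \<Phi> t \<beta> * indicator {\<beta>. pos_def_on U (H_mat \<beta>)} \<beta> \<partial>lborel) =
      2 * (\<integral>\<^sup>+y. F (\<beta>(v := y)) * indicator {\<beta>. pos_def_on (insert v U) (H_mat \<beta>)} (\<beta>(v := y)) \<partial>lborel)"
    proof (cases "pos_def_on U (H_mat \<beta>)")
      case True
      have [measurable]: "(\<lambda>y. F (\<beta>(v := y))) \<in> borel_measurable borel"
        using measurable_compose[OF measurable_component_update[OF \<beta> insert(2)] F] by simp
      have "(\<integral>\<^sup>+t. \<Phi> t \<beta> * indicator {\<beta>. pos_def_on U (H_mat \<beta>)} \<beta> \<partial>lborel) =
          2 * (\<integral>\<^sup>+y. F (\<beta>(v := y)) * indicator {y. q \<beta> < 2 * y} y \<partial>lborel)"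
        using True nn_integral_exp_substitution[OF b_pos[OF True], of "\<lambda>y. F (\<beta>(v := y))" "q \<beta>"]
        by (simp add: \<Phi>_def)
      also have "(\<integral>\<^sup>+y. F (\<beta>(v := y)) * indicator {y. q \<beta> < 2 * y} y \<partial>lborel) =
          (\<integral>\<^sup>+y. F (\<beta>(v := y)) * indicator {\<beta>. pos_def_on (insert v U) (H_mat \<beta>)} (\<beta>(v := y)) \<partial>lborel)"
        using True
        by (intro nn_integral_cong) (auto simp: indicator_def pos_def_on_H_mat_insert[OF insert(1,2)]
            H_mat_update[OF insert(2)] pivot_update[OF insert(2)] q_def)
      finally show ?thesis .
    next
      case False
      then show ?thesis
        by (simp add: indicator_def pos_def_on_H_mat_insert[OF insert(1,2)] H_mat_update[OF insert(2)])
    qed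
  qed
  also have "\<dots> = 2 * (\<integral>\<^sup>+\<beta>. (\<integral>\<^sup>+y. F (\<beta>(v := y)) *
      indicator {\<beta>. pos_def_on (insert v U) (H_mat \<beta>)} (\<beta>(v := y)) \<partial>lborel) \<partial>?M)"
    using insert(1) by (intro nn_integral_cmult) measurable
  also have "\<dots> = 2 * (\<integral>\<^sup>+\<beta>. F \<beta> * indicator {\<beta>. pos_def_on (insert v U) (H_mat \<beta>)} \<beta> \<partial>?N)"
    using insert(1) by (subst product_nn_integral_insert[OF insert(1,2)]) measurable
  finally show ?case using insert(1,2) by (simp add: mult_ac)
qed

text \<open>
  In terms of the pivot x = 2 \<beta> v - q, the density on the larger set factorises into a part K without x and
  the integrand of the inverse Gaussian integral with parameter b. Its value, a multiple of exp(-b), supplies the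
  cross term that turns <\<eta>,G\<eta>> into the same form for \<eta> + W(.,v).
\<close>
lemma beta_density_marginal:
  assumes U: "finite U" "v \<notin> U" and \<eta>: "\<And>i. i \<in> insert v U \<Longrightarrow> 0 \<le> \<eta> i"
    and bd: "reaches_boundary (insert v U) \<eta>"
  shows "(\<integral>\<^sup>+y. ennreal (beta_density (insert v U) \<eta> (\<beta>(v := y))) \<partial>lborel) =
    ennreal (beta_density U (\<lambda>i. \<eta> i + W i v) \<beta>)"
proof (cases "pos_def_on U (H_mat \<beta>)")
  case False
  then show ?thesis
    by (simp add: beta_density_def pos_def_on_H_mat_insert[OF U] H_mat_update[OF U(2)])
next
  case True
  define b where "b = pivot_source U v \<eta> \<beta>"
  define q where "q = pivot_shift U v \<beta>"
  define w where "w = (\<Sum>i\<in>U. W v i)"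
  define D where "D = det_on U (H_mat \<beta>)"
  define h where "h = bilinear_form U (H_mat \<beta>) (\<lambda>_. 1) (\<lambda>_. 1)"
  define g where "g = bilinear_form U (inv_on U (H_mat \<beta>)) \<eta> \<eta>"
  define K where "K = sqrt (2 / pi) ^ Suc (card U) *
    exp (- (1 / 2) * (h + q - 2 * w) - 1 / 2 * g + sum \<eta> U + \<eta> v) / sqrt D"
  have b: "0 < b" unfolding b_def by (rule pivot_source_pos[OF U True \<eta> bd])
  have D: "0 < D" unfolding D_def by (rule det_on_pos[OF U(1) True])
  have one: "bilinear_form (insert v U) (H_mat \<beta>') (\<lambda>_. 1) (\<lambda>_. 1) =
     bilinear_form U (H_mat \<beta>') (\<lambda>_. 1) (\<lambda>_. 1) + 2 * \<beta>' v - 2 * w" for \<beta>'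
  proof -
    have "(\<Sum>i\<in>U. H_mat \<beta>' v i) = - w" "(\<Sum>i\<in>U. H_mat \<beta>' i v) = - w"
      unfolding w_def sum_negf[symmetric] using U(2) by (auto intro!: sum.cong simp: H_mat_def W_sym)
    moreover have "H_mat \<beta>' v v = 2 * \<beta>' v" by (simp add: H_mat_def)
    ultimately show ?thesis using U by (simp add: bilinear_form_def sum.distrib)
  qed
  have dens: "beta_density (insert v U) \<eta> (\<beta>(v := y)) =
      K * (exp (- (1 / 2) * ((2 * y - q) + b\<^sup>2 / (2 * y - q))) / sqrt (2 * y - q)) * indicator {0<..} (2 * y - q)" for y
  proof (cases "q < 2 * y")
    case True
    let ?H = "H_mat (\<beta>(v := y))"
    have pd: "pos_def_on (insert v U) ?H"
      using True \<open>pos_def_on U (H_mat \<beta>)\<close>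
      by (simp add: pos_def_on_H_mat_insert[OF U] H_mat_update[OF U(2)] pivot_update[OF U(2)] q_def)
    have pdU: "pos_def_on U ?H" by (simp add: H_mat_update[OF U(2)] \<open>pos_def_on U (H_mat \<beta>)\<close>)
    have piv: "Schur_pivot U v ?H = 2 * y - q"
      by (simp add: Schur_pivot_H_mat[OF U(2)] pivot_update[OF U(2)] q_def)
    have form_inv: "bilinear_form (insert v U) (inv_on (insert v U) ?H) \<eta> \<eta> = g + b\<^sup>2 / (2 * y - q)"
      using bilinear_form_inv_on_insert[OF U H_mat_sym pd, of \<eta>]
      unfolding piv pivot_source_Schur[OF U pdU] pivot_update[OF U(2)] H_mat_update[OF U(2)] g_def b_def .
    have det: "det_on (insert v U) ?H = D * (2 * y - q)"
      using det_on_insert[OF U H_mat_sym pdU] unfolding piv H_mat_update[OF U(2)] D_def .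
    have form_one: "bilinear_form (insert v U) ?H (\<lambda>_. 1) (\<lambda>_. 1) = h + q - 2 * w + (2 * y - q)"
      unfolding one H_mat_update[OF U(2)] h_def by simp
    have "beta_density (insert v U) \<eta> (\<beta>(v := y)) =
      sqrt (2 / pi) ^ Suc (card U) *
      exp (- (1 / 2) * (h + q - 2 * w + (2 * y - q)) - 1 / 2 * (g + b\<^sup>2 / (2 * y - q)) + (\<eta> v + sum \<eta> U))
        / sqrt (D * (2 * y - q))"
      using pd by (simp only: beta_density_def form_inv form_one det if_True card_insert_disjoint[OF U] sum.insert[OF U])
    also have "- (1 / 2) * (h + q - 2 * w + (2 * y - q)) - 1 / 2 * (g + b\<^sup>2 / (2 * y - q)) + (\<eta> v + sum \<eta> U) =
      (- (1 / 2) * (h + q - 2 * w) - 1 / 2 * g + sum \<eta> U + \<eta> v) + (- (1 / 2) * ((2 * y - q) + b\<^sup>2 / (2 * y - q)))"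
      by argo
    finally have "beta_density (insert v U) \<eta> (\<beta>(v := y)) =
      sqrt (2 / pi) ^ Suc (card U) *
      exp ((- (1 / 2) * (h + q - 2 * w) - 1 / 2 * g + sum \<eta> U + \<eta> v) + (- (1 / 2) * ((2 * y - q) + b\<^sup>2 / (2 * y - q))))
        / (sqrt D * sqrt (2 * y - q))"
      by (simp only: real_sqrt_mult)
    then show ?thesis using True unfolding exp_add K_def by simp
  next
    case False
    then show ?thesis
      by (simp add: beta_density_def pos_def_on_H_mat_insert[OF U] pivot_update[OF U(2)] q_def)
  qed
  have K: "0 \<le> K" unfolding K_def using D by simp
  have "(\<integral>\<^sup>+y. ennreal (beta_density (insert v U) \<eta> (\<beta>(v := y))) \<partial>lborel) =
      (\<integral>\<^sup>+y. ennreal K * (ennreal (exp (- (1 / 2) * ((2 * y - q) + b\<^sup>2 / (2 * y - q))) / sqrt (2 * y - q)) * indicator {0<..} (2 * y - q)) \<partial>lborel)"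
    unfolding dens using K by (intro nn_integral_cong) (simp add: indicator_def ennreal_mult'[symmetric])
  also have "\<dots> = ennreal K * (\<integral>\<^sup>+y. ennreal (exp (- (1 / 2) * ((2 * y - q) + b\<^sup>2 / (2 * y - q))) / sqrt (2 * y - q)) * indicator {0<..} (2 * y - q) \<partial>lborel)"
    by (intro nn_integral_cmult) measurable
  also have "\<dots> = ennreal K * (ennreal (1 / 2) * (\<integral>\<^sup>+x. ennreal (exp (- (1 / 2) * (x + b\<^sup>2 / x)) / sqrt x) * indicator {0<..} x \<partial>lborel))"
    by (subst nn_integral_real_affine[where c = "1 / 2" and t = "q / 2"]) (auto simp: algebra_simps)
  also have "\<dots> = ennreal (K * (1 / 2) * (sqrt (2 * pi) * exp (- b)))"
    unfolding nn_integral_inverse_Gaussian[OF b] using K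
    by (simp only: ennreal_mult'[symmetric] mult.assoc zero_le_divide_1_iff zero_le_numeral)
  also have "K * (1 / 2) * (sqrt (2 * pi) * exp (- b)) = beta_density U (\<lambda>i. \<eta> i + W i v) \<beta>"
  proof -
    have bil: "bilinear_form U (inv_on U (H_mat \<beta>)) (\<lambda>i. \<eta> i + W i v) (\<lambda>i. \<eta> i + W i v) = g + 2 * (b - \<eta> v) + q"
    proof -
      have "(\<Sum>i\<in>U. \<eta> i * green U \<beta> (\<lambda>j. W j v) i) = (\<Sum>i\<in>U. W v i * green U \<beta> \<eta> i)"
        using green_self_adjoint[OF U(1) True, of \<eta> "\<lambda>j. W j v"] by (simp add: W_sym[of _ v])
      then show ?thesis
        unfolding g_def q_def b_def pivot_shift_def pivot_source_def bilinear_form_green green_add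
        by (simp add: algebra_simps sum.distrib W_sym[of _ v])
    qed
    have w: "(\<Sum>i\<in>U. \<eta> i + W i v) = sum \<eta> U + w" by (simp add: sum.distrib w_def W_sym[of _ v])
    have c: "sqrt (2 / pi) * (1 / 2) * sqrt (2 * pi) = 1"
      by (simp add: real_sqrt_mult real_sqrt_divide field_simps)
    have "K * (1 / 2) * (sqrt (2 * pi) * exp (- b)) = (sqrt (2 / pi) * (1 / 2) * sqrt (2 * pi)) *
      (sqrt (2 / pi) ^ card U * exp (- (1 / 2) * (h + q - 2 * w) - 1 / 2 * g + sum \<eta> U + \<eta> v + (- b)) / sqrt D)"
      unfolding K_def exp_add by (simp add: mult_ac)
    also have "\<dots> = beta_density U (\<lambda>i. \<eta> i + W i v) \<beta>"
      unfolding c beta_density_def bil w using True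
      by (simp add: h_def[symmetric] D_def[symmetric] algebra_simps)
    finally show ?thesis .
  qed
  finally show ?thesis .
qed

section \<open>Marginals and tilting of the density\<close>

lemma beta_density_cong:
  assumes "\<And>i. i \<in> U \<Longrightarrow> \<eta> i = \<eta>' i"
  shows "beta_density U \<eta> = beta_density U \<eta>'"
proof -
  have form: "bilinear_form U A \<eta> \<eta> = bilinear_form U A \<eta>' \<eta>'" for A
    using assms by (intro bilinear_form_cong) auto
  have "sum \<eta> U = sum \<eta>' U" using assms by (intro sum.cong) auto
  then show ?thesis unfolding beta_density_def form by (simp only:)
qed

lemma beta_density_marginal_set:
  assumes "finite D" "finite U" "U \<inter> D = {}" "\<And>i. i \<in> U \<union> D \<Longrightarrow> 0 \<le> \<eta> i" "reaches_boundary (U \<union> D) \<eta>"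
    and g: "g \<in> borel_measurable (\<Pi>\<^sub>M i\<in>U. lborel)"
  shows "(\<integral>\<^sup>+\<beta>. g (restrict \<beta> U) * ennreal (beta_density (U \<union> D) \<eta> \<beta>) \<partial>(\<Pi>\<^sub>M i\<in>U \<union> D. lborel)) =
    (\<integral>\<^sup>+\<beta>. g \<beta> * ennreal (beta_density U (\<lambda>i. \<eta> i + (\<Sum>k\<in>D. W i k)) \<beta>) \<partial>(\<Pi>\<^sub>M i\<in>U. lborel))"
  using assms(1-5)
proof (induction D arbitrary: \<eta>)
  case empty
  have "restrict \<beta> U = \<beta>" if "\<beta> \<in> space (\<Pi>\<^sub>M i\<in>U. (lborel :: real measure))" for \<beta>
    using that unfolding space_PiM by (rule PiE_restrict)
  then show ?case unfolding Un_empty_right sum.empty add_0_right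
    by (intro nn_integral_cong) (simp only:)
next
  case (insert v D)
  interpret product_sigma_finite "\<lambda>_::'a. lborel :: real measure" ..
  have fin: "finite (U \<union> D)" "v \<notin> U \<union> D" using insert by auto
  have ins: "U \<union> insert v D = insert v (U \<union> D)" by simp
  have \<eta>: "\<And>i. i \<in> insert v (U \<union> D) \<Longrightarrow> 0 \<le> \<eta> i" and bd: "reaches_boundary (insert v (U \<union> D)) \<eta>"
    using insert.prems unfolding ins by auto
  have fin': "finite (insert v (U \<union> D))" using fin by simp
  note [measurable] = g borel_measurable_beta_density[OF fin']
  have [measurable]: "(\<lambda>\<beta>. restrict \<beta> U) \<in> (\<Pi>\<^sub>M i\<in>insert v (U \<union> D). lborel) \<rightarrow>\<^sub>M (\<Pi>\<^sub>M i\<in>U. lborel)"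
    by (rule measurable_restrict_subset) auto
  have restr: "restrict (\<beta>(v := y)) U = restrict \<beta> U" for \<beta> :: "'a \<Rightarrow> real" and y
    using fin(2) by (auto simp: restrict_def)
  have "(\<integral>\<^sup>+\<beta>. g (restrict \<beta> U) * ennreal (beta_density (insert v (U \<union> D)) \<eta> \<beta>) \<partial>(\<Pi>\<^sub>M i\<in>insert v (U \<union> D). lborel)) =
    (\<integral>\<^sup>+\<beta>. (\<integral>\<^sup>+y. g (restrict \<beta> U) * ennreal (beta_density (insert v (U \<union> D)) \<eta> (\<beta>(v := y))) \<partial>lborel) \<partial>(\<Pi>\<^sub>M i\<in>U \<union> D. lborel))"
    by (subst product_nn_integral_insert[OF fin]) (measurable, simp only: restr)
  also have "\<dots> = (\<integral>\<^sup>+\<beta>. g (restrict \<beta> U) * ennreal (beta_density (U \<union> D) (\<lambda>i. \<eta> i + W i v) \<beta>) \<partial>(\<Pi>\<^sub>M i\<in>U \<union> D. lborel))"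
  proof (intro nn_integral_cong)
    fix \<beta> assume \<beta>: "\<beta> \<in> space (\<Pi>\<^sub>M i\<in>U \<union> D. (lborel :: real measure))"
    have [measurable]: "(\<lambda>y. beta_density (insert v (U \<union> D)) \<eta> (\<beta>(v := y))) \<in> borel_measurable borel"
      using measurable_compose[OF measurable_component_update[OF \<beta> fin(2)] borel_measurable_beta_density[OF fin']] by simp
    show "(\<integral>\<^sup>+y. g (restrict \<beta> U) * ennreal (beta_density (insert v (U \<union> D)) \<eta> (\<beta>(v := y))) \<partial>lborel) =
      g (restrict \<beta> U) * ennreal (beta_density (U \<union> D) (\<lambda>i. \<eta> i + W i v) \<beta>)"
      by (subst nn_integral_cmult) (measurable, simp only: beta_density_marginal[OF fin \<eta> bd])
  qed
  also have "\<dots> = (\<integral>\<^sup>+\<beta>. g \<beta> * ennreal (beta_density U (\<lambda>i. \<eta> i + W i v + (\<Sum>k\<in>D. W i k)) \<beta>) \<partial>(\<Pi>\<^sub>M i\<in>U. lborel))"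
  proof (rule insert.IH)
    show "0 \<le> \<eta> i + W i v" if "i \<in> U \<union> D" for i
      using \<eta>[of i] that W_nonneg[of i v] by auto
    have "reaches_boundary (U \<union> D) (\<lambda>i. \<eta> i + W i v * 1)"
      by (rule reaches_boundary_insert[OF bd]) (use \<eta> in auto)
    then show "reaches_boundary (U \<union> D) (\<lambda>i. \<eta> i + W i v)" by simp
  qed (use insert.prems in auto)
  also have "(\<lambda>i. \<eta> i + W i v + (\<Sum>k\<in>D. W i k)) = (\<lambda>i. \<eta> i + (\<Sum>k\<in>insert v D. W i k))"
    using insert(1,2) by (simp add: add.assoc)
  finally show ?case unfolding ins .
qed

text \<open>Integrating out all vertices leaves the density on the empty set, which is the constant 1.\<close>
lemma beta_density_total_mass:
  assumes "finite U" "\<And>i. i \<in> U \<Longrightarrow> 0 \<le> \<eta> i" "reaches_boundary U \<eta>"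
  shows "(\<integral>\<^sup>+\<beta>. ennreal (beta_density U \<eta> \<beta>) \<partial>(\<Pi>\<^sub>M i\<in>U. lborel)) = 1"
proof -
  interpret product_sigma_finite "\<lambda>_::'a. lborel :: real measure" ..
  have "(\<integral>\<^sup>+\<beta>. ennreal (beta_density U \<eta> \<beta>) \<partial>(\<Pi>\<^sub>M i\<in>U. lborel)) =
    (\<integral>\<^sup>+\<beta>. ennreal (beta_density {} (\<lambda>i. \<eta> i + (\<Sum>k\<in>U. W i k)) \<beta>) \<partial>(\<Pi>\<^sub>M i\<in>{}. lborel))"
    using beta_density_marginal_set[of U "{}" \<eta> "\<lambda>_. 1"] assms by simp
  also have "\<dots> = 1"
    by (simp add: PiM_empty nn_integral_count_space_finite beta_density_def pos_def_on_def bilinear_form_def det_on_empty)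
  finally show ?thesis .
qed

lemma reaches_boundary_mono:
  assumes "reaches_boundary U \<eta>" "\<And>i. i \<in> U \<Longrightarrow> 0 < \<eta> i \<Longrightarrow> 0 < \<eta>' i"
  shows "reaches_boundary U \<eta>'"
  using assms unfolding reaches_boundary_def by (meson in_mono)

text \<open>Every \<beta> with H positive definite is reached: take the logarithm of the solution of H y = \<eta>, which is
  positive.\<close>
lemma beta_map_ln_green:
  assumes U: "finite U" "pos_def_on U (H_mat \<beta>)" and \<eta>: "\<And>i. i \<in> U \<Longrightarrow> 0 \<le> \<eta> i" "reaches_boundary U \<eta>"
    and \<beta>: "\<beta> \<in> extensional U" and u: "\<And>i. i \<in> U \<Longrightarrow> u i = ln (green U \<beta> \<eta> i)"
  shows "beta_map U \<eta> u = \<beta>"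
proof
  fix i
  show "beta_map U \<eta> u i = \<beta> i"
  proof (cases "i \<in> U")
    case True
    have pos: "0 < green U \<beta> \<eta> j" if "j \<in> U" for j by (rule green_pos[OF U \<eta> that])
    then have e: "exp (u j) = green U \<beta> \<eta> j" if "j \<in> U" for j using u that by simp
    have "2 * \<beta> i * green U \<beta> \<eta> i = (\<Sum>j\<in>U. W i j * green U \<beta> \<eta> j) + \<eta> i"
      using H_mat_green[OF U True, of \<eta>] H_mat_apply[OF U(1) True, of \<beta> "green U \<beta> \<eta>"] by simp
    then show ?thesis using True pos[OF True] e
      by (simp add: beta_map_def exp_minus field_simps)
  qed (use \<beta> in \<open>auto simp: beta_map_def extensional_def\<close>)
qed

text \<open>Completing the square: -<\<eta>,G\<eta>>/2 + <\<theta>,G\<eta>> - <\<theta>,G\<theta>>/2 = -<\<eta>-\<theta>,G(\<eta>-\<theta>)>/2. The factor exp(sum of \<theta>)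
  comes from the linear term.\<close>
lemma beta_density_tilt:
  assumes "finite U" "pos_def_on U (H_mat \<beta>)"
  shows "exp ((\<Sum>i\<in>U. \<theta> i * green U \<beta> \<eta> i) - 1 / 2 * bilinear_form U (inv_on U (H_mat \<beta>)) \<theta> \<theta>)
      * beta_density U \<eta> \<beta> = exp (sum \<theta> U) * beta_density U (\<lambda>i. \<eta> i - \<theta> i) \<beta>"
proof -
  let ?B = "\<lambda>x y. bilinear_form U (inv_on U (H_mat \<beta>)) x y"
  have "?B (\<lambda>i. \<eta> i - \<theta> i) (\<lambda>i. \<eta> i - \<theta> i) = ?B \<eta> \<eta> - ?B \<eta> \<theta> - ?B \<theta> \<eta> + ?B \<theta> \<theta>"
    unfolding bilinear_form_def by (simp add: algebra_simps sum.distrib sum_subtractf)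
  also have "?B \<eta> \<theta> = ?B \<theta> \<eta>"
    unfolding bilinear_form_green by (rule green_self_adjoint[OF assms])
  finally have B: "?B (\<lambda>i. \<eta> i - \<theta> i) (\<lambda>i. \<eta> i - \<theta> i) =
      ?B \<eta> \<eta> - 2 * (\<Sum>i\<in>U. \<theta> i * green U \<beta> \<eta> i) + ?B \<theta> \<theta>"
    unfolding bilinear_form_green by simp
  define x where "x = - (1 / 2) * bilinear_form U (H_mat \<beta>) (\<lambda>_. 1) (\<lambda>_. 1)"
  define K where "K = sqrt (2 / pi) ^ card U / sqrt (det_on U (H_mat \<beta>))"
  have dens: "beta_density U \<eta> \<beta> = K * exp (x - 1 / 2 * ?B \<eta> \<eta> + sum \<eta> U)" for \<eta>
    unfolding beta_density_def x_def K_def using assms(2) by simp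
  have "exp ((\<Sum>i\<in>U. \<theta> i * green U \<beta> \<eta> i) - 1 / 2 * ?B \<theta> \<theta>) * exp (x - 1 / 2 * ?B \<eta> \<eta> + sum \<eta> U) =
    exp (sum \<theta> U) * exp (x - 1 / 2 * ?B (\<lambda>i. \<eta> i - \<theta> i) (\<lambda>i. \<eta> i - \<theta> i) + (\<Sum>i\<in>U. \<eta> i - \<theta> i))"
    unfolding B exp_add[symmetric] by (simp add: sum_subtractf field_simps)
  then show ?thesis unfolding dens mult.left_commute[of _ K] by (simp only:)
qed

end

section \<open>Wired boundary conditions\<close>

lemma sets_PiM_lborel: "sets (\<Pi>\<^sub>M i\<in>I. (lborel :: real measure)) = sets (\<Pi>\<^sub>M i\<in>I. borel)"
  by (intro sets_PiM_cong) auto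

lemma infsum_finite_support:
  fixes f :: "'a \<Rightarrow> real"
  assumes "finite S" "\<And>k. k \<in> V - S \<Longrightarrow> f k = 0" "S \<subseteq> V"
  shows "(\<Sum>\<^sub>\<infinity>k\<in>V - U. f k) = sum f (S - U)"
proof -
  have "(\<Sum>\<^sub>\<infinity>k\<in>V - U. f k) = (\<Sum>\<^sub>\<infinity>k\<in>S - U. f k)"
    using assms by (intro infsum_cong_neutral) auto
  then show ?thesis using assms(1) by simp
qed

sublocale infinite_weighted_graph \<subseteq> symmetric_weights W
proof
  show "W i j = W j i" for i j by (rule weight_sym)
  show "0 \<le> W i j" for i j by (cases "(i, j) \<in> E") (auto simp: weight_zero less_imp_le[OF weight_pos])
  show "W i i = 0" for i using no_loops by (auto intro!: weight_zero simp: irrefl_def)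
qed

context infinite_weighted_graph begin

definition wired_eta :: "'a set \<Rightarrow> 'a \<Rightarrow> real" where
  "wired_eta U i = (\<Sum>\<^sub>\<infinity>k\<in>V - U. W i k)"

lemma wired_eta_sum:
  assumes "i \<in> V"
  shows "wired_eta U i = (\<Sum>k\<in>E `` {i} - U. W i k)"
  unfolding wired_eta_def
  by (rule infsum_finite_support) (use locally_finite[OF assms] edges_subset in \<open>auto intro: weight_zero\<close>)

lemma wired_eta_nonneg: "0 \<le> wired_eta U i"
  unfolding wired_eta_def by (intro infsum_nonneg W_nonneg)

lemma wired_eta_pos:
  assumes "i \<in> V" "(i, j) \<in> E" "j \<notin> U"
  shows "0 < wired_eta U i"
  unfolding wired_eta_sum[OF assms(1)]
proof (rule sum_pos2[of _ j])
  show "finite (E `` {i} - U)" using locally_finite[OF assms(1)] by blast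
qed (use assms in \<open>auto simp: weight_pos W_nonneg\<close>)

text \<open>The vertices of U' - U leave the boundary sum of U and become inner vertices of U'.\<close>
lemma wired_eta_shrink:
  assumes "finite U'" "U \<subseteq> U'" "i \<in> V"
  shows "wired_eta U i = wired_eta U' i + (\<Sum>k\<in>U' - U. W i k)"
proof -
  let ?S = "E `` {i}"
  have fin: "finite ?S" by (rule locally_finite[OF assms(3)])
  have "(\<Sum>k\<in>?S - U. W i k) = (\<Sum>k\<in>?S - U'. W i k) + (\<Sum>k\<in>?S \<inter> (U' - U). W i k)"
    using fin assms(2) by (subst sum.union_disjoint[symmetric]) (auto intro: sum.cong)
  also have "(\<Sum>k\<in>?S \<inter> (U' - U). W i k) = (\<Sum>k\<in>U' - U. W i k)"
    using assms(1) by (intro sum.mono_neutral_left) (auto intro: weight_zero)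
  finally show ?thesis unfolding wired_eta_sum[OF assms(3)] .
qed

text \<open>U is finite and the graph is infinite and connected, so a path from Z to a vertex outside U has to
  leave Z somewhere.\<close>
lemma reaches_boundary_wired_eta:
  assumes "finite U" "U \<subseteq> V"
  shows "reaches_boundary U (wired_eta U)"
  unfolding reaches_boundary_def
proof (intro allI impI)
  fix Z assume Z: "Z \<subseteq> U" "Z \<noteq> {}"
  obtain i where i: "i \<in> Z" using Z by auto
  have "V - U \<noteq> {}" using infinite_vertices assms(1) by (metis Diff_eq_empty_iff finite_subset)
  then obtain j where j: "j \<in> V" "j \<notin> U" by auto
  have "(i, j) \<in> E\<^sup>*" using connected_graph i j Z assms by blast
  moreover have "\<exists>a b. a \<in> Z \<and> b \<notin> Z \<and> (a, b) \<in> E" if "(i, k) \<in> E\<^sup>*" "k \<notin> Z" for k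
    using that
  proof (induction rule: rtrancl_induct)
    case base
    then show ?case using i by simp
  next
    case (step y z)
    then show ?case by blast
  qed
  ultimately obtain a b where ab: "a \<in> Z" "b \<notin> Z" "(a, b) \<in> E" using j Z by blast
  then show "\<exists>i\<in>Z. 0 < wired_eta U i \<or> (\<exists>j\<in>U - Z. 0 < W i j)"
    using wired_eta_pos[of a b U] weight_pos[of a b] Z assms(2) by (cases "b \<in> U") blast+
qed

end

locale wired_graph = infinite_weighted_graph V E W
  for V :: "'a set" and E :: "('a \<times> 'a) set" and W :: "'a \<Rightarrow> 'a \<Rightarrow> real" +
  fixes U :: "'a set" and \<delta> :: 'a
  assumes U: "finite U" "U \<subseteq> V" and \<delta>: "\<delta> \<notin> U"
begin

lemma wired_weight_simps:
  "i \<in> U \<Longrightarrow> j \<in> U \<Longrightarrow> wired_weight V W U \<delta> i j = W i j"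
  "i \<in> U \<Longrightarrow> wired_weight V W U \<delta> i \<delta> = wired_eta U i"
  "i \<in> U \<Longrightarrow> wired_weight V W U \<delta> \<delta> i = wired_eta U i"
  "wired_weight V W U \<delta> \<delta> \<delta> = 0"
  using \<delta> by (auto simp: wired_weight_def wired_eta_def)

lemma wired_weight_sym: "wired_weight V W U \<delta> i j = wired_weight V W U \<delta> j i"
proof (cases "i \<in> U \<and> j \<in> U")
  case True
  then have "wired_weight V W U \<delta> i j = W i j" by (simp only: wired_weight_simps)
  also have "\<dots> = W j i" by (rule W_sym)
  also have "\<dots> = wired_weight V W U \<delta> j i" using True by (simp only: wired_weight_simps)
  finally show ?thesis .
next
  case False
  then show ?thesis using \<delta> unfolding wired_weight_def by (cases "i \<in> U"; cases "j \<in> U") simp_all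
qed

lemma wired_weight_zero:
  assumes "i \<in> insert \<delta> U" "j \<in> insert \<delta> U" "(i, j) \<notin> wired_edges V E U \<delta>"
  shows "wired_weight V W U \<delta> i j = 0"
proof -
  have "wired_eta U k = 0" if "k \<in> U" "\<not> (\<exists>j\<in>V - U. (k, j) \<in> E)" for k
  proof -
    have "k \<in> V" using that U by auto
    then show ?thesis unfolding wired_eta_sum[OF \<open>k \<in> V\<close>]
      using that edges_subset by (intro sum.neutral) auto
  qed
  then show ?thesis
    using assms by (auto simp: wired_edges_def wired_weight_simps weight_zero)
qed

text \<open>
  Here and in the next lemmas u may have any height at the reference vertex, which only rescales \<eta>. A
  function recovering u from \<beta> may return such values outside the range of \<beta>, and measurability has to be
  shown for them as well.
\<close>
lemma wired_beta_eq:
  "wired_beta V E W U \<delta> u = beta_map U (\<lambda>i. wired_eta U i * exp (u \<delta>)) u"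
proof -
  have neighbour_sum: "(\<Sum>j | j \<in> insert \<delta> U \<and> (i, j) \<in> wired_edges V E U \<delta>. wired_weight V W U \<delta> i j * exp (u j - u i)) =
      exp (- u i) * ((\<Sum>j\<in>U. W i j * exp (u j)) + wired_eta U i * exp (u \<delta>))" if i: "i \<in> U" for i
  proof -
    have "(\<Sum>j | j \<in> insert \<delta> U \<and> (i, j) \<in> wired_edges V E U \<delta>. wired_weight V W U \<delta> i j * exp (u j - u i)) =
        (\<Sum>j\<in>insert \<delta> U. wired_weight V W U \<delta> i j * exp (u j - u i))"
      using U i wired_weight_zero[of i] by (intro sum.mono_neutral_left) auto
    also have "\<dots> = wired_eta U i * exp (u \<delta> - u i) + (\<Sum>j\<in>U. W i j * exp (u j - u i))"
      using U \<delta> i by (simp add: wired_weight_simps)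
    also have "\<dots> = exp (- u i) * ((\<Sum>j\<in>U. W i j * exp (u j)) + wired_eta U i * exp (u \<delta>))"
      by (simp add: diff_conv_add_uminus exp_add sum_distrib_left algebra_simps del: add_uminus_conv_diff)
    finally show ?thesis .
  qed
  have vertices: "insert \<delta> U - {\<delta>} = U" using \<delta> by auto
  show ?thesis unfolding wired_beta_def beta_of_def beta_map_def vertices
    by (rule restrict_ext) (simp only: neighbour_sum)
qed

lemma A_mat_wired:
  assumes "i \<in> U" "j \<in> U"
  shows "A_mat (insert \<delta> U) (wired_weight V W U \<delta>) u i j =
    exp (u i) * H_mat (beta_map U (\<lambda>i. wired_eta U i * exp (u \<delta>)) u) i j * exp (u j)"
proof (cases "i = j")
  case True
  have "(\<Sum>k\<in>insert \<delta> U. wired_weight V W U \<delta> i k * exp (u i + u k)) =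
      exp (u i) * ((\<Sum>k\<in>U. W i k * exp (u k)) + wired_eta U i * exp (u \<delta>))"
    using U \<delta> assms by (simp add: wired_weight_simps exp_add sum_distrib_left algebra_simps)
  then show ?thesis using True assms by (simp add: A_mat_def H_mat_def beta_map_def exp_minus)
qed (use assms in \<open>simp add: A_mat_def H_mat_def wired_weight_simps exp_add\<close>)

lemma A_mat_wired_sym:
  "A_mat (insert \<delta> U) (wired_weight V W U \<delta>) u i j = A_mat (insert \<delta> U) (wired_weight V W U \<delta>) u j i"
proof (cases "i = j")
  case False
  then show ?thesis using wired_weight_sym[of i j] by (simp add: A_mat_def add.commute)
qed simp

lemma pos_def_on_wired:
  "pos_def_on U (H_mat (beta_map U (\<lambda>i. wired_eta U i * exp t) u))"
proof (rule pos_def_on_beta_map[OF U(1)])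
  show "reaches_boundary U (\<lambda>i. wired_eta U i * exp t)"
    by (rule reaches_boundary_mono[OF reaches_boundary_wired_eta[OF U]]) simp
qed (simp add: wired_eta_nonneg)

lemma pos_def_on_A_mat_wired: "pos_def_on U (A_mat (insert \<delta> U) (wired_weight V W U \<delta>) u)"
proof -
  have "pos_def_on U (\<lambda>i j. exp (u i) * H_mat (beta_map U (\<lambda>i. wired_eta U i * exp (u \<delta>)) u) i j * exp (u j))"
    by (rule pos_def_on_diag_scale[OF pos_def_on_wired]) simp
  moreover have "pos_def_on U (A_mat (insert \<delta> U) (wired_weight V W U \<delta>) u) \<longleftrightarrow>
      pos_def_on U (\<lambda>i j. exp (u i) * H_mat (beta_map U (\<lambda>i. wired_eta U i * exp (u \<delta>)) u) i j * exp (u j))"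
    by (rule pos_def_on_cong) (rule A_mat_wired)
  ultimately show ?thesis by blast
qed

lemma det_on_A_mat_wired:
  "det_on U (A_mat (insert \<delta> U) (wired_weight V W U \<delta>) u) =
    (\<Prod>i\<in>U. exp (u i))\<^sup>2 * det_on U (H_mat (beta_map U (\<lambda>i. wired_eta U i * exp (u \<delta>)) u))"
  unfolding det_on_diag_scale[OF U(1), symmetric] by (rule det_on_cong) (rule A_mat_wired)

lemma inv_on_A_mat_wired:
  assumes "i \<in> U" "j \<in> U"
  shows "exp (u i) * inv_on U (A_mat (insert \<delta> U) (wired_weight V W U \<delta>) u) i j * exp (u j) =
    inv_on U (H_mat (beta_map U (\<lambda>i. wired_eta U i * exp (u \<delta>)) u)) i j"
proof -
  have "inv_on U (A_mat (insert \<delta> U) (wired_weight V W U \<delta>) u) =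
      inv_on U (\<lambda>i j. exp (u i) * H_mat (beta_map U (\<lambda>i. wired_eta U i * exp (u \<delta>)) u) i j * exp (u j))"
    by (rule inv_on_cong) (rule A_mat_wired)
  then show ?thesis
    using inv_on_diag_scale[OF U(1) pos_def_on_wired _ assms, of "\<lambda>i. exp (u i)"] by simp
qed

section \<open>The law of \<beta> under the H22 measure\<close>

abbreviation "Vt \<equiv> insert \<delta> U"
abbreviation "Wt \<equiv> wired_weight V W U \<delta>"
abbreviation "Et \<equiv> wired_edges V E U \<delta>"
abbreviation "\<eta> \<equiv> wired_eta U"

lemma finite_Vt: "finite Vt" and Vt_minus_root: "Vt - {\<delta>} = U"
  using U \<delta> by auto

lemma wired_beta_pinned: "u \<delta> = 0 \<Longrightarrow> wired_beta V E W U \<delta> u = beta_map U \<eta> u"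
  by (simp add: wired_beta_eq)

lemma pos_def_on_beta_map_eta: "pos_def_on U (H_mat (beta_map U \<eta> u))"
  using pos_def_on_wired[of 0 u] by simp

text \<open>
  Summing W (cosh - 1) over the edges equals summing W (exp(u j - u i) - 1)/2 over ordered pairs, as W is
  symmetric. The rows of vertices in U give 2 \<beta> i, the row of the reference vertex gives
  <\<eta>,exp u> = <\<eta>,G\<eta>>.
\<close>
lemma H22_edge_product:
  assumes u: "u \<delta> = 0"
  shows "(\<Prod>(i, j)\<in>Et. exp (- (1 / 2) * (Wt i j * (cosh (u i - u j) - 1)))) =
    exp (- (1 / 2) * bilinear_form U (H_mat (beta_map U \<eta> u)) (\<lambda>_. 1) (\<lambda>_. 1)
         - 1 / 2 * bilinear_form U (inv_on U (H_mat (beta_map U \<eta> u))) \<eta> \<eta> + sum \<eta> U)"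
proof -
  let ?\<beta> = "beta_map U \<eta> u"
  have sub: "Et \<subseteq> Vt \<times> Vt" by (auto simp: wired_edges_def)
  have finE: "finite Et" using finite_subset[OF sub] finite_Vt by simp
  have dsum: "(\<Sum>i\<in>Vt. \<Sum>j\<in>Vt. h i j) = h \<delta> \<delta> + (\<Sum>j\<in>U. h \<delta> j) + (\<Sum>i\<in>U. h i \<delta>) + (\<Sum>i\<in>U. \<Sum>j\<in>U. h i j)"
    for h :: "'a \<Rightarrow> 'a \<Rightarrow> real"
    using U \<delta> by (simp add: sum.distrib)
  have row: "\<eta> i * exp (- u i) + (\<Sum>j\<in>U. W i j * exp (u j - u i)) = 2 * ?\<beta> i" if "i \<in> U" for i
    using that by (simp add: beta_map_def diff_conv_add_uminus exp_add sum_distrib_left algebra_simps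
        del: add_uminus_conv_diff)
  have cosh_sum: "(\<Sum>i\<in>Vt. \<Sum>j\<in>Vt. Wt i j * cosh (u i - u j)) = (\<Sum>i\<in>Vt. \<Sum>j\<in>Vt. Wt i j * exp (u j - u i))"
  proof -
    have "(\<Sum>i\<in>Vt. \<Sum>j\<in>Vt. Wt i j * exp (u i - u j)) = (\<Sum>i\<in>Vt. \<Sum>j\<in>Vt. Wt i j * exp (u j - u i))"
      by (subst sum.swap, intro sum.cong refl arg_cong2[where f = "(*)"] wired_weight_sym)
    moreover have "Wt i j * cosh (u i - u j) = 1 / 2 * (Wt i j * exp (u i - u j)) + 1 / 2 * (Wt i j * exp (u j - u i))" for i j
      by (simp add: cosh_field_def algebra_simps)
    ultimately show ?thesis
      by (simp only: sum.distrib sum_distrib_left[symmetric])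
  qed
  have exp_sum': "(\<Sum>i\<in>Vt. \<Sum>j\<in>Vt. Wt i j * exp (u j - u i)) = (\<Sum>j\<in>U. \<eta> j * exp (u j)) + (\<Sum>i\<in>U. 2 * ?\<beta> i)"
  proof -
    have "(\<Sum>i\<in>U. 2 * ?\<beta> i) = (\<Sum>i\<in>U. Wt i \<delta> * exp (u \<delta> - u i)) + (\<Sum>i\<in>U. \<Sum>j\<in>U. Wt i j * exp (u j - u i))"
      unfolding sum.distrib[symmetric] using u by (intro sum.cong refl) (simp add: wired_weight_simps row[symmetric])
    moreover have "(\<Sum>j\<in>U. Wt \<delta> j * exp (u j - u \<delta>)) = (\<Sum>j\<in>U. \<eta> j * exp (u j))"
      using u by (simp add: wired_weight_simps)
    ultimately show ?thesis unfolding dsum by (simp add: wired_weight_simps)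
  qed
  have weight_sum: "(\<Sum>i\<in>Vt. \<Sum>j\<in>Vt. Wt i j) = 2 * sum \<eta> U + (\<Sum>i\<in>U. \<Sum>j\<in>U. W i j)"
    unfolding dsum by (simp add: wired_weight_simps)
  have form_one: "bilinear_form U (H_mat ?\<beta>) (\<lambda>_. 1) (\<lambda>_. 1) = (\<Sum>i\<in>U. 2 * ?\<beta> i) - (\<Sum>i\<in>U. \<Sum>j\<in>U. W i j)"
    unfolding bilinear_form_def sum_subtractf[symmetric]
    using H_mat_apply[OF U(1), of _ ?\<beta> "\<lambda>_. 1"] by (intro sum.cong refl) simp
  have form_inv: "bilinear_form U (inv_on U (H_mat ?\<beta>)) \<eta> \<eta> = (\<Sum>j\<in>U. \<eta> j * exp (u j))"
    unfolding bilinear_form_green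
    by (intro sum.cong refl) (simp add: green_beta_map[OF U(1) pos_def_on_beta_map_eta])
  have "(\<Sum>(i, j)\<in>Et. - (1 / 2) * (Wt i j * (cosh (u i - u j) - 1))) =
      (\<Sum>(i, j)\<in>Vt \<times> Vt. - (1 / 2) * (Wt i j * (cosh (u i - u j) - 1)))"
    using finite_Vt sub by (intro sum.mono_neutral_left) (auto simp: wired_weight_zero)
  also have "\<dots> = (\<Sum>i\<in>Vt. \<Sum>j\<in>Vt. - (1 / 2) * (Wt i j * cosh (u i - u j)) + 1 / 2 * Wt i j)"
    unfolding sum.cartesian_product by (intro sum.cong refl) (auto simp: algebra_simps)
  also have "\<dots> = - (1 / 2) * (\<Sum>i\<in>Vt. \<Sum>j\<in>Vt. Wt i j * cosh (u i - u j)) + 1 / 2 * (\<Sum>i\<in>Vt. \<Sum>j\<in>Vt. Wt i j)"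
    by (simp only: sum.distrib sum_distrib_left)
  also have "\<dots> = - (1 / 2) * bilinear_form U (H_mat ?\<beta>) (\<lambda>_. 1) (\<lambda>_. 1)
         - 1 / 2 * bilinear_form U (inv_on U (H_mat ?\<beta>)) \<eta> \<eta> + sum \<eta> U"
    unfolding cosh_sum exp_sum' weight_sum form_one form_inv by argo
  finally have "exp (\<Sum>(i, j)\<in>Et. - (1 / 2) * (Wt i j * (cosh (u i - u j) - 1))) =
     exp (- (1 / 2) * bilinear_form U (H_mat ?\<beta>) (\<lambda>_. 1) (\<lambda>_. 1)
         - 1 / 2 * bilinear_form U (inv_on U (H_mat ?\<beta>)) \<eta> \<eta> + sum \<eta> U)"
    by (rule arg_cong)
  then show ?thesis unfolding exp_sum[OF finE] by (simp add: case_prod_unfold)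
qed

lemma H22_density_pinned:
  assumes u: "u \<delta> = 0" and s: "s \<delta> = 0"
  shows "H22_density Vt Et \<delta> Wt u s =
    exp (- (1 / 2) * bilinear_form U (A_mat Vt Wt u) s s) *
      ((\<Prod>i\<in>U. exp (u i)) * det_on U (H_mat (beta_map U \<eta> u)) *
       exp (- (1 / 2) * bilinear_form U (H_mat (beta_map U \<eta> u)) (\<lambda>_. 1) (\<lambda>_. 1)
         - 1 / 2 * bilinear_form U (inv_on U (H_mat (beta_map U \<eta> u))) \<eta> \<eta> + sum \<eta> U) / (2 * pi) ^ card U)"
proof -
  have quad: "(\<Sum>i\<in>Vt. \<Sum>j\<in>Vt. s i * A_mat Vt Wt u i j * s j) = bilinear_form U (A_mat Vt Wt u) s s"
    unfolding bilinear_form_def using U \<delta> s by simp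
  have prod: "(\<Prod>i\<in>U. exp (- u i) / (2 * pi)) = 1 / ((\<Prod>i\<in>U. exp (u i)) * (2 * pi) ^ card U)"
  proof -
    have "(\<Prod>i\<in>U. exp (- u i) / (2 * pi)) = (\<Prod>i\<in>U. exp (- u i)) / (2 * pi) ^ card U"
      by (simp add: prod_dividef)
    also have "(\<Prod>i\<in>U. exp (- u i)) = inverse (\<Prod>i\<in>U. exp (u i))"
      unfolding exp_minus by (rule prod_inversef[unfolded comp_def])
    finally show ?thesis by (simp only: inverse_eq_divide divide_divide_eq_left)
  qed
  have det: "det_on U (A_mat Vt Wt u) = (\<Prod>i\<in>U. exp (u i))\<^sup>2 * det_on U (H_mat (beta_map U \<eta> u))"
    using u by (simp add: det_on_A_mat_wired)
  define P where "P = (\<Prod>i\<in>U. exp (u i))"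
  have "P \<noteq> 0" unfolding P_def using U by simp
  then show ?thesis
    unfolding H22_density_def Vt_minus_root H22_edge_product[where u = u, OF u] prod quad det P_def[symmetric]
    by (simp add: power2_eq_square)
qed

text \<open>
  The matrix in the Gaussian is H conjugated by the diagonal matrix of exp u, so its determinant is P^2 D
  with P the product of the exp(u i) and D = det H. The powers of P cancel, and one factor D is kept
  apart as the Jacobian of the passage to \<beta>.
\<close>
lemma nn_integral_H22_density_s:
  assumes u: "u \<delta> = 0"
  shows "(\<integral>\<^sup>+s. ennreal (H22_density Vt Et \<delta> Wt u (s(\<delta> := 0))) \<partial>(\<Pi>\<^sub>M i\<in>U. lborel)) =
    ennreal (beta_density U \<eta> (beta_map U \<eta> u) / 2 ^ card U) * ennreal (det_on U (H_mat (beta_map U \<eta> u)))"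
proof -
  let ?\<beta> = "beta_map U \<eta> u"
  define P where "P = (\<Prod>i\<in>U. exp (u i))"
  define D where "D = det_on U (H_mat ?\<beta>)"
  define X where "X = exp (- (1 / 2) * bilinear_form U (H_mat ?\<beta>) (\<lambda>_. 1) (\<lambda>_. 1)
         - 1 / 2 * bilinear_form U (inv_on U (H_mat ?\<beta>)) \<eta> \<eta> + sum \<eta> U)"
  define c where "c = P * D * X / (2 * pi) ^ card U"
  have P: "0 < P" unfolding P_def by (intro prod_pos) simp
  have D: "0 < D" unfolding D_def by (rule det_on_pos[OF U(1) pos_def_on_beta_map_eta])
  have X: "0 < X" unfolding X_def by simp
  have c: "0 \<le> c" unfolding c_def using P D X by simp
  have dens: "ennreal (H22_density Vt Et \<delta> Wt u (s(\<delta> := 0))) =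
    ennreal (exp (- (1 / 2) * bilinear_form U (A_mat Vt Wt u) (\<lambda>i. s i + 0) (\<lambda>i. s i + 0))) * ennreal c" for s
  proof -
    have form: "bilinear_form U (A_mat Vt Wt u) (s(\<delta> := 0)) (s(\<delta> := 0)) = bilinear_form U (A_mat Vt Wt u) (\<lambda>i. s i + 0) (\<lambda>i. s i + 0)"
      using \<delta> by (intro bilinear_form_cong) auto
    have "H22_density Vt Et \<delta> Wt u (s(\<delta> := 0)) =
        exp (- (1 / 2) * bilinear_form U (A_mat Vt Wt u) (\<lambda>i. s i + 0) (\<lambda>i. s i + 0)) * c"
      unfolding H22_density_pinned[where u = u and s = "s(\<delta> := 0)", OF u fun_upd_same] form c_def P_def D_def X_def ..
    then show ?thesis by (simp only: ennreal_mult' exp_ge_zero)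
  qed
  have [measurable]: "(\<lambda>s. ennreal (exp (- (1 / 2) * bilinear_form U (A_mat Vt Wt u) (\<lambda>i. s i + 0) (\<lambda>i. s i + 0))))
     \<in> borel_measurable (\<Pi>\<^sub>M i\<in>U. lborel)"
    unfolding bilinear_form_def by measurable
  have sq: "sqrt (2 * pi) / (2 * pi) = sqrt (2 / pi) / 2"
    by (simp add: real_sqrt_mult real_sqrt_divide field_simps)
  have dA: "det_on U (A_mat Vt Wt u) = P\<^sup>2 * D"
    using u unfolding P_def D_def by (simp add: det_on_A_mat_wired)
  have "(\<integral>\<^sup>+s. ennreal (H22_density Vt Et \<delta> Wt u (s(\<delta> := 0))) \<partial>(\<Pi>\<^sub>M i\<in>U. lborel)) =
      ennreal (sqrt (2 * pi) ^ card U / sqrt (det_on U (A_mat Vt Wt u))) * ennreal c"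
    unfolding dens
    by (subst nn_integral_multc) (measurable, simp only: nn_integral_multivariate_Gaussian[OF U(1) pos_def_on_A_mat_wired])
  also have "\<dots> = ennreal (sqrt (2 * pi) ^ card U / sqrt (det_on U (A_mat Vt Wt u)) * c)"
    using det_on_pos[OF U(1) pos_def_on_A_mat_wired, of u] by (subst ennreal_mult') auto
  also have "sqrt (2 * pi) ^ card U / sqrt (det_on U (A_mat Vt Wt u)) * c =
      (sqrt (2 * pi) / (2 * pi)) ^ card U * X / sqrt D * D"
    using P D unfolding dA c_def by (simp add: real_sqrt_mult power_divide mult_ac)
  also have "\<dots> = beta_density U \<eta> ?\<beta> / 2 ^ card U * D"
    unfolding sq beta_density_def X_def[symmetric] D_def[symmetric]
    using pos_def_on_beta_map_eta by (simp add: power_divide)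
  also have "ennreal \<dots> = ennreal (beta_density U \<eta> ?\<beta> / 2 ^ card U) * ennreal D"
    by (rule ennreal_mult') (simp add: beta_density_nonneg[OF U(1)])
  finally show ?thesis unfolding D_def .
qed

lemma sets_pinned: "sets (pinned_lebesgue Vt \<delta>) = sets (\<Pi>\<^sub>M i\<in>Vt. (borel :: real measure))"
  unfolding pinned_lebesgue_def by (intro sets_PiM_cong) auto

lemma pinned_product_sigma_finite:
  "product_sigma_finite (\<lambda>i. if i = \<delta> then return borel 0 else lborel :: real measure)"
proof (rule product_sigma_finite.intro)
  fix i
  interpret r: prob_space "return borel (0::real)" by (rule prob_space_return) simp
  show "sigma_finite_measure (if i = \<delta> then return borel 0 else lborel :: real measure)"
    by (auto intro: r.sigma_finite_measure_axioms lborel.sigma_finite_measure_axioms)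
qed

lemma sigma_finite_pinned: "sigma_finite_measure (pinned_lebesgue Vt \<delta>)"
  unfolding pinned_lebesgue_def
  by (rule product_sigma_finite.sigma_finite[OF pinned_product_sigma_finite finite_Vt])

text \<open>The point mass at the reference vertex evaluates that coordinate at 0.\<close>
lemma nn_integral_pinned:
  assumes f: "f \<in> borel_measurable (\<Pi>\<^sub>M i\<in>Vt. (borel :: real measure))"
  shows "(\<integral>\<^sup>+x. f x \<partial>pinned_lebesgue Vt \<delta>) = (\<integral>\<^sup>+x. f (x(\<delta> := 0)) \<partial>(\<Pi>\<^sub>M i\<in>U. lborel))"
proof -
  interpret product_sigma_finite "\<lambda>i. if i = \<delta> then return borel 0 else lborel :: real measure"
    by (rule pinned_product_sigma_finite)
  let ?M = "\<lambda>i. if i = \<delta> then return borel 0 else lborel :: real measure"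
  have f'[measurable]: "f \<in> borel_measurable (PiM Vt ?M)"
    using f by (subst measurable_cong_sets[OF sets_pinned[unfolded pinned_lebesgue_def] refl])
  have eq: "PiM U ?M = (\<Pi>\<^sub>M i\<in>U. lborel)"
    using \<delta> by (intro PiM_cong) auto
  have "(\<integral>\<^sup>+x. f x \<partial>pinned_lebesgue Vt \<delta>) = (\<integral>\<^sup>+x. (\<integral>\<^sup>+y. f (x(\<delta> := y)) \<partial>?M \<delta>) \<partial>PiM U ?M)"
    unfolding pinned_lebesgue_def by (rule product_nn_integral_insert[OF U(1) \<delta> f'])
  also have "\<dots> = (\<integral>\<^sup>+x. f (x(\<delta> := 0)) \<partial>PiM U ?M)"
  proof (intro nn_integral_cong)
    fix x assume x: "x \<in> space (PiM U ?M)"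
    have "(\<lambda>y. f (x(\<delta> := y))) \<in> borel_measurable (?M \<delta>)"
      by (rule measurable_compose[OF measurable_component_update[OF x \<delta>] f'])
    then show "(\<integral>\<^sup>+y. f (x(\<delta> := y)) \<partial>?M \<delta>) = f (x(\<delta> := 0))"
      by (simp add: nn_integral_return)
  qed
  finally show ?thesis unfolding eq .
qed

lemma measurable_H22_density:
  "(\<lambda>x. H22_density Vt Et \<delta> Wt (fst x) (snd x)) \<in>
    borel_measurable ((\<Pi>\<^sub>M i\<in>Vt. borel) \<Otimes>\<^sub>M (\<Pi>\<^sub>M i\<in>Vt. borel))"
proof -
  let ?N = "(\<Pi>\<^sub>M i\<in>Vt. (borel :: real measure)) \<Otimes>\<^sub>M (\<Pi>\<^sub>M i\<in>Vt. (borel :: real measure))"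
  have fst: "(\<lambda>x. fst x i) \<in> borel_measurable ?N" if "i \<in> Vt" for i
    by (rule measurable_compose[OF measurable_fst measurable_component_singleton[OF that]])
  have snd: "(\<lambda>x. snd x i) \<in> borel_measurable ?N" if "i \<in> Vt" for i
    by (rule measurable_compose[OF measurable_snd measurable_component_singleton[OF that]])
  have A: "(\<lambda>x. A_mat Vt Wt (fst x) i j) \<in> borel_measurable ?N" if "i \<in> Vt" "j \<in> Vt" for i j
  proof (cases "i = j")
    case True
    have "(\<lambda>x. \<Sum>k\<in>Vt. Wt i k * exp (fst x i + fst x k)) \<in> borel_measurable ?N"
      by (intro borel_measurable_sum borel_measurable_times borel_measurable_const borel_measurable_add
          measurable_compose[OF _ borel_measurable_exp] fst that)
    then show ?thesis using True by (simp add: A_mat_def)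
  next
    case False
    have "(\<lambda>x. - Wt i j * exp (fst x i + fst x j)) \<in> borel_measurable ?N"
      by (intro borel_measurable_times borel_measurable_const borel_measurable_add
          measurable_compose[OF _ borel_measurable_exp] fst that)
    then show ?thesis using False by (simp add: A_mat_def)
  qed
  have 1: "(\<lambda>x. \<Sum>i\<in>Vt. \<Sum>j\<in>Vt. snd x i * A_mat Vt Wt (fst x) i j * snd x j) \<in> borel_measurable ?N"
    by (intro borel_measurable_sum borel_measurable_times A snd)
  have 2: "(\<lambda>x. det_on (Vt - {\<delta>}) (A_mat Vt Wt (fst x))) \<in> borel_measurable ?N"
    by (intro borel_measurable_det_on A) auto
  have 3: "(\<lambda>x. \<Prod>e\<in>Et. exp (- (1 / 2) * (Wt (fst e) (snd e) * (cosh (fst x (fst e) - fst x (snd e)) - 1)))) \<in> borel_measurable ?N"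
  proof (intro borel_measurable_prod)
    fix e assume "e \<in> Et"
    then have "fst e \<in> Vt" "snd e \<in> Vt" by (auto simp: wired_edges_def)
    note [measurable] = fst[OF this(1)] fst[OF this(2)]
    show "(\<lambda>x. exp (- (1 / 2) * (Wt (fst e) (snd e) * (cosh (fst x (fst e) - fst x (snd e)) - 1)))) \<in> borel_measurable ?N"
      unfolding cosh_field_def by measurable
  qed
  have 4: "(\<lambda>x. \<Prod>i\<in>Vt - {\<delta>}. exp (- fst x i) / (2 * pi)) \<in> borel_measurable ?N"
  proof (intro borel_measurable_prod)
    fix i assume "i \<in> Vt - {\<delta>}"
    then have "i \<in> Vt" by blast
    note [measurable] = fst[OF this]
    show "(\<lambda>x. exp (- fst x i) / (2 * pi)) \<in> borel_measurable ?N" by measurable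
  qed
  note [measurable] = 1 2 3 4
  show ?thesis unfolding H22_density_def case_prod_unfold by measurable
qed

lemma measurable_wired_beta:
  "wired_beta V E W U \<delta> \<in> (\<Pi>\<^sub>M i\<in>Vt. borel) \<rightarrow>\<^sub>M (\<Pi>\<^sub>M i\<in>U. borel)"
proof -
  have "wired_beta V E W U \<delta> = (\<lambda>u. beta_map U (\<lambda>i. \<eta> i * exp (u \<delta>)) u)" by (intro ext wired_beta_eq)
  also have "\<dots> \<in> (\<Pi>\<^sub>M i\<in>Vt. borel) \<rightarrow>\<^sub>M (\<Pi>\<^sub>M i\<in>U. borel)"
    unfolding beta_map_def by measurable
  finally show ?thesis .
qed

lemma measurable_H22_density_s:
  assumes u: "u \<delta> = 0"
  shows "(\<lambda>s. ennreal (H22_density Vt Et \<delta> Wt u (s(\<delta> := 0)))) \<in> borel_measurable (\<Pi>\<^sub>M i\<in>U. lborel)"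
proof -
  have eq: "H22_density Vt Et \<delta> Wt u (s(\<delta> := 0)) =
      exp (- (1 / 2) * bilinear_form U (A_mat Vt Wt u) s s) *
      ((\<Prod>i\<in>U. exp (u i)) * det_on U (H_mat (beta_map U \<eta> u)) *
       exp (- (1 / 2) * bilinear_form U (H_mat (beta_map U \<eta> u)) (\<lambda>_. 1) (\<lambda>_. 1)
         - 1 / 2 * bilinear_form U (inv_on U (H_mat (beta_map U \<eta> u))) \<eta> \<eta> + sum \<eta> U) / (2 * pi) ^ card U)" for s
  proof -
    have form: "bilinear_form U (A_mat Vt Wt u) (s(\<delta> := 0)) (s(\<delta> := 0)) = bilinear_form U (A_mat Vt Wt u) s s"
      using \<delta> by (intro bilinear_form_cong) auto
    show ?thesis
      unfolding H22_density_pinned[where u = u and s = "s(\<delta> := 0)", OF u fun_upd_same] form ..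
  qed
  have "(\<lambda>s. bilinear_form U (A_mat Vt Wt u) s s) \<in> borel_measurable (\<Pi>\<^sub>M i\<in>U. lborel)"
    unfolding bilinear_form_def by measurable
  then show ?thesis unfolding eq by measurable
qed

text \<open>Fubini for the pinned product measure. The function of \<beta> does not depend on s and comes out of the
  inner integral.\<close>
lemma nn_integral_wired_H22:
  assumes g: "g \<in> borel_measurable (\<Pi>\<^sub>M i\<in>U. borel)"
  shows "(\<integral>\<^sup>+x. g (wired_beta V E W U \<delta> (fst x)) \<partial>wired_H22 V E W U \<delta>) =
    (\<integral>\<^sup>+u. (\<integral>\<^sup>+s. ennreal (H22_density Vt Et \<delta> Wt (u(\<delta> := 0)) (s(\<delta> := 0))) \<partial>(\<Pi>\<^sub>M i\<in>U. lborel)) *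
      g (beta_map U \<eta> u) \<partial>(\<Pi>\<^sub>M i\<in>U. lborel))"
proof -
  let ?B = "\<Pi>\<^sub>M i\<in>Vt. (borel :: real measure)"
  let ?L = "pinned_lebesgue Vt \<delta>" and ?b = "wired_beta V E W U \<delta>" and ?M = "\<Pi>\<^sub>M i\<in>U. (lborel :: real measure)"
  let ?d = "\<lambda>u s. ennreal (H22_density Vt Et \<delta> Wt u s)"
  interpret L: sigma_finite_measure ?L by (rule sigma_finite_pinned)
  interpret finite_product_sigma_finite "\<lambda>_. lborel :: real measure" U
    by standard (rule U(1))
  have sets2: "sets (?L \<Otimes>\<^sub>M ?L) = sets (?B \<Otimes>\<^sub>M ?B)"
    by (intro sets_pair_measure_cong sets_pinned)
  have d0: "(\<lambda>x. ?d (fst x) (snd x)) \<in> borel_measurable (?B \<Otimes>\<^sub>M ?B)"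
    using measurable_H22_density by (rule measurable_compose[OF _ measurable_ennreal])
  have b: "?b \<in> ?B \<rightarrow>\<^sub>M (\<Pi>\<^sub>M i\<in>U. borel)" by (rule measurable_wired_beta)
  have gb: "(\<lambda>u. g (?b u)) \<in> borel_measurable ?B" by (rule measurable_compose[OF b g])
  have gb2: "(\<lambda>x. g (?b (fst x))) \<in> borel_measurable (?B \<Otimes>\<^sub>M N)" for N :: "('a \<Rightarrow> real) measure"
    by (rule measurable_compose[OF measurable_fst gb])
  have H22: "wired_H22 V E W U \<delta> = density (?L \<Otimes>\<^sub>M ?L) (\<lambda>x. ?d (fst x) (snd x))"
    unfolding wired_H22_def H22_measure_def by (simp add: case_prod_unfold)
  have "(\<integral>\<^sup>+x. g (?b (fst x)) \<partial>wired_H22 V E W U \<delta>) =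
      (\<integral>\<^sup>+x. ?d (fst x) (snd x) * g (?b (fst x)) \<partial>(?L \<Otimes>\<^sub>M ?L))"
    unfolding H22 by (rule nn_integral_density; subst measurable_cong_sets[OF sets2 refl]) (rule d0, rule gb2)
  also have "\<dots> = (\<integral>\<^sup>+u. (\<integral>\<^sup>+s. ?d u s * g (?b u) \<partial>?L) \<partial>?L)"
  proof -
    have "(\<lambda>x. ?d (fst x) (snd x) * g (?b (fst x))) \<in> borel_measurable (?L \<Otimes>\<^sub>M ?L)"
      by (subst measurable_cong_sets[OF sets2 refl]) (intro borel_measurable_times_ennreal d0 gb2)
    from L.nn_integral_fst[OF this] show ?thesis by simp
  qed
  also have "\<dots> = (\<integral>\<^sup>+u. (\<integral>\<^sup>+s. ?d u (s(\<delta> := 0)) * g (?b u) \<partial>?M) \<partial>?L)"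
  proof (intro nn_integral_cong)
    fix u assume u: "u \<in> space ?L"
    then have "u \<in> space ?B" using sets_eq_imp_space_eq[OF sets_pinned] by simp
    then have "(\<lambda>s. ?d u s * g (?b u)) \<in> borel_measurable ?B"
      using measurable_compose[OF measurable_Pair1' d0, of u] by (intro borel_measurable_times_ennreal) auto
    then show "(\<integral>\<^sup>+s. ?d u s * g (?b u) \<partial>?L) = (\<integral>\<^sup>+s. ?d u (s(\<delta> := 0)) * g (?b u) \<partial>?M)"
      by (rule nn_integral_pinned)
  qed
  also have "\<dots> = (\<integral>\<^sup>+u. (\<integral>\<^sup>+s. ?d (u(\<delta> := 0)) (s(\<delta> := 0)) * g (?b (u(\<delta> := 0))) \<partial>?M) \<partial>?M)"
  proof (rule nn_integral_pinned)
    have upd: "(\<lambda>s. s(\<delta> := 0)) \<in> ?M \<rightarrow>\<^sub>M ?B"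
    proof (rule measurable_PiM_single')
      fix i assume "i \<in> Vt"
      then show "(\<lambda>s. (s(\<delta> := 0)) i) \<in> ?M \<rightarrow>\<^sub>M borel"
        by (cases "i = \<delta>") auto
    qed (auto simp: space_PiM PiE_def extensional_def)
    have "(\<lambda>x. (fst x, (snd x)(\<delta> := 0))) \<in> ?B \<Otimes>\<^sub>M ?M \<rightarrow>\<^sub>M ?B \<Otimes>\<^sub>M ?B"
      by (intro measurable_Pair measurable_fst measurable_compose[OF measurable_snd upd])
    from measurable_compose[OF this d0]
    have "(\<lambda>x. ?d (fst x) ((snd x)(\<delta> := 0)) * g (?b (fst x))) \<in> borel_measurable (?B \<Otimes>\<^sub>M ?M)"
      by (intro borel_measurable_times_ennreal gb2) simp
    then have "(\<lambda>(u, s). ?d u (s(\<delta> := 0)) * g (?b u)) \<in> borel_measurable (?B \<Otimes>\<^sub>M ?M)"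
      by (simp only: case_prod_unfold)
    then show "(\<lambda>u. \<integral>\<^sup>+s. ?d u (s(\<delta> := 0)) * g (?b u) \<partial>?M) \<in> borel_measurable ?B"
      by (rule borel_measurable_nn_integral)
  qed
  also have "\<dots> = (\<integral>\<^sup>+u. (\<integral>\<^sup>+s. ?d (u(\<delta> := 0)) (s(\<delta> := 0)) \<partial>?M) * g (beta_map U \<eta> u) \<partial>?M)"
  proof (intro nn_integral_cong)
    fix u :: "'a \<Rightarrow> real"
    have "?b (u(\<delta> := 0)) = beta_map U \<eta> (u(\<delta> := 0))"
      by (rule wired_beta_pinned) simp
    also have "\<dots> = beta_map U \<eta> u"
      using \<delta> by (intro beta_map_cong) auto
    finally have "?b (u(\<delta> := 0)) = beta_map U \<eta> u" .
    then show "(\<integral>\<^sup>+s. ?d (u(\<delta> := 0)) (s(\<delta> := 0)) * g (?b (u(\<delta> := 0))) \<partial>?M) =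
        (\<integral>\<^sup>+s. ?d (u(\<delta> := 0)) (s(\<delta> := 0)) \<partial>?M) * g (beta_map U \<eta> u)"
      by (simp only:) (rule nn_integral_multc[OF measurable_H22_density_s], simp)
  qed
  finally show ?thesis .
qed

lemma nn_integral_wired_beta_law:
  assumes g: "g \<in> borel_measurable (\<Pi>\<^sub>M i\<in>U. borel)"
  shows "(\<integral>\<^sup>+\<beta>. g \<beta> \<partial>distr (wired_H22 V E W U \<delta>) (\<Pi>\<^sub>M i\<in>U. borel) (\<lambda>(v, s). wired_beta V E W U \<delta> v)) =
    (\<integral>\<^sup>+\<beta>. g \<beta> * ennreal (beta_density U \<eta> \<beta>) \<partial>(\<Pi>\<^sub>M i\<in>U. lborel))"
proof -
  let ?B = "\<Pi>\<^sub>M i\<in>Vt. (borel :: real measure)"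
  let ?L = "pinned_lebesgue Vt \<delta>" and ?b = "wired_beta V E W U \<delta>" and ?M = "\<Pi>\<^sub>M i\<in>U. (lborel :: real measure)"
  have g'[measurable]: "g \<in> borel_measurable ?M" using g by (subst measurable_cong_sets[OF sets_PiM_lborel refl])
  note [measurable] = borel_measurable_beta_density[OF U(1)] pred_pos_def_on_H_mat[OF U(1)]
  have "sets (wired_H22 V E W U \<delta>) = sets (?B \<Otimes>\<^sub>M ?B)"
    unfolding wired_H22_def H22_measure_def sets_density by (intro sets_pair_measure_cong sets_pinned)
  then have "(\<lambda>x. ?b (fst x)) \<in> wired_H22 V E W U \<delta> \<rightarrow>\<^sub>M (\<Pi>\<^sub>M i\<in>U. borel)"
    by (subst measurable_cong_sets[OF _ refl])
       (assumption, rule measurable_compose[OF measurable_fst measurable_wired_beta])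
  then have "(\<integral>\<^sup>+\<beta>. g \<beta> \<partial>distr (wired_H22 V E W U \<delta>) (\<Pi>\<^sub>M i\<in>U. borel) (\<lambda>(v, s). ?b v)) =
      (\<integral>\<^sup>+x. g (?b (fst x)) \<partial>wired_H22 V E W U \<delta>)"
    unfolding case_prod_unfold by (rule nn_integral_distr) (simp add: g)
  also have "\<dots> = (\<integral>\<^sup>+u. (g (beta_map U \<eta> u) * ennreal (beta_density U \<eta> (beta_map U \<eta> u) / 2 ^ card U)) *
      ennreal (det_on U (H_mat (beta_map U \<eta> u))) \<partial>?M)"
    unfolding nn_integral_wired_H22[OF g]
  proof (intro nn_integral_cong)
    fix u :: "'a \<Rightarrow> real"
    have bm: "beta_map U \<eta> (u(\<delta> := 0)) = beta_map U \<eta> u"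
      using \<delta> by (intro beta_map_cong) auto
    show "(\<integral>\<^sup>+s. ennreal (H22_density Vt Et \<delta> Wt (u(\<delta> := 0)) (s(\<delta> := 0))) \<partial>?M) * g (beta_map U \<eta> u) =
      (g (beta_map U \<eta> u) * ennreal (beta_density U \<eta> (beta_map U \<eta> u) / 2 ^ card U)) *
      ennreal (det_on U (H_mat (beta_map U \<eta> u)))"
      unfolding nn_integral_H22_density_s[where u = "u(\<delta> := 0)", OF fun_upd_same] bm by (simp only: mult_ac)
  qed
  also have "\<dots> = 2 ^ card U * (\<integral>\<^sup>+\<beta>. (g \<beta> * ennreal (beta_density U \<eta> \<beta> / 2 ^ card U)) *
      indicator {\<beta>. pos_def_on U (H_mat \<beta>)} \<beta> \<partial>?M)"
    by (rule beta_map_change_of_variables[OF U(1) wired_eta_nonneg reaches_boundary_wired_eta[OF U]]) measurable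
  also have "\<dots> = (\<integral>\<^sup>+\<beta>. 2 ^ card U * ((g \<beta> * ennreal (beta_density U \<eta> \<beta> / 2 ^ card U)) *
      indicator {\<beta>. pos_def_on U (H_mat \<beta>)} \<beta>) \<partial>?M)"
    by (rule nn_integral_cmult[symmetric]) measurable
  also have "\<dots> = (\<integral>\<^sup>+\<beta>. g \<beta> * ennreal (beta_density U \<eta> \<beta>) \<partial>?M)"
  proof (intro nn_integral_cong)
    fix \<beta>
    have "(2::ennreal) ^ card U = ennreal (2 ^ card U)" by (simp add: ennreal_power[symmetric])
    then have "(2::ennreal) ^ card U * ennreal (beta_density U \<eta> \<beta> / 2 ^ card U) = ennreal (beta_density U \<eta> \<beta>)"
      by (simp add: ennreal_mult'[symmetric])
    then show "2 ^ card U * ((g \<beta> * ennreal (beta_density U \<eta> \<beta> / 2 ^ card U)) *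
      indicator {\<beta>. pos_def_on U (H_mat \<beta>)} \<beta>) = g \<beta> * ennreal (beta_density U \<eta> \<beta>)"
      by (cases "pos_def_on U (H_mat \<beta>)") (simp_all add: mult.left_commute beta_density_def)
  qed
  finally show ?thesis .
qed

section \<open>The exponential functional\<close>

lemma exp_functional_eq:
  "exp_functional V W \<theta> U \<delta> u =
    exp ((\<Sum>\<^sub>\<infinity>j\<in>V - U. \<theta> j) * exp (u \<delta>) + (\<Sum>i\<in>U. \<theta> i * exp (u i)) -
      1 / 2 * (\<Sum>i\<in>U. \<Sum>j\<in>U. \<theta> i * (exp (u i) * inv_on U (A_mat Vt Wt u) i j * exp (u j)) * \<theta> j))"
proof -
  have G0: "G_hat Vt \<delta> Wt u i \<delta> = 0" "G_hat Vt \<delta> Wt u \<delta> i = 0" for i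
    by (simp_all add: G_hat_def)
  have G: "G_hat Vt \<delta> Wt u i j = exp (u i) * inv_on U (A_mat Vt Wt u) i j * exp (u j)" if "i \<in> U" "j \<in> U" for i j
    using that \<delta> unfolding G_hat_def Vt_minus_root by auto
  have \<theta>: "wired_theta V \<theta> U \<delta> i = \<theta> i" if "i \<in> U" for i using that by (simp add: wired_theta_def)
  have \<theta>0: "wired_theta V \<theta> U \<delta> \<delta> = (\<Sum>\<^sub>\<infinity>j\<in>V - U. \<theta> j)" using \<delta> by (simp add: wired_theta_def)
  have "(\<Sum>i\<in>Vt. wired_theta V \<theta> U \<delta> i * (\<Sum>j\<in>Vt. G_hat Vt \<delta> Wt u i j * wired_theta V \<theta> U \<delta> j)) =
      (\<Sum>i\<in>U. wired_theta V \<theta> U \<delta> i * (\<Sum>j\<in>U. G_hat Vt \<delta> Wt u i j * wired_theta V \<theta> U \<delta> j))"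
    using U \<delta> by (simp add: G0)
  also have "\<dots> = (\<Sum>i\<in>U. \<Sum>j\<in>U. \<theta> i * (exp (u i) * inv_on U (A_mat Vt Wt u) i j * exp (u j)) * \<theta> j)"
    unfolding sum_distrib_left by (intro sum.cong refl) (simp add: \<theta> G)
  finally have quad: "(\<Sum>i\<in>Vt. wired_theta V \<theta> U \<delta> i * (\<Sum>j\<in>Vt. G_hat Vt \<delta> Wt u i j * wired_theta V \<theta> U \<delta> j)) = \<dots>" .
  have lin: "(\<Sum>i\<in>Vt. wired_theta V \<theta> U \<delta> i * exp (u i)) =
      (\<Sum>\<^sub>\<infinity>j\<in>V - U. \<theta> j) * exp (u \<delta>) + (\<Sum>i\<in>U. \<theta> i * exp (u i))"
    using U \<delta> by (simp add: \<theta> \<theta>0)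
  show ?thesis unfolding exp_functional_def Let_def lin quad ..
qed

lemma measurable_exp_functional:
  "(\<lambda>u. exp_functional V W \<theta> U \<delta> u) \<in> borel_measurable (\<Pi>\<^sub>M i\<in>Vt. borel)"
proof -
  let ?B = "\<Pi>\<^sub>M i\<in>Vt. (borel :: real measure)"
  have A: "(\<lambda>u. A_mat Vt Wt u i j) \<in> borel_measurable ?B" if "i \<in> U" "j \<in> U" for i j
  proof (cases "i = j")
    case True
    have "i \<in> Vt" using that by simp
    then have "(\<lambda>u. \<Sum>k\<in>Vt. Wt i k * exp (u i + u k)) \<in> borel_measurable ?B" by measurable
    then show ?thesis using True by (simp add: A_mat_def)
  next
    case False
    have "i \<in> Vt" "j \<in> Vt" using that by auto
    then have "(\<lambda>u. - Wt i j * exp (u i + u j)) \<in> borel_measurable ?B" by measurable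
    then show ?thesis using False by (simp add: A_mat_def)
  qed
  have [measurable]: "(\<lambda>u. inv_on U (A_mat Vt Wt u) i j) \<in> borel_measurable ?B" for i j
  proof -
    have "(\<lambda>u. if pos_def_on U (A_mat Vt Wt u) then inv_on U (A_mat Vt Wt u) i j else 0) \<in> borel_measurable ?B"
      by (rule measurable_inv_on_guarded[OF U(1) A A_mat_wired_sym])
    then show ?thesis by (simp only: pos_def_on_A_mat_wired if_True)
  qed
  have [measurable]: "(\<lambda>u. u i) \<in> borel_measurable ?B" if "i \<in> U" for i
    using that by (intro measurable_component_singleton) simp
  have [measurable]: "(\<lambda>u. u \<delta>) \<in> borel_measurable ?B"
    by (intro measurable_component_singleton) simp
  show ?thesis unfolding exp_functional_eq by measurable
qed

text \<open>
  Only \<beta> with H positive definite matter, and these lie in the range of the map from u to \<beta>, so f returns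
  the u with exp u = G \<eta>. The total boundary value of \<theta> outside U enters at height 0 and combines with
  the sum of \<theta> over U to a constant that does not see U.
\<close>
lemma exp_functional_tilt:
  assumes f: "wired_recovers_u V E W U \<delta> f" and \<beta>: "\<beta> \<in> extensional U"
    and S: "finite S" "S \<subseteq> V" "\<And>k. k \<in> V - S \<Longrightarrow> \<theta> k = 0"
  shows "exp_functional V W \<theta> U \<delta> (f \<beta>) * beta_density U \<eta> \<beta> =
    exp (sum \<theta> S) * beta_density U (\<lambda>i. \<eta> i - \<theta> i) \<beta>"
proof (cases "pos_def_on U (H_mat \<beta>)")
  case False
  then show ?thesis by (simp add: beta_density_def)
next
  case True
  note bd = reaches_boundary_wired_eta[OF U]
  define u where "u = (\<lambda>i\<in>Vt. if i = \<delta> then 0 else ln (green U \<beta> \<eta> i))"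
  have u0: "u \<delta> = 0" by (simp add: u_def)
  have ui: "u i = ln (green U \<beta> \<eta> i)" if "i \<in> U" for i using that \<delta> by (auto simp: u_def)
  have eu: "exp (u i) = green U \<beta> \<eta> i" if "i \<in> U" for i
    using green_pos[OF U(1) True wired_eta_nonneg bd that] ui[OF that] by simp
  have bmap: "beta_map U \<eta> u = \<beta>"
    by (rule beta_map_ln_green[OF U(1) True wired_eta_nonneg bd \<beta> ui])
  have "u \<in> pinned_configs Vt \<delta>" using u0 by (auto simp: pinned_configs_def u_def)
  then have "f (wired_beta V E W U \<delta> u) = u"
    using f unfolding wired_recovers_u_def recovers_u_def wired_beta_def by blast
  then have fu: "f \<beta> = u" using wired_beta_pinned[where u = u, OF u0] bmap by simp
  have rest: "(\<Sum>\<^sub>\<infinity>j\<in>V - U. \<theta> j) + sum \<theta> U = sum \<theta> S"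
  proof -
    have "(\<Sum>\<^sub>\<infinity>j\<in>V - U. \<theta> j) = sum \<theta> (S - U)"
      by (rule infsum_finite_support[OF S(1) S(3) S(2)])
    moreover have "sum \<theta> U = sum \<theta> (S \<inter> U)"
      using U S(3) by (intro sum.mono_neutral_right) auto
    moreover have "sum \<theta> S = sum \<theta> (S \<inter> U) + sum \<theta> (S - U)"
      using S(1) by (rule sum.Int_Diff)
    ultimately show ?thesis by simp
  qed
  have "(\<Sum>i\<in>U. \<Sum>j\<in>U. \<theta> i * (exp (u i) * inv_on U (A_mat Vt Wt u) i j * exp (u j)) * \<theta> j) =
      bilinear_form U (inv_on U (H_mat \<beta>)) \<theta> \<theta>"
    unfolding bilinear_form_def
    by (intro sum.cong refl) (simp only: inv_on_A_mat_wired u0 exp_zero mult_1_right bmap)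
  moreover have "(\<Sum>i\<in>U. \<theta> i * exp (u i)) = (\<Sum>i\<in>U. \<theta> i * green U \<beta> \<eta> i)"
    by (intro sum.cong refl) (simp only: eu)
  ultimately have "exp_functional V W \<theta> U \<delta> (f \<beta>) = exp (\<Sum>\<^sub>\<infinity>j\<in>V - U. \<theta> j) *
      exp ((\<Sum>i\<in>U. \<theta> i * green U \<beta> \<eta> i) - 1 / 2 * bilinear_form U (inv_on U (H_mat \<beta>)) \<theta> \<theta>)"
    unfolding exp_functional_eq fu u0 exp_add[symmetric] by simp
  then have "exp_functional V W \<theta> U \<delta> (f \<beta>) * beta_density U \<eta> \<beta> = exp (\<Sum>\<^sub>\<infinity>j\<in>V - U. \<theta> j) *
      (exp (sum \<theta> U) * beta_density U (\<lambda>i. \<eta> i - \<theta> i) \<beta>)"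
    using beta_density_tilt[OF U(1) True, of \<theta> \<eta>] by simp
  then show ?thesis unfolding rest[symmetric] exp_add by (simp only: mult.assoc)
qed

end

section \<open>The martingale property\<close>

theorem theorem2p6:
  fixes V :: "'a set" and E :: "('a \<times> 'a) set" and W :: "'a \<Rightarrow> 'a \<Rightarrow> real"
    and Vn :: "nat \<Rightarrow> 'a set" and \<delta> :: "nat \<Rightarrow> 'a"
    and P :: "'w measure" and \<beta> :: "'a \<Rightarrow> 'w \<Rightarrow> real"
    and f :: "nat \<Rightarrow> ('a \<Rightarrow> real) \<Rightarrow> 'a \<Rightarrow> real"
    and \<theta> :: "'a \<Rightarrow> real"
    and \<beta>n :: "nat \<Rightarrow> 'w \<Rightarrow> 'a \<Rightarrow> real" and F :: "nat \<Rightarrow> 'w measure"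
    and u :: "nat \<Rightarrow> 'w \<Rightarrow> 'a \<Rightarrow> real" and M :: "nat \<Rightarrow> 'w \<Rightarrow> real"
  assumes graph: "infinite_weighted_graph V E W"
    and Vn_finite: "\<And>n. finite (Vn n)"
    and Vn_incseq: "incseq Vn"
    and Vn_union: "(\<Union>n. Vn n) = V"
    and delta_new: "\<And>n. \<delta> n \<notin> Vn n"
    and P_prob: "prob_space P"
    and beta_measurable: "\<And>i. i \<in> V \<Longrightarrow> \<beta> i \<in> borel_measurable P"
    and betan_def: "\<And>n. \<beta>n n = (\<lambda>\<omega>. \<lambda>i\<in>Vn n. \<beta> i \<omega>)"
    and beta_law: "\<And>n. distr P (\<Pi>\<^sub>M i\<in>Vn n. borel) (\<beta>n n) =
      distr (wired_H22 V E W (Vn n) (\<delta> n)) (\<Pi>\<^sub>M i\<in>Vn n. borel)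
        (\<lambda>(v, s). wired_beta V E W (Vn n) (\<delta> n) v)"
    and F_def: "\<And>n. F n = vimage_algebra (space P) (\<beta>n n) (\<Pi>\<^sub>M i\<in>Vn n. borel)"
    and f_recovers: "\<And>n. wired_recovers_u V E W (Vn n) (\<delta> n) (f n)"
    and u_def: "\<And>n. u n = (\<lambda>\<omega>. f n (\<beta>n n \<omega>))"
    and theta_nonpos: "\<And>i. i \<in> V \<Longrightarrow> \<theta> i \<le> 0"
    and theta_finite: "finite {i \<in> V. \<theta> i \<noteq> 0}"
    and M_def: "\<And>n. M n = (\<lambda>\<omega>. exp_functional V W \<theta> (Vn n) (\<delta> n) (u n \<omega>))"
  shows "is_martingale P F M"
proof -
  interpret infinite_weighted_graph V E W by (rule graph)
  interpret P: prob_space P by (rule P_prob)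
  have Vn_sub: "Vn n \<subseteq> V" for n using Vn_union by blast
  have wg: "wired_graph V E W (Vn n) (\<delta> n)" for n
    by (intro wired_graph.intro wired_graph_axioms.intro graph Vn_finite Vn_sub delta_new)
  define B where "B n = (\<Pi>\<^sub>M i\<in>Vn n. (borel :: real measure))" for n
  define L where "L n = (\<Pi>\<^sub>M i\<in>Vn n. (lborel :: real measure))" for n
  define S where "S = {i \<in> V. \<theta> i \<noteq> 0}"
  define c where "c = exp (sum \<theta> S)"
  \<comment> \<open>The parameter of the tilted density.\<close>
  define \<eta>\<theta> where "\<eta>\<theta> n i = wired_eta (Vn n) i - \<theta> i" for n i
  define N where "N n \<beta> = exp_functional V W \<theta> (Vn n) (\<delta> n) (f n \<beta>)" for n \<beta>
  have finS: "finite S" and subS: "S \<subseteq> V"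
    using theta_finite by (auto simp: S_def)
  have \<theta>_S: "\<theta> k = 0" if "k \<in> V - S" for k using that by (auto simp: S_def)
  have sets_L: "sets (L n) = sets (B n)" for n
    unfolding L_def B_def by (rule sets_PiM_lborel)
  have space_L: "space (L n) = extensional (Vn n)" and space_B: "space (B n) = extensional (Vn n)" for n
    by (auto simp: L_def B_def space_PiM PiE_def)
  have M_N: "M n \<omega> = N n (\<beta>n n \<omega>)" for n \<omega> by (simp add: M_def N_def u_def)
  have N_pos: "0 < N n \<beta>" for n \<beta> by (simp add: N_def exp_functional_def Let_def)
  have \<beta>n_meas: "\<beta>n n \<in> P \<rightarrow>\<^sub>M B n" for n
    unfolding betan_def B_def using Vn_sub by (intro measurable_restrict beta_measurable) auto
  have \<beta>n_space: "\<beta>n n \<in> space P \<rightarrow> space (B n)" for n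
    using measurable_space[OF \<beta>n_meas] by auto
  have restr: "\<beta>n m \<omega> = restrict (\<beta>n n \<omega>) (Vn m)" if "m \<le> n" for m n \<omega>
    using incseqD[OF Vn_incseq that] by (auto simp: betan_def restrict_def fun_eq_iff)
  have restr_meas: "(\<lambda>\<beta>. restrict \<beta> (Vn m)) \<in> B n \<rightarrow>\<^sub>M B m" if "m \<le> n" for m n
    unfolding B_def by (rule measurable_restrict_subset[OF incseqD[OF Vn_incseq that]])
  have f_meas: "f n \<in> B n \<rightarrow>\<^sub>M (\<Pi>\<^sub>M i\<in>insert (\<delta> n) (Vn n). borel)" for n
    using f_recovers[of n] unfolding wired_recovers_u_def recovers_u_def B_def
    by (simp add: wired_graph.Vt_minus_root[OF wg])
  have N_meas: "N n \<in> borel_measurable (B n)" for n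
    unfolding N_def by (rule measurable_compose[OF f_meas wired_graph.measurable_exp_functional[OF wg]])

  have sets_F: "sets (F n) = {\<beta>n n -` A \<inter> space P | A. A \<in> sets (B n)}" for n
    unfolding F_def B_def[symmetric] by (rule sets_vimage_algebra2[OF \<beta>n_space])
  have space_F: "space (F n) = space P" for n by (simp add: F_def)
  have sub: "subalgebra P (F n)" for n
    unfolding subalgebra_def space_F sets_F using measurable_sets[OF \<beta>n_meas] by auto
  have "\<beta>n n \<in> F n \<rightarrow>\<^sub>M B n" for n
    unfolding F_def B_def[symmetric] by (rule measurable_vimage_algebra1[OF \<beta>n_space])
  then have M_F: "M n \<in> borel_measurable (F n)" for n
    using measurable_compose[OF _ N_meas] unfolding M_N[abs_def] by blast
  then have M_P: "M n \<in> borel_measurable P" for n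
    using measurable_from_subalg[OF sub] by blast
  have filt: "filtration (space P) F"
  proof
    show "sets (F m) \<subseteq> sets (F n)" if "m \<le> n" for m n
    proof
      fix X assume "X \<in> sets (F m)"
      then obtain A where A: "A \<in> sets (B m)" "X = \<beta>n m -` A \<inter> space P" by (auto simp: sets_F)
      let ?A = "(\<lambda>\<beta>. restrict \<beta> (Vn m)) -` A \<inter> space (B n)"
      have "?A \<in> sets (B n)" by (rule measurable_sets[OF restr_meas[OF that] A(1)])
      moreover have "X = \<beta>n n -` ?A \<inter> space P"
        using \<beta>n_space[of n] restr[OF that] by (auto simp: A(2))
      ultimately show "X \<in> sets (F n)" unfolding sets_F by blast
    qed
  qed (rule space_F)

  have law: "(\<integral>\<^sup>+\<omega>. h (\<beta>n n \<omega>) \<partial>P) = (\<integral>\<^sup>+\<beta>. h \<beta> * ennreal (beta_density (Vn n) (wired_eta (Vn n)) \<beta>) \<partial>L n)"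
    if h: "h \<in> borel_measurable (B n)" for h n
  proof -
    have "(\<integral>\<^sup>+\<omega>. h (\<beta>n n \<omega>) \<partial>P) = (\<integral>\<^sup>+\<beta>. h \<beta> \<partial>distr P (B n) (\<beta>n n))"
      by (rule nn_integral_distr[symmetric, OF \<beta>n_meas]) (simp add: h)
    then show ?thesis
      unfolding B_def L_def beta_law wired_graph.nn_integral_wired_beta_law[OF wg h[unfolded B_def]] .
  qed

  have \<eta>\<theta>_nonneg: "0 \<le> \<eta>\<theta> n i" if "i \<in> Vn n" for n i
    using theta_nonpos[of i] wired_eta_nonneg[of "Vn n" i] that Vn_sub[of n] by (auto simp: \<eta>\<theta>_def)
  have \<eta>\<theta>_boundary: "reaches_boundary (Vn n) (\<eta>\<theta> n)" for n
  proof (rule reaches_boundary_mono[OF reaches_boundary_wired_eta[OF Vn_finite Vn_sub]])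
    fix i assume "i \<in> Vn n" "0 < wired_eta (Vn n) i"
    then show "0 < \<eta>\<theta> n i" using theta_nonpos[of i] Vn_sub[of n] by (auto simp: \<eta>\<theta>_def)
  qed
  have \<eta>\<theta>_shrink: "\<eta>\<theta> n i + (\<Sum>k\<in>Vn n - Vn m. W i k) = \<eta>\<theta> m i" if "m \<le> n" "i \<in> Vn m" for m n i
    using wired_eta_shrink[OF Vn_finite incseqD[OF Vn_incseq that(1)], of i] that(2) Vn_sub[of m]
    by (auto simp: \<eta>\<theta>_def)

  \<comment> \<open>The right-hand side does not involve n.\<close>
  have key: "(\<integral>\<^sup>+\<omega>. ennreal (M n \<omega>) * indicator (\<beta>n m -` A \<inter> space P) \<omega> \<partial>P) =
      ennreal c * (\<integral>\<^sup>+\<beta>. indicator A \<beta> * ennreal (beta_density (Vn m) (\<eta>\<theta> m) \<beta>) \<partial>L m)"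
    if mn: "m \<le> n" and A: "A \<in> sets (B m)" for m n A
  proof -
    let ?D = "Vn n - Vn m"
    have split: "Vn m \<union> ?D = Vn n" using incseqD[OF Vn_incseq mn] by auto
    have ind: "(\<lambda>\<beta>. indicator A (restrict \<beta> (Vn m)) :: ennreal) \<in> borel_measurable (B n)"
      by (rule measurable_compose[OF restr_meas[OF mn] borel_measurable_indicator[OF A]])
    have h: "(\<lambda>\<beta>. ennreal (N n \<beta>) * indicator A (restrict \<beta> (Vn m))) \<in> borel_measurable (B n)"
      by (intro borel_measurable_times_ennreal ind measurable_compose[OF N_meas measurable_ennreal])
    have "(\<integral>\<^sup>+\<omega>. ennreal (M n \<omega>) * indicator (\<beta>n m -` A \<inter> space P) \<omega> \<partial>P) =
        (\<integral>\<^sup>+\<omega>. ennreal (N n (\<beta>n n \<omega>)) * indicator A (restrict (\<beta>n n \<omega>) (Vn m)) \<partial>P)"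
      by (intro nn_integral_cong) (simp add: M_N restr[OF mn] indicator_def)
    also have "\<dots> = (\<integral>\<^sup>+\<beta>. ennreal (N n \<beta>) * indicator A (restrict \<beta> (Vn m)) *
        ennreal (beta_density (Vn n) (wired_eta (Vn n)) \<beta>) \<partial>L n)"
      by (rule law[OF h])
    also have "\<dots> = (\<integral>\<^sup>+\<beta>. ennreal c * (indicator A (restrict \<beta> (Vn m)) * ennreal (beta_density (Vn n) (\<eta>\<theta> n) \<beta>)) \<partial>L n)"
    proof (intro nn_integral_cong)
      fix \<beta> assume "\<beta> \<in> space (L n)"
      then have "N n \<beta> * beta_density (Vn n) (wired_eta (Vn n)) \<beta> = c * beta_density (Vn n) (\<eta>\<theta> n) \<beta>"
        unfolding N_def c_def \<eta>\<theta>_def space_L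
        by (intro wired_graph.exp_functional_tilt[OF wg f_recovers _ finS subS \<theta>_S])
      then have "ennreal (N n \<beta>) * ennreal (beta_density (Vn n) (wired_eta (Vn n)) \<beta>) =
          ennreal c * ennreal (beta_density (Vn n) (\<eta>\<theta> n) \<beta>)"
        using N_pos[of n \<beta>] by (simp add: ennreal_mult'[symmetric] c_def less_imp_le)
      then show "ennreal (N n \<beta>) * indicator A (restrict \<beta> (Vn m)) * ennreal (beta_density (Vn n) (wired_eta (Vn n)) \<beta>) =
          ennreal c * (indicator A (restrict \<beta> (Vn m)) * ennreal (beta_density (Vn n) (\<eta>\<theta> n) \<beta>))"
        by (metis mult.assoc mult.left_commute)
    qed
    also have "\<dots> = ennreal c * (\<integral>\<^sup>+\<beta>. indicator A (restrict \<beta> (Vn m)) * ennreal (beta_density (Vn n) (\<eta>\<theta> n) \<beta>) \<partial>L n)"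
    proof (rule nn_integral_cmult)
      show "(\<lambda>\<beta>. indicator A (restrict \<beta> (Vn m)) * ennreal (beta_density (Vn n) (\<eta>\<theta> n) \<beta>)) \<in> borel_measurable (L n)"
      proof (rule borel_measurable_times_ennreal)
        show "(\<lambda>\<beta>. indicator A (restrict \<beta> (Vn m)) :: ennreal) \<in> borel_measurable (L n)"
          using ind by (subst measurable_cong_sets[OF sets_L refl])
        show "(\<lambda>\<beta>. ennreal (beta_density (Vn n) (\<eta>\<theta> n) \<beta>)) \<in> borel_measurable (L n)"
          unfolding L_def by (rule measurable_compose[OF borel_measurable_beta_density[OF Vn_finite] measurable_ennreal])
      qed
    qed
    \<comment> \<open>Integrate out the vertices of V(n) - V(m).\<close>
    also have "(\<integral>\<^sup>+\<beta>. indicator A (restrict \<beta> (Vn m)) * ennreal (beta_density (Vn n) (\<eta>\<theta> n) \<beta>) \<partial>L n) =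
        (\<integral>\<^sup>+\<beta>. indicator A \<beta> * ennreal (beta_density (Vn m) (\<lambda>i. \<eta>\<theta> n i + (\<Sum>k\<in>?D. W i k)) \<beta>) \<partial>L m)"
      unfolding L_def
    proof (rule beta_density_marginal_set[of ?D "Vn m", unfolded split])
      show "(indicator A :: _ \<Rightarrow> ennreal) \<in> borel_measurable (\<Pi>\<^sub>M i\<in>Vn m. lborel)"
        using A sets_L[of m] by (intro borel_measurable_indicator) (simp add: L_def)
    qed (use Vn_finite \<eta>\<theta>_nonneg \<eta>\<theta>_boundary in auto)
    also have "beta_density (Vn m) (\<lambda>i. \<eta>\<theta> n i + (\<Sum>k\<in>?D. W i k)) = beta_density (Vn m) (\<eta>\<theta> m)"
      by (rule beta_density_cong) (rule \<eta>\<theta>_shrink[OF mn])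
    finally show ?thesis .
  qed

  have int: "integrable P (M n)" for n
  proof (rule integrableI_nonneg[OF M_P])
    show "AE \<omega> in P. 0 \<le> M n \<omega>" using N_pos by (simp add: M_N less_imp_le)
    have "(\<integral>\<^sup>+\<omega>. ennreal (M n \<omega>) \<partial>P) =
        (\<integral>\<^sup>+\<omega>. ennreal (M n \<omega>) * indicator (\<beta>n n -` space (B n) \<inter> space P) \<omega> \<partial>P)"
      using \<beta>n_space[of n] by (intro nn_integral_cong) (auto simp: indicator_def)
    also have "\<dots> = ennreal c * (\<integral>\<^sup>+\<beta>. indicator (space (B n)) \<beta> * ennreal (beta_density (Vn n) (\<eta>\<theta> n) \<beta>) \<partial>L n)"
      by (rule key) auto
    also have "(\<integral>\<^sup>+\<beta>. indicator (space (B n)) \<beta> * ennreal (beta_density (Vn n) (\<eta>\<theta> n) \<beta>) \<partial>L n) =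
        (\<integral>\<^sup>+\<beta>. ennreal (beta_density (Vn n) (\<eta>\<theta> n) \<beta>) \<partial>L n)"
      by (intro nn_integral_cong) (simp add: space_L space_B)
    also have "\<dots> = 1"
      unfolding L_def by (rule beta_density_total_mass[OF Vn_finite \<eta>\<theta>_nonneg \<eta>\<theta>_boundary])
    finally show "(\<integral>\<^sup>+\<omega>. ennreal (M n \<omega>) \<partial>P) < \<infinity>" by (simp add: ennreal_mult_less_top)
  qed

  have cond: "AE \<omega> in P. real_cond_exp P (F m) (M n) \<omega> = M m \<omega>" if mn: "m \<le> n" for m n
  proof -
    interpret finite_measure_subalgebra P "F m"
      by (intro finite_measure_subalgebra.intro finite_measure_subalgebra_axioms.intro
          P.finite_measure_axioms sub)
    show ?thesis
    proof (rule real_cond_exp_charact[OF _ int int M_F])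
      fix X assume X: "X \<in> sets (F m)"
      then obtain A where A: "A \<in> sets (B m)" "X = \<beta>n m -` A \<inter> space P" by (auto simp: sets_F)
      have X_P: "X \<in> sets P" using X sub[of m] by (auto simp: subalgebra_def)
      have "(\<integral>\<omega>\<in>X. M k \<omega> \<partial>P) =
          enn2real (ennreal c * (\<integral>\<^sup>+\<beta>. indicator A \<beta> * ennreal (beta_density (Vn m) (\<eta>\<theta> m) \<beta>) \<partial>L m))"
        if "m \<le> k" for k
      proof -
        have "(\<integral>\<omega>\<in>X. M k \<omega> \<partial>P) = enn2real (\<integral>\<^sup>+\<omega>. ennreal (indicator X \<omega> *\<^sub>R M k \<omega>) \<partial>P)"
          unfolding set_lebesgue_integral_def
        proof (rule integral_eq_nn_integral)
          show "(\<lambda>\<omega>. indicator X \<omega> *\<^sub>R M k \<omega>) \<in> borel_measurable P"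
            using M_P X_P by simp
        qed (simp add: M_N less_imp_le[OF N_pos])
        also have "(\<integral>\<^sup>+\<omega>. ennreal (indicator X \<omega> *\<^sub>R M k \<omega>) \<partial>P) = (\<integral>\<^sup>+\<omega>. ennreal (M k \<omega>) * indicator X \<omega> \<partial>P)"
          by (intro nn_integral_cong) (simp add: indicator_def)
        finally show ?thesis unfolding A(2) key[OF that A(1)] .
      qed
      from this[OF mn] this[OF order_refl] show "(\<integral>\<omega>\<in>X. M n \<omega> \<partial>P) = (\<integral>\<omega>\<in>X. M m \<omega> \<partial>P)" by simp
    qed
  qed

  show ?thesis
    unfolding is_martingale_def using filt sub M_F int cond by blast
qed

end
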